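(* Let $\mathcal{P}$ be an orthogonal term graph rewriting system (a finite set of evaluation rules such that the term rewriting system $\mathcal{U}[\mathcal{P}]=\{\mathcal{U}[p]\mid p\in\mathcal{P}\}$ is orthogonal). Consider the rewriting system whose states are all pointed term graphs $(G,n)$ over $\Sigma$ and whose reduction sequences $\mathcal{S}(\mathcal{P})$ are all finite sequences of direct derivations using rules of $\mathcal{P}$ such that the track function maps the distinguished node to the distinguished node; and the rational TRS whose states are the rational terms $CT_\Sigma^{rat}$, with rules $\mathcal{U}[\mathcal{P}]$ and reduction sequences all finite rational parallel reduction sequences using rules of $\mathcal{U}[\mathcal{P}]$. Let $\mathcal{U}$ map a pointed graph $(G,n)$ to $\mathcal{U}_G[n]$. Then: (1) [Surjectivity] $\mathcal{U}$ is surjective onto $CT_\Sigma^{rat}$; (2) [Weak preservation of normal forms] if $(G,n)$ is in normal form then $\mathcal{U}_G[n]$ is in normal form; (3) [Preservation of reductions] if $a\Rightarrow^* a'$ via a sequence in $\mathcal{S}(\mathcal{P})$, then $\mathcal{U}[a]\rightarrow^*\mathcal{U}[a']$ via a rational parallel reduction sequence; (4) [Cofinality] for any pointed graph $a$ and rational term $b$, if $\mathcal{U}[a]\rightarrow^* b$ via a rational parallel reduction sequence, then there is a pointed graph $a'$ with $a\Rightarrow^* a'$ in $\mathcal{S}(\mathcal{P})$ and $b\rightarrow^*\mathcal{U}[a']$ via a rational parallel reduction sequence.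
   Context: Terms: occurrences are finite strings of positive naturals. A term over $\Sigma,X$ is a partial function $t:\omega^*\to\Sigma\cup X$ with prefix-closed domain $\mathcal{O}(t)$ where $wi\in\mathcal{O}(t)$ implies $t(w)$ is an operator of arity $\ge i$; $\bot$ is the empty term; terms are ordered by $t\le t'$ iff $t$ is less defined as a partial function (a cpo). A term is rational if it has finitely many distinct subterms $t/w$ ($t/w(u)=t(wu)$). A rule $l\to r$: total terms, $var(r)\subseteq var(l)$, $l$ finite and not a variable; a redex of $t$ is $(w,R)$ with $t/w=l\sigma$, reducing to $t[w\leftarrow r\sigma]$. Orthogonal: left-linear and non-overlapping. Finite parallel reduction $t\to_\Phi t'$ for a finite set $\Phi$ of redexes: result of any complete development of $\Phi$ (reducing residuals of $\Phi$ until none remain). For an infinite (countable) set $\Phi$ of redexes: choose a chain $t_0\le t_1\le\dots$ with lub $t$ such that each $(w,R)\in\Phi$ is a redex of $t_i$ or $t_i(w)=\bot$, and only finitely many redexes $\Phi_i\subseteq\Phi$ are redexes of $t_i$; then $t\to_\Phi\bigcup_i d_i$ where $t_i\to_{\Phi_i}d_i$ (well defined). A parallel reduction $t\to_\Phi t'$ is rational if the term obtained by marking in $t$ all occurrences of redexes of $\Phi$ is rational; a rational parallel reduction sequence has every step rational. Term graphs $G=(N_G,s_G,l_G)$: finite node set, partial successor $s_G:N_G\to N_G^*$ and labelling $l_G:N_G\to\Sigma$ defined on the same nodes with $|s_G(n)|$ = arity of $l_G(n)$; unlabelled nodes are variable nodes $\mathrm{var}(G)$. Morphisms preserve labels and successors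 on labelled nodes. Paths follow successor positions; the occurrence of a path is its sequence of positions. Unraveling $\mathcal{U}_G[n](w)$ is $n'$ (if the path from $n$ with occurrence $w$ ends in variable node $n'$), $l_G(n')$ (if it ends in labelled $n'$), or $\bot$ (no such path). A pointed graph is a graph with a distinguished node. Evaluation rule $p=(L\stackrel{l}{\leftarrow}K\stackrel{r}{\rightarrow}R)$: injective morphisms; $L$ a tree (unique path from root $\underline n$ to every node), not a single unlabelled node; $K$ is $L$ with labelling/successor undefined at $\underline n$, $l$ the inclusion; $r$ restricts to a bijection $\mathrm{var}(L)\to\mathrm{var}(R)$. Its unraveling $\mathcal{U}[p]$ is the term rule $\mathcal{U}_L[\underline n]\to\mathcal{U}_R[r(\underline n)]\tau$ with $\tau(x)=y$ iff $r(y)=x$. A direct derivation $G\Rightarrow_{p,g}H$ for a morphism $g:L\to G$ is a double-pushout diagram in the category of term graphs with context $D$ (same nodes as $G$) and $b:D\to H$; the track function is $tr=b:N_G\to N_H$. A pointed graph is in normal form if no direct derivation applies to it (no rule of $\mathcal{P}$ has a morphism from its left-hand side into the graph); a term is in normal form if it has no redex of a rule of $\mathcal{U}[\mathcal{P}]$.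
   Formalization: Proved in two readings, as literally ⊥ is no unraveling and derivations may rename variable nodes: (A) variable nodes unravel to ⊥, onto all variable-free rational terms; (B) U as defined, onto total rational terms with nodes as variables, for derivations whose track function fixes variable nodes. *)

theory Defs
  imports Main "HOL-Library.Sublist"
begin

section \<open>Partial and infinite terms\<close>

text \<open>
  A signature is a type \<open>'f\<close> of operators with an arity function \<open>ar\<close>.
  A term is a partial function on occurrences; \<open>Inl f\<close> is an operator, \<open>Inr x\<close> a variable and
  \<^term>\<open>Map.empty\<close> is the empty term \<open>\<bottom>\<close>. Occurrences are lists of positive numbers
  (the clause \<open>1 \<le> i\<close> in \<open>is_term\<close>), so argument positions are counted from 1.
\<close>

type_synonym occ = "nat list"
type_synonym ('f, 'v) pterm = "occ \<Rightarrow> ('f + 'v) option"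

definition is_term :: "('f \<Rightarrow> nat) \<Rightarrow> ('f, 'v) pterm \<Rightarrow> bool" where
  "is_term ar t \<longleftrightarrow>
     (\<forall>w i. t (w @ [i]) \<noteq> None \<longrightarrow> (\<exists>f. t w = Some (Inl f) \<and> 1 \<le> i \<and> i \<le> ar f))"

definition tvars :: "('f, 'v) pterm \<Rightarrow> 'v set" where
  "tvars t = {x. \<exists>w. t w = Some (Inr x)}"

text \<open>The clause \<open>t [] \<noteq> None\<close> excludes \<open>\<bottom>\<close>, of which the other clause holds vacuously.\<close>

definition total_term :: "('f \<Rightarrow> nat) \<Rightarrow> ('f, 'v) pterm \<Rightarrow> bool" where
  "total_term ar t \<longleftrightarrow>
     t [] \<noteq> None \<and>
     (\<forall>w f i. t w = Some (Inl f) \<longrightarrow> 1 \<le> i \<longrightarrow> i \<le> ar f \<longrightarrow> t (w @ [i]) \<noteq> None)"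

definition linear_term :: "('f, 'v) pterm \<Rightarrow> bool" where
  "linear_term t \<longleftrightarrow> (\<forall>u v x. t u = Some (Inr x) \<longrightarrow> t v = Some (Inr x) \<longrightarrow> u = v)"

definition subterm :: "('f, 'v) pterm \<Rightarrow> occ \<Rightarrow> ('f, 'v) pterm" where
  "subterm t w = (\<lambda>u. t (w @ u))"

text \<open>
  Here \<open>w\<close> ranges over all lists; outside the domain of \<open>t\<close> this only adds \<open>\<bottom>\<close> to the set
  of subterms.
\<close>

definition rational :: "('f, 'v) pterm \<Rightarrow> bool" where
  "rational t \<longleftrightarrow> finite (range (subterm t))"

definition CT :: "('f \<Rightarrow> nat) \<Rightarrow> 'v set \<Rightarrow> ('f, 'v) pterm set" where
  "CT ar X = {t. is_term ar t \<and> tvars t \<subseteq> X}"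

definition CT_rat :: "('f \<Rightarrow> nat) \<Rightarrow> 'v set \<Rightarrow> ('f, 'v) pterm set" where
  "CT_rat ar X = {t \<in> CT ar X. rational t}"

fun subst :: "('f, 'v) pterm \<Rightarrow> ('v \<Rightarrow> ('f, 'x) pterm) \<Rightarrow> ('f, 'x) pterm" where
  "subst t \<sigma> [] = (case t [] of None \<Rightarrow> None | Some (Inl f) \<Rightarrow> Some (Inl f) | Some (Inr x) \<Rightarrow> \<sigma> x [])"
| "subst t \<sigma> (i # w) =
     (case t [] of Some (Inr x) \<Rightarrow> \<sigma> x (i # w) | _ \<Rightarrow> subst (subterm t [i]) \<sigma> w)"

definition tvar :: "'v \<Rightarrow> ('f, 'v) pterm" where
  "tvar x = [[] \<mapsto> Inr x]"

definition replace_at :: "('f, 'v) pterm \<Rightarrow> occ \<Rightarrow> ('f, 'v) pterm \<Rightarrow> ('f, 'v) pterm" where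
  "replace_at t w s = (\<lambda>u. if prefix w u then s (drop (length w) u) else t u)"

text \<open>The order on terms is the library's \<open>\<subseteq>\<^sub>m\<close>.\<close>

definition term_chain :: "(nat \<Rightarrow> ('f, 'v) pterm) \<Rightarrow> bool" where
  "term_chain T \<longleftrightarrow> (\<forall>i. T i \<subseteq>\<^sub>m T (Suc i))"

definition is_lub_term :: "('f \<Rightarrow> nat) \<Rightarrow> (nat \<Rightarrow> ('f, 'v) pterm) \<Rightarrow> ('f, 'v) pterm \<Rightarrow> bool" where
  "is_lub_term ar T t \<longleftrightarrow>
     is_term ar t \<and> (\<forall>i. T i \<subseteq>\<^sub>m t) \<and>
     (\<forall>u. is_term ar u \<longrightarrow> (\<forall>i. T i \<subseteq>\<^sub>m u) \<longrightarrow> t \<subseteq>\<^sub>m u)"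


section \<open>Term rewriting and parallel reduction\<close>

type_synonym ('f, 'v) trule = "('f, 'v) pterm \<times> ('f, 'v) pterm"
type_synonym ('f, 'v) redex = "occ \<times> ('f, 'v) trule"

definition is_trule :: "('f \<Rightarrow> nat) \<Rightarrow> ('f, 'v) trule \<Rightarrow> bool" where
  "is_trule ar = (\<lambda>(l, r).
     is_term ar l \<and> is_term ar r \<and> total_term ar l \<and> total_term ar r \<and>
     tvars r \<subseteq> tvars l \<and> finite (dom l) \<and> (\<forall>x. l \<noteq> tvar x))"

text \<open>
  Overlap is unifiability of two left-hand sides whose variables have been renamed apart, hence
  the two independent substitutions. Two rules are identified only if they are equal, so a rule
  overlaps with a renamed copy of itself.
\<close>

definition non_overlapping :: "('f \<Rightarrow> nat) \<Rightarrow> ('f, 'v) trule set \<Rightarrow> bool" where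
  "non_overlapping ar S \<longleftrightarrow>
     (\<forall>(l, r) \<in> S. \<forall>(l', r') \<in> S. \<forall>w f. \<forall>\<sigma> \<sigma>' :: 'v \<Rightarrow> ('f, 'v) pterm.
        l w = Some (Inl f) \<longrightarrow> (\<forall>x. is_term ar (\<sigma> x)) \<longrightarrow> (\<forall>x. is_term ar (\<sigma>' x)) \<longrightarrow>
        subst (subterm l w) \<sigma> = subst l' \<sigma>' \<longrightarrow> w = [] \<and> (l, r) = (l', r'))"

definition orthogonal_trs :: "('f \<Rightarrow> nat) \<Rightarrow> ('f, 'v) trule set \<Rightarrow> bool" where
  "orthogonal_trs ar S \<longleftrightarrow>
     (\<forall>R \<in> S. is_trule ar R) \<and> (\<forall>(l, r) \<in> S. linear_term l) \<and> non_overlapping ar S"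

definition is_redex :: "('f \<Rightarrow> nat) \<Rightarrow> ('f, 'x) pterm \<Rightarrow> ('f, 'v) redex \<Rightarrow> bool" where
  "is_redex ar t = (\<lambda>(w, l, r).
     \<exists>\<sigma>. (\<forall>x. is_term ar (\<sigma> x)) \<and> subterm t w = subst l \<sigma>)"

definition reduces ::
  "('f \<Rightarrow> nat) \<Rightarrow> ('f, 'x) pterm \<Rightarrow> ('f, 'v) redex \<Rightarrow> ('f, 'x) pterm \<Rightarrow> bool" where
  "reduces ar t = (\<lambda>(w, l, r) t'.
     \<exists>\<sigma>. (\<forall>x. is_term ar (\<sigma> x)) \<and> subterm t w = subst l \<sigma> \<and>
         t' = replace_at t w (subst r \<sigma>))"

text \<open>
  Residuals of the second redex after reducing the first. A redex strictly below the reduced one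
  lies, by orthogonality, below an occurrence \<open>v\<close> of a variable \<open>x\<close> of the left-hand side, and is
  copied to every occurrence of \<open>x\<close> in the right-hand side (possibly infinitely many, since
  right-hand sides may be infinite).
\<close>

fun residuals :: "('f, 'v) redex \<Rightarrow> ('f, 'v) redex \<Rightarrow> ('f, 'v) redex set" where
  "residuals (w, l, r) (w', R') =
     (if (w', R') = (w, l, r) then {}
      else if \<not> prefix w w' then {(w', R')}
      else {(w @ u @ v', R') | u v v' x.
              w' = w @ v @ v' \<and> l v = Some (Inr x) \<and> r u = Some (Inr x)})"

inductive complete_dev ::
  "('f \<Rightarrow> nat) \<Rightarrow> ('f, 'x) pterm \<Rightarrow> ('f, 'v) redex set \<Rightarrow> ('f, 'x) pterm \<Rightarrow> bool"
  for ar :: "'f \<Rightarrow> nat" where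
  finished: "complete_dev ar t {} t"
| step: "\<lbrakk>\<Delta> \<in> \<Phi>; reduces ar t \<Delta> t'; complete_dev ar t' (\<Union>\<Delta>' \<in> \<Phi>. residuals \<Delta> \<Delta>') t''\<rbrakk>
         \<Longrightarrow> complete_dev ar t \<Phi> t''"

definition inf_par_red ::
  "('f \<Rightarrow> nat) \<Rightarrow> ('f, 'x) pterm \<Rightarrow> ('f, 'v) redex set \<Rightarrow> ('f, 'x) pterm \<Rightarrow> bool" where
  "inf_par_red ar t \<Phi> t' \<longleftrightarrow>
     (\<exists>T d. (\<forall>i. is_term ar (T i)) \<and> term_chain T \<and> is_lub_term ar T t \<and>
        (\<forall>i. \<forall>\<Delta> \<in> \<Phi>. is_redex ar (T i) \<Delta> \<or> T i (fst \<Delta>) = None) \<and>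
        (\<forall>i. finite {\<Delta> \<in> \<Phi>. is_redex ar (T i) \<Delta>}) \<and>
        (\<forall>i. complete_dev ar (T i) {\<Delta> \<in> \<Phi>. is_redex ar (T i) \<Delta>} (d i)) \<and>
        is_lub_term ar d t')"

text \<open>
  A set of redexes for a finite set \<open>S\<close> of rules is always countable, so countability need not be
  required.
\<close>

definition par_red ::
  "('f \<Rightarrow> nat) \<Rightarrow> ('f, 'v) trule set \<Rightarrow> ('f, 'x) pterm \<Rightarrow> ('f, 'v) redex set \<Rightarrow> ('f, 'x) pterm \<Rightarrow> bool"
where
  "par_red ar S t \<Phi> t' \<longleftrightarrow>
     (\<forall>\<Delta> \<in> \<Phi>. snd \<Delta> \<in> S \<and> is_redex ar t \<Delta>) \<and>
     (if finite \<Phi> then complete_dev ar t \<Phi> t' else inf_par_red ar t \<Phi> t')"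

definition mark :: "occ set \<Rightarrow> ('f, 'x) pterm \<Rightarrow> ('f \<times> bool, 'x) pterm" where
  "mark W t = (\<lambda>w. map_option (map_sum (\<lambda>f. (f, w \<in> W)) id) (t w))"

definition rat_par_step ::
  "('f \<Rightarrow> nat) \<Rightarrow> ('f, 'v) trule set \<Rightarrow> ('f, 'x) pterm \<Rightarrow> ('f, 'x) pterm \<Rightarrow> bool" where
  "rat_par_step ar S t t' \<longleftrightarrow> (\<exists>\<Phi>. par_red ar S t \<Phi> t' \<and> rational (mark (fst ` \<Phi>) t))"

definition term_normal_form ::
  "('f \<Rightarrow> nat) \<Rightarrow> ('f, 'v) trule set \<Rightarrow> ('f, 'x) pterm \<Rightarrow> bool" where
  "term_normal_form ar S t \<longleftrightarrow> \<not> (\<exists>w. \<exists>R \<in> S. is_redex ar t (w, R))"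


section \<open>Term graphs\<close>

record ('f, 'n) tgraph =
  nodes :: "'n set"
  sucs :: "'n \<Rightarrow> 'n list option"
  lab :: "'n \<Rightarrow> 'f option"

definition is_graph :: "('f \<Rightarrow> nat) \<Rightarrow> ('f, 'n) tgraph \<Rightarrow> bool" where
  "is_graph ar G \<longleftrightarrow>
     finite (nodes G) \<and> dom (lab G) = dom (sucs G) \<and> dom (lab G) \<subseteq> nodes G \<and>
     (\<forall>n f ns. lab G n = Some f \<longrightarrow> sucs G n = Some ns \<longrightarrow>
        length ns = ar f \<and> set ns \<subseteq> nodes G)"

definition var_nodes :: "('f, 'n) tgraph \<Rightarrow> 'n set" where
  "var_nodes G = {n \<in> nodes G. lab G n = None}"

text \<open>
  Morphisms are functions on the node type; only their values on the nodes of the source matter,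
  and equality of morphisms is equality on those nodes.
\<close>

definition morphism :: "('f, 'n) tgraph \<Rightarrow> ('f, 'm) tgraph \<Rightarrow> ('n \<Rightarrow> 'm) \<Rightarrow> bool" where
  "morphism G H h \<longleftrightarrow>
     (\<forall>n \<in> nodes G. h n \<in> nodes H) \<and>
     (\<forall>n \<in> nodes G. lab G n \<noteq> None \<longrightarrow>
        lab H (h n) = lab G n \<and> sucs H (h n) = map_option (map h) (sucs G n))"

text \<open>
  A path from a given node is determined by its occurrence; \<open>path_end G n w\<close> is the node in
  which the path from \<open>n\<close> with occurrence \<open>w\<close> ends, if there is such a path.
\<close>

fun path_end :: "('f, 'n) tgraph \<Rightarrow> 'n \<Rightarrow> occ \<Rightarrow> 'n option" where
  "path_end G n [] = Some n"
| "path_end G n (i # w) =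
     (case sucs G n of
        None \<Rightarrow> None
      | Some ns \<Rightarrow> if 1 \<le> i \<and> i \<le> length ns then path_end G (ns ! (i - 1)) w else None)"

definition unravel :: "('f, 'n) tgraph \<Rightarrow> 'n \<Rightarrow> ('f, 'n) pterm" where
  "unravel G n = (\<lambda>w.
     case path_end G n w of
       None \<Rightarrow> None
     | Some m \<Rightarrow> (case lab G m of None \<Rightarrow> Some (Inr m) | Some f \<Rightarrow> Some (Inl f)))"

definition is_tree :: "('f, 'n) tgraph \<Rightarrow> 'n \<Rightarrow> bool" where
  "is_tree G n \<longleftrightarrow> n \<in> nodes G \<and> (\<forall>m \<in> nodes G. \<exists>!w. path_end G n w = Some m)"

definition unlabel :: "('f, 'n) tgraph \<Rightarrow> 'n \<Rightarrow> ('f, 'n) tgraph" where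
  "unlabel G n = G\<lparr>sucs := (sucs G)(n := None), lab := (lab G)(n := None)\<rparr>"


section \<open>Term graph rewriting\<close>

text \<open>The morphism from the interface to the left-hand side is the inclusion, so it is not stored.\<close>

record ('f, 'n) grule =
  lhs :: "('f, 'n) tgraph"
  itf :: "('f, 'n) tgraph"
  rhs :: "('f, 'n) tgraph"
  rmor :: "'n \<Rightarrow> 'n"
  rt :: "'n"

definition evaluation_rule :: "('f \<Rightarrow> nat) \<Rightarrow> ('f, 'n) grule \<Rightarrow> bool" where
  "evaluation_rule ar p \<longleftrightarrow>
     is_graph ar (lhs p) \<and> is_graph ar (itf p) \<and> is_graph ar (rhs p) \<and>
     is_tree (lhs p) (rt p) \<and>
     \<not> (nodes (lhs p) = {rt p} \<and> lab (lhs p) (rt p) = None) \<and>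
     itf p = unlabel (lhs p) (rt p) \<and> morphism (itf p) (lhs p) id \<and>
     morphism (itf p) (rhs p) (rmor p) \<and> inj_on (rmor p) (nodes (itf p)) \<and>
     bij_betw (rmor p) (var_nodes (lhs p)) (var_nodes (rhs p))"

definition unravel_rule :: "('f, 'n) grule \<Rightarrow> ('f, 'n) trule" where
  "unravel_rule p =
     (unravel (lhs p) (rt p),
      subst (unravel (rhs p) (rmor p (rt p)))
        (\<lambda>x. tvar (THE y. y \<in> var_nodes (lhs p) \<and> rmor p y = x)))"

definition orthogonal_tgrs :: "('f \<Rightarrow> nat) \<Rightarrow> ('f, 'n) grule set \<Rightarrow> bool" where
  "orthogonal_tgrs ar P \<longleftrightarrow>
     finite P \<and> (\<forall>p \<in> P. evaluation_rule ar p) \<and> orthogonal_trs ar (unravel_rule ` P)"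

text \<open>
  \<open>is_pushout ar K A B f g C i j\<close>: the square with \<open>f : K \<rightarrow> A\<close>, \<open>g : K \<rightarrow> B\<close>,
  \<open>i : A \<rightarrow> C\<close>, \<open>j : B \<rightarrow> C\<close> is a pushout. Test objects have their nodes in the same type
  \<open>'n\<close>; since graphs are finite, this is no restriction if \<open>'n\<close> is infinite.
\<close>

definition is_pushout ::
  "('f \<Rightarrow> nat) \<Rightarrow> ('f, 'n) tgraph \<Rightarrow> ('f, 'n) tgraph \<Rightarrow> ('f, 'n) tgraph \<Rightarrow> ('n \<Rightarrow> 'n) \<Rightarrow> ('n \<Rightarrow> 'n) \<Rightarrow>
   ('f, 'n) tgraph \<Rightarrow> ('n \<Rightarrow> 'n) \<Rightarrow> ('n \<Rightarrow> 'n) \<Rightarrow> bool" where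
  "is_pushout ar K A B f g C i j \<longleftrightarrow>
     is_graph ar K \<and> is_graph ar A \<and> is_graph ar B \<and> is_graph ar C \<and>
     morphism K A f \<and> morphism K B g \<and> morphism A C i \<and> morphism B C j \<and>
     (\<forall>x \<in> nodes K. i (f x) = j (g x)) \<and>
     (\<forall>(X :: ('f, 'n) tgraph) i' j'. is_graph ar X \<longrightarrow> morphism A X i' \<longrightarrow> morphism B X j' \<longrightarrow>
        (\<forall>x \<in> nodes K. i' (f x) = j' (g x)) \<longrightarrow>
        (\<exists>h. morphism C X h \<and> (\<forall>x \<in> nodes A. h (i x) = i' x) \<and> (\<forall>x \<in> nodes B. h (j x) = j' x) \<and>
           (\<forall>h'. morphism C X h' \<longrightarrow> (\<forall>x \<in> nodes A. h' (i x) = i' x) \<longrightarrow>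
              (\<forall>x \<in> nodes B. h' (j x) = j' x) \<longrightarrow> (\<forall>x \<in> nodes C. h' x = h x))))"

text \<open>
  \<open>direct_derivation ar p g G b H\<close>: both squares of
  \<open>L \<leftarrow> K \<rightarrow> R\<close> over \<open>G \<leftarrow> D \<rightarrow> H\<close> are pushouts, with left vertical map \<open>g\<close> and track function \<open>b\<close>.
  The context \<open>D\<close> has to be given explicitly: it is \<open>G\<close> with label and successors removed at the
  image of the root, just as \<open>K\<close> arises from \<open>L\<close>. Being a pushout complement does not determine it,
  because \<open>D = G\<close> would make the left square a pushout as well. As the map from \<open>D\<close> to \<open>G\<close> is the
  inclusion, the map from \<open>K\<close> to \<open>D\<close> is the restriction of \<open>g\<close>.
\<close>

definition direct_derivation ::
  "('f \<Rightarrow> nat) \<Rightarrow> ('f, 'n) grule \<Rightarrow> ('n \<Rightarrow> 'n) \<Rightarrow> ('f, 'n) tgraph \<Rightarrow> ('n \<Rightarrow> 'n) \<Rightarrow> ('f, 'n) tgraph \<Rightarrow> bool"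
where
  "direct_derivation ar p g G b H \<longleftrightarrow>
     (let D = unlabel G (g (rt p)) in
        is_pushout ar (itf p) (lhs p) D id g G g id \<and>
        (\<exists>h. is_pushout ar (itf p) (rhs p) D (rmor p) g H h b))"

type_synonym ('f, 'n) pgraph = "('f, 'n) tgraph \<times> 'n"

definition pointed_graphs :: "('f \<Rightarrow> nat) \<Rightarrow> ('f, 'n) pgraph set" where
  "pointed_graphs ar = {(G, n). is_graph ar G \<and> n \<in> nodes G}"

definition graph_step ::
  "('f \<Rightarrow> nat) \<Rightarrow> ('f, 'n) grule set \<Rightarrow> ('f, 'n) pgraph \<Rightarrow> ('f, 'n) pgraph \<Rightarrow> bool" where
  "graph_step ar P = (\<lambda>(G, n) (H, m).
     \<exists>p \<in> P. \<exists>g b. direct_derivation ar p g G b H \<and> b n = m)"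

text \<open>
  A pushout object is determined up to isomorphism only, so variable nodes may change their names
  in a direct derivation. The next relation picks out the derivations that keep these names; every
  direct derivation is isomorphic to one of them. It matters if the names of variable nodes are
  used as variables of terms.
\<close>

definition graph_step_names ::
  "('f \<Rightarrow> nat) \<Rightarrow> ('f, 'n) grule set \<Rightarrow> ('f, 'n) pgraph \<Rightarrow> ('f, 'n) pgraph \<Rightarrow> bool" where
  "graph_step_names ar P = (\<lambda>(G, n) (H, m).
     \<exists>p \<in> P. \<exists>g b. direct_derivation ar p g G b H \<and> b n = m \<and> (\<forall>x \<in> var_nodes G. b x = x))"

definition graph_normal_form :: "('f \<Rightarrow> nat) \<Rightarrow> ('f, 'n) grule set \<Rightarrow> ('f, 'n) pgraph \<Rightarrow> bool" where
  "graph_normal_form ar P = (\<lambda>(G, n). \<not> (\<exists>p \<in> P. \<exists>g b H. direct_derivation ar p g G b H))"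

definition unravel_pointed :: "('f, 'n) pgraph \<Rightarrow> ('f, 'n) pterm" where
  "unravel_pointed = (\<lambda>(G, n). unravel G n)"

text \<open>
  The unraveling as a term without variables: variable nodes, which carry no operator, become
  undefined.
\<close>

definition unravel_ground :: "('f, 'n) pgraph \<Rightarrow> ('f, 'n) pterm" where
  "unravel_ground a = subst (unravel_pointed a) (\<lambda>_. Map.empty)"


section \<open>Adequacy\<close>

definition adequate ::
  "'a set \<Rightarrow> ('a \<Rightarrow> 'a \<Rightarrow> bool) \<Rightarrow> ('a \<Rightarrow> bool) \<Rightarrow>
   'b set \<Rightarrow> ('b \<Rightarrow> 'b \<Rightarrow> bool) \<Rightarrow> ('b \<Rightarrow> bool) \<Rightarrow> ('a \<Rightarrow> 'b) \<Rightarrow> bool" where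
  "adequate A redA nfA B redB nfB U \<longleftrightarrow>
     U ` A = B \<and>
     (\<forall>a \<in> A. nfA a \<longrightarrow> nfB (U a)) \<and>
     (\<forall>a \<in> A. \<forall>a' \<in> A. redA a a' \<longrightarrow> redB (U a) (U a')) \<and>
     (\<forall>a \<in> A. \<forall>b \<in> B. redB (U a) b \<longrightarrow> (\<exists>a' \<in> A. redA a a' \<and> redB b (U a')))"

end

theory Submission
  imports Defs
begin

text \<open>
  Since the morphism \<open>r\<close> of an evaluation rule is injective, the right-hand side of its unraveling is
  never a variable. Contracting an arbitrary, possibly infinite, set of non-overlapping redexes
  is therefore productive and defines a function \<open>dev\<close> on terms with annotated redexes, which
  agrees with finite complete developments and, by continuity, with infinite parallel reduction.
  It satisfies the triangle property: contracting some of the annotated redexes and then the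
  residuals of the others amounts to contracting all of them; and it preserves rationality.

  A direct derivation at a node unravels to the contraction of all occurrences of this node. Reducing
  once every node of a graph that carries a redex therefore unravels to the development \<open>star t\<close> of
  all redexes of the unraveling \<open>t\<close>. By the triangle property \<open>s \<rightarrow> t\<close> implies \<open>t \<rightarrow> star s\<close>, hence the
  iterates of \<open>star\<close> are cofinal, and cofinality of term graph rewriting follows.
\<close>

section \<open>Terms and substitution\<close>

text \<open>Collapsing rules would be fatal: an infinite tower of nested redexes whose right-hand
  side is a variable has no first symbol, so contracting all of them determines nothing. Cyclic
  graphs produce such towers, since one node stands for infinitely many, possibly nested,
  occurrences. With an operator at the root of each right-hand side, a contraction consumes at least
  one position of the word at which the result is read, so induction on \<open>length w\<close> does
  the work of coinduction. The triangle equation \<open>dev_False_dev_True\<close> is instantiated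
  with three choices of redexes: one occurrence (\<open>contract_one\<close>), which makes
  \<open>full_dev\<close> an invariant of complete developments; a rational set of occurrences
  (\<open>rat_par_step_triangle\<close>); all occurrences of one node
  (\<open>contract_nodes\<close>). The substitutions in \<open>non_overlapping\<close> may have
  infinite terms as values. This excludes patterns that fold onto themselves in a cyclic graph, an
  overlap that unification with an occurs check could miss.\<close>

lemma subterm_Nil [simp]: "subterm t [] = t"
  by (simp add: subterm_def)

lemma subterm_subterm [simp]: "subterm (subterm t u) v = subterm t (u @ v)"
  by (simp add: subterm_def)

lemma subterm_apply: "subterm t u v = t (u @ v)"
  by (simp add: subterm_def)

lemma subterm_apply_Nil [simp]: "subterm t u [] = t u"
  and subterm_apply_Cons [simp]: "subterm t u (i # v) = t (u @ i # v)"
  by (simp_all add: subterm_def)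

lemma subterm_empty [simp]: "subterm Map.empty w = Map.empty"
  by (simp add: subterm_def)

lemma is_term_subterm: "is_term ar t \<Longrightarrow> is_term ar (subterm t w)"
  unfolding is_term_def subterm_apply by (simp flip: append_assoc)

lemma is_term_snocD:
  "is_term ar t \<Longrightarrow> t (w @ [i]) \<noteq> None \<Longrightarrow> \<exists>f. t w = Some (Inl f) \<and> 1 \<le> i \<and> i \<le> ar f"
  unfolding is_term_def by blast

lemma is_term_prefix_op:
  assumes "is_term ar t" "t (w @ u) \<noteq> None" "u \<noteq> []"
  shows "\<exists>f. t w = Some (Inl f)"
  using assms(2,3)
proof (induction u rule: rev_induct)
  case (snoc i u)
  then obtain f where f: "t (w @ u) = Some (Inl f)"
    using is_term_snocD[OF assms(1), of "w @ u" i] by auto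
  show ?case
    by (cases "u = []") (use f snoc.IH in auto)
qed simp

lemma is_term_var_below:
  "is_term ar t \<Longrightarrow> t w = Some (Inr x) \<Longrightarrow> u \<noteq> [] \<Longrightarrow> t (w @ u) = None"
  using is_term_prefix_op[of ar t w u] by (cases "t (w @ u)") auto

lemma is_term_None_below: "is_term ar t \<Longrightarrow> t w = None \<Longrightarrow> t (w @ u) = None"
  using is_term_prefix_op[of ar t w u] by (cases "u = []"; cases "t (w @ u)") auto

lemma is_term_None_root: "is_term ar t \<Longrightarrow> t [] = None \<Longrightarrow> t = Map.empty"
  using is_term_None_below[of ar t "[]"] by auto

lemma is_term_var_root:
  assumes "is_term ar t" "t [] = Some (Inr x)"
  shows "t = tvar x"
proof
  fix w
  show "t w = tvar x w"
    using is_term_var_below[OF assms, of w] assms(2) by (cases "w = []") (auto simp: tvar_def)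
qed

lemma total_term_subterm:
  "total_term ar t \<Longrightarrow> t w \<noteq> None \<Longrightarrow> total_term ar (subterm t w)"
  unfolding total_term_def subterm_apply by (simp flip: append_assoc)

lemma subst_Inr_root: "s [] = Some (Inr x) \<Longrightarrow> subst s \<sigma> = \<sigma> x"
proof
  fix w
  assume "s [] = Some (Inr x)"
  then show "subst s \<sigma> w = \<sigma> x w"
    by (cases w) auto
qed

lemma subst_empty [simp]: "subst Map.empty \<sigma> = Map.empty"
proof
  show "subst Map.empty \<sigma> w = None" for w
    by (induction w) simp_all
qed

text \<open>The quantifier over \<sigma> is innermost, so that a single case distinction on
  \<open>w\<close> serves two substitutions that are to be compared.\<close>

lemma subst_word:
  fixes s :: "('f, 'v) pterm"
  shows "(\<exists>y. (\<forall>\<sigma>. (subst s \<sigma> :: ('f, 'x) pterm) w = y) \<and> (y = None \<or> (\<exists>f. s w = Some (Inl f) \<and> y = Some (Inl f)))) \<or>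
   (\<exists>x u v. w = u @ v \<and> s u = Some (Inr x) \<and> (\<forall>\<sigma>. (subst s \<sigma> :: ('f, 'x) pterm) w = \<sigma> x v))"
proof (induction w arbitrary: s)
  case Nil
  show ?case
    by (cases "s []"; cases "the (s [])") auto
next
  case (Cons i w)
  show ?case
  proof (cases "\<exists>x. s [] = Some (Inr x)")
    case True
    then show ?thesis
      by auto (metis append_Nil)
  next
    case False
    then have eq: "subst s \<sigma> (i # w) = subst (subterm s [i]) \<sigma> w" for \<sigma> :: "'v \<Rightarrow> ('f, 'x) pterm"
      by (auto split: option.splits sum.splits)
    show ?thesis
      using Cons.IH[of "subterm s [i]"]
    proof (elim disjE exE conjE, goal_cases)
      case (3 x u v)
      then have "i # w = (i # u) @ v \<and> s (i # u) = Some (Inr x) \<and>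
        (\<forall>\<sigma>. (subst s \<sigma> :: ('f, 'x) pterm) (i # w) = \<sigma> x v)"
        using eq by (auto simp del: subst.simps simp add: subterm_apply[of s "[i]" u])
      then show ?case by blast
    qed (simp_all del: subst.simps add: eq subterm_apply[of s "[i]" w])
  qed
qed

lemma subst_at_var:
  assumes "is_term ar s" "s u = Some (Inr x)"
  shows "subst s \<sigma> (u @ v) = \<sigma> x v"
  using assms
proof (induction u arbitrary: s)
  case Nil
  then show ?case by (simp add: subst_Inr_root)
next
  case (Cons i u)
  obtain f where "s [] = Some (Inl f)"
    using is_term_prefix_op[OF Cons.prems(1), of "[]" "i # u"] Cons.prems(2) by auto
  then show ?case
    using Cons.IH[OF is_term_subterm[OF Cons.prems(1)], of "[i]"] Cons.prems(2)
    by (simp add: subterm_apply[of s "[i]" u])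
qed

lemma subst_subterm:
  assumes "is_term ar s" "s u \<noteq> None"
  shows "subterm (subst s \<sigma>) u = subst (subterm s u) \<sigma>"
proof
  fix v
  show "subterm (subst s \<sigma>) u v = subst (subterm s u) \<sigma> v"
    using assms
  proof (induction u arbitrary: s)
    case (Cons i u)
    obtain f where "s [] = Some (Inl f)"
      using is_term_prefix_op[OF Cons.prems(1), of "[]" "i # u"] Cons.prems(2) by auto
    then show ?case
      using Cons.IH[OF is_term_subterm[OF Cons.prems(1)], of "[i]"] Cons.prems(2)
      by (simp add: subterm_apply[of s "[i]" u] subterm_apply[of "subst (subterm s [i]) \<sigma>" u v]
          subterm_apply[of "subst s \<sigma>" "i # u" v])
  qed simp_all
qed

lemma subst_at_op:
  assumes "is_term ar s" "s u = Some (Inl f)"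
  shows "subst s \<sigma> u = Some (Inl f)"
  using subst_subterm[OF assms(1), of u \<sigma>] assms(2)
  by (metis option.distinct(1) option.simps(5) subst.simps(1) subterm_apply_Nil sum.simps(5))

lemma subst_cong_vars:
  fixes \<sigma> \<tau> :: "'v \<Rightarrow> ('f, 'x) pterm"
  assumes "\<And>x. x \<in> tvars s \<Longrightarrow> \<sigma> x = \<tau> x"
  shows "subst s \<sigma> = subst s \<tau>"
proof
  fix w
  show "subst s \<sigma> w = subst s \<tau> w"
    using subst_word[of s w, where ?'x = 'x]
  proof (elim disjE exE conjE, goal_cases)
    case (3 x u v)
    then have "\<sigma> x = \<tau> x" using assms[of x] by (auto simp: tvars_def)
    then show ?case using 3 by simp
  qed simp_all
qed


section \<open>Matching\<close>

text \<open>For linear patterns this replaces the existential quantifier over substitutions in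
  \<open>is_redex\<close>: agreement at the operator positions is all that has to be
  checked.\<close>

definition matches :: "('f, 'v) pterm \<Rightarrow> ('f, 'x) pterm \<Rightarrow> bool" where
  "matches l t \<longleftrightarrow> (\<forall>v f. l v = Some (Inl f) \<longrightarrow> t v = Some (Inl f))"

text \<open>Meaningful for variables that occur in a linear pattern. It makes the matching
  substitution explicit, as \<open>\<lambda>x. subterm t (var_pos l x)\<close>, and thereby
  contraction a function.\<close>

definition var_pos :: "('f, 'v) pterm \<Rightarrow> 'v \<Rightarrow> occ" where
  "var_pos l x = (THE v. l v = Some (Inr x))"

lemma var_pos_eq: "linear_term l \<Longrightarrow> l v = Some (Inr x) \<Longrightarrow> var_pos l x = v"
  unfolding var_pos_def linear_term_def by blast

lemma subst_matching:
  assumes "is_term ar l" "total_term ar l" "is_term ar t" "matches l t"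
    and "\<And>x v. l v = Some (Inr x) \<Longrightarrow> \<sigma> x = subterm t v"
  shows "subst l \<sigma> = t"
proof
  fix u
  show "subst l \<sigma> u = t u"
    using assms
  proof (induction u arbitrary: l t)
    case Nil
    then show ?case
      by (cases "l []") (auto split: sum.splits simp: matches_def total_term_def)
  next
    case (Cons i u)
    show ?case
    proof (cases "l []")
      case None
      then show ?thesis using Cons.prems(2) by (simp add: total_term_def)
    next
      case (Some y)
      show ?thesis
      proof (cases y)
        case (Inr x)
        then show ?thesis using Cons.prems(5)[of "[]" x] Some by simp
      next
        case (Inl f)
        then have tf: "t [] = Some (Inl f)"
          using Cons.prems(4) Some by (simp add: matches_def)
        show ?thesis
        proof (cases "l [i] = None")
          case True
          \<comment> \<open>By totality of \<open>l\<close>, a missing argument means that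
            \<open>i\<close> is not an argument position of \<open>f\<close>; hence \<open>t\<close>
            has no such argument either and both sides are undefined.\<close>
          then have ni: "\<not> (1 \<le> i \<and> i \<le> ar f)"
            using Cons.prems(2) Some Inl unfolding total_term_def by (metis append_Nil)
          then have "t [i] = None"
            using is_term_snocD[OF Cons.prems(3), of "[]" i] tf by (metis append_Nil Inl_inject option.inject)
          then have "t (i # u) = None"
            using is_term_None_below[OF Cons.prems(3), of "[i]"] by simp
          moreover have "subterm l [i] = Map.empty"
            using is_term_None_root[OF is_term_subterm[OF Cons.prems(1)], of "[i]"] True by simp
          ultimately show ?thesis using Some Inl by simp
        next
          case False
          have "subst (subterm l [i]) \<sigma> u = subterm t [i] u"
          proof (rule Cons.IH)
            show "total_term ar (subterm l [i])"
              using total_term_subterm[OF Cons.prems(2)] False by simp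
            show "matches (subterm l [i]) (subterm t [i])"
              using Cons.prems(4) by (simp add: matches_def subterm_apply)
            show "\<sigma> x = subterm (subterm t [i]) v" if "subterm l [i] v = Some (Inr x)" for x v
              using Cons.prems(5)[of "i # v" x] that by (simp add: subterm_apply[of l "[i]" v])
          qed (use Cons.prems(1,3) in \<open>auto intro: is_term_subterm\<close>)
          then show ?thesis using Some Inl by (simp add: subterm_apply[of t "[i]" u])
        qed
      qed
    qed
  qed
qed

lemma matches_subst: "is_term ar l \<Longrightarrow> matches l (subst l \<sigma>)"
  unfolding matches_def by (blast intro: subst_at_op)

lemma subterm_subst_var:
  "is_term ar l \<Longrightarrow> l v = Some (Inr x) \<Longrightarrow> subterm (subst l \<sigma>) v = \<sigma> x"
  by (rule ext) (simp add: subst_at_var subterm_apply)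

lemma subst_var_pos:
  assumes "is_term ar l" "total_term ar l" "linear_term l" "is_term ar t" "matches l t"
  shows "subst l (\<lambda>x. subterm t (var_pos l x)) = t"
  using assms by (intro subst_matching) (auto simp: var_pos_eq)

lemma is_redex_iff_matches:
  assumes "is_trule ar (l, r)" "linear_term l" "is_term ar t"
  shows "is_redex ar t (w, l, r) \<longleftrightarrow> matches l (subterm t w)"
proof
  assume "is_redex ar t (w, l, r)"
  then show "matches l (subterm t w)"
    using assms(1) by (auto simp: is_redex_def is_trule_def matches_subst)
next
  assume "matches l (subterm t w)"
  then have "subst l (\<lambda>x. subterm (subterm t w) (var_pos l x)) = subterm t w"
    using assms by (intro subst_var_pos) (auto simp: is_trule_def intro: is_term_subterm)
  then show "is_redex ar t (w, l, r)"
    unfolding is_redex_def prod.case using is_term_subterm[OF assms(3)]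
    by (intro exI[of _ "\<lambda>x. subterm (subterm t w) (var_pos l x)"]) simp
qed

text \<open>A matching substitution is determined on the variables of \<open>l\<close>, hence on
  those of \<open>r\<close>, so the contractum does not depend on the witness \<sigma>.\<close>

lemma reduces_iff:
  assumes "is_trule ar (l, r)" "linear_term l" "is_term ar t"
  shows "reduces ar t (w, l, r) t' \<longleftrightarrow> matches l (subterm t w) \<and>
    t' = replace_at t w (subst r (\<lambda>x. subterm t (w @ var_pos l x)))"
proof -
  have rl: "is_term ar l" "total_term ar l" "tvars r \<subseteq> tvars l"
    using assms(1) by (auto simp: is_trule_def)
  have eq: "subst r \<sigma> = subst r (\<lambda>x. subterm t (w @ var_pos l x))"
    if "subterm t w = subst l \<sigma>" for \<sigma>
  proof (rule subst_cong_vars)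
    fix x assume "x \<in> tvars r"
    then obtain v where v: "l v = Some (Inr x)" using rl(3) by (auto simp: tvars_def)
    show "\<sigma> x = subterm t (w @ var_pos l x)"
      using subterm_subst_var[OF rl(1) v, of \<sigma>] var_pos_eq[OF assms(2) v]
      unfolding that[symmetric] by simp
  qed
  have "subst l (\<lambda>x. subterm t (w @ var_pos l x)) = subterm t w" if "matches l (subterm t w)"
    using subst_var_pos[OF rl(1,2) assms(2) is_term_subterm[OF assms(3)] that] by simp
  then have "is_redex ar t (w, l, r) \<longleftrightarrow> subst l (\<lambda>x. subterm t (w @ var_pos l x)) = subterm t w"
    unfolding is_redex_iff_matches[OF assms, of w]
    using matches_subst[OF rl(1), of "\<lambda>x. subterm t (w @ var_pos l x)"] by auto
  moreover have "reduces ar t (w, l, r) t' \<longleftrightarrow> is_redex ar t (w, l, r) \<and>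
    t' = replace_at t w (subst r (\<lambda>x. subterm t (w @ var_pos l x)))"
    unfolding reduces_def is_redex_def prod.case
  proof
    assume "\<exists>\<sigma>. (\<forall>x. is_term ar (\<sigma> x)) \<and> subterm t w = subst l \<sigma> \<and> t' = replace_at t w (subst r \<sigma>)"
    then obtain \<sigma> where s: "\<forall>x. is_term ar (\<sigma> x)" "subterm t w = subst l \<sigma>"
      "t' = replace_at t w (subst r \<sigma>)" by blast
    from s(3) have "t' = replace_at t w (subst r (\<lambda>x. subterm t (w @ var_pos l x)))"
      unfolding eq[OF s(2)] .
    then show "(\<exists>\<sigma>. (\<forall>x. is_term ar (\<sigma> x)) \<and> subterm t w = subst l \<sigma>) \<and>
      t' = replace_at t w (subst r (\<lambda>x. subterm t (w @ var_pos l x)))" using s(1,2) by blast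
  next
    assume "(\<exists>\<sigma>. (\<forall>x. is_term ar (\<sigma> x)) \<and> subterm t w = subst l \<sigma>) \<and>
      t' = replace_at t w (subst r (\<lambda>x. subterm t (w @ var_pos l x)))"
    then obtain \<sigma> where s: "\<forall>x. is_term ar (\<sigma> x)" "subterm t w = subst l \<sigma>"
      "t' = replace_at t w (subst r (\<lambda>x. subterm t (w @ var_pos l x)))" by blast
    from s(3) have "t' = replace_at t w (subst r \<sigma>)"
      unfolding eq[OF s(2)] .
    then show "\<exists>\<sigma>. (\<forall>x. is_term ar (\<sigma> x)) \<and> subterm t w = subst l \<sigma> \<and> t' = replace_at t w (subst r \<sigma>)" using s(1,2) by blast
  qed
  ultimately show ?thesis
    using is_redex_iff_matches[OF assms, of w] by (simp only:)
qed

text \<open>Closure under one-letter steps gives closure under all words, so \<open>F\<close> acts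
  as the finite state set of an automaton reading occurrences.\<close>

lemma rational_subterm_closed:
  assumes "finite F" "t \<in> F" "\<And>s i. s \<in> F \<Longrightarrow> subterm s [i] \<in> F"
  shows "rational t"
proof -
  have "subterm s w \<in> F" if "s \<in> F" for s w
    using that
  proof (induction w arbitrary: s)
    case (Cons i w)
    then show ?case using Cons.IH[OF assms(3)[OF Cons.prems, of i]] by simp
  qed simp
  then have "range (subterm t) \<subseteq> F" using assms(2) by blast
  then show ?thesis unfolding rational_def using assms(1) finite_subset by blast
qed

text \<open>Applies to operations that are local in the sense that a subterm of the result is a
  function of the corresponding subterm of the argument: the number of subterms cannot grow.\<close>

lemma rational_mapped:
  assumes "rational t" "\<And>w. subterm s w = F (subterm t w)"
  shows "rational s"
proof -
  have "range (subterm s) \<subseteq> F ` range (subterm t)" using assms(2) by auto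
  then show ?thesis using assms(1) unfolding rational_def by (meson finite_imageI finite_subset)
qed

text \<open>The last two assumptions go beyond orthogonality and will come from the graph side.
  \<open>noncollapsing\<close> makes infinite developments productive; \<open>rational_rhs\<close>
  is needed because right-hand sides may be infinite, and keeps developments of rational terms
  rational.\<close>

locale noncollapsing_orthogonal =
  fixes ar :: "'f \<Rightarrow> nat" and S :: "('f, 'v) trule set"
  assumes orth: "orthogonal_trs ar S"
    and finite_rules: "finite S"
    and noncollapsing: "R \<in> S \<Longrightarrow> \<exists>f. snd R [] = Some (Inl f)"
    and rational_rhs: "R \<in> S \<Longrightarrow> rational (snd R)"
begin

lemma rule: "R \<in> S \<Longrightarrow> is_trule ar R"
  using orth unfolding orthogonal_trs_def by blast

lemma lhs_linear: "R \<in> S \<Longrightarrow> linear_term (fst R)"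
  using orth unfolding orthogonal_trs_def by auto

lemma lhs_term: "R \<in> S \<Longrightarrow> is_term ar (fst R)"
  and rhs_term: "R \<in> S \<Longrightarrow> is_term ar (snd R)"
  and lhs_total: "R \<in> S \<Longrightarrow> total_term ar (fst R)"
  and rhs_vars: "R \<in> S \<Longrightarrow> tvars (snd R) \<subseteq> tvars (fst R)"
  using rule[of R] by (auto simp: is_trule_def)

lemma lhs_root: "R \<in> S \<Longrightarrow> \<exists>f. fst R [] = Some (Inl f)"
proof -
  assume R: "R \<in> S"
  have "fst R [] \<noteq> Some (Inr x)" for x
    using is_term_var_root[OF lhs_term[OF R], of x] rule[OF R] by (auto simp: is_trule_def)
  moreover have "fst R [] \<noteq> None"
    using lhs_total[OF R] by (simp add: total_term_def)
  ultimately show ?thesis by (metis option.exhaust sum.exhaust)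
qed

lemma is_redex_iff:
  "R \<in> S \<Longrightarrow> is_term ar t \<Longrightarrow> is_redex ar t (w, R) \<longleftrightarrow> matches (fst R) (subterm t w)"
  using is_redex_iff_matches[of ar "fst R" "snd R" t w] rule lhs_linear by simp

text \<open>Two patterns present in one term \<open>t\<close> yield, through their variable
  positions, the two substitutions of \<open>non_overlapping\<close>. Since \<open>t\<close> may be
  infinite, so may their values; this is what later controls redexes in cyclic graphs.\<close>

lemma no_overlap:
  assumes R: "R \<in> S" "R' \<in> S" and t: "is_term ar (t :: ('f, 'v) pterm)"
    and m: "matches (fst R) t" "matches (fst R') (subterm t w)" and w: "fst R w = Some (Inl f)"
  shows "w = [] \<and> R = R'"
proof -
  define \<sigma> where "\<sigma> x = subterm t (var_pos (fst R) x)" for x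
  define \<sigma>' where "\<sigma>' x = subterm (subterm t w) (var_pos (fst R') x)" for x
  have "subst (fst R) \<sigma> = t"
    unfolding \<sigma>_def using R t m by (intro subst_var_pos) (auto intro: lhs_term lhs_total lhs_linear)
  then have "subst (subterm (fst R) w) \<sigma> = subterm t w"
    using subst_subterm[OF lhs_term[OF R(1)], of w \<sigma>] w by simp
  moreover have "subst (fst R') \<sigma>' = subterm t w"
    unfolding \<sigma>'_def using R t m
    by (intro subst_var_pos) (auto intro: lhs_term lhs_total lhs_linear is_term_subterm)
  moreover have "is_term ar (\<sigma> x)" "is_term ar (\<sigma>' x)" for x
    unfolding \<sigma>_def \<sigma>'_def using t by (auto intro!: is_term_subterm)
  moreover have "w = [] \<and> (l, r) = (l', r')"
    if "(l, r) \<in> S" "(l', r') \<in> S" "l w = Some (Inl f)" "\<forall>x. is_term ar (\<sigma> x)"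
      "\<forall>x. is_term ar (\<sigma>' x)" "subst (subterm l w) \<sigma> = subst l' \<sigma>'" for l r l' r'
  proof -
    have "non_overlapping ar S" using orth by (simp add: orthogonal_trs_def)
    note * = bspec[OF bspec[OF this[unfolded non_overlapping_def] that(1), unfolded prod.case] that(2), unfolded prod.case]
    show ?thesis by (rule *[rule_format, OF that(3)]) (use that(4-6) in simp_all)
  qed
  ultimately show ?thesis
    using R w by (metis prod.collapse)
qed

lemma matches_unique:
  assumes "R \<in> S" "R' \<in> S" "is_term ar (t :: ('f, 'v) pterm)" "matches (fst R) t" "matches (fst R') t"
  shows "R = R'"
  using no_overlap[of R R' t "[]"] lhs_root[OF assms(1)] assms by auto

end


section \<open>Developments of annotated terms\<close>

definition relab :: "('f \<Rightarrow> 'g) \<Rightarrow> ('f, 'v) pterm \<Rightarrow> ('g, 'v) pterm" where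
  "relab h t = (\<lambda>w. map_option (map_sum h id) (t w))"

lemma subterm_relab: "subterm (relab h t) w = relab h (subterm t w)"
  by (simp add: relab_def subterm_def)

lemma relab_relab: "relab h (relab k t) = relab (h \<circ> k) t"
proof
  show "relab h (relab k t) w = relab (h \<circ> k) t w" for w
    by (cases "t w"; cases "the (t w)") (auto simp: relab_def)
qed

lemma relab_Inl: "relab h t w = Some (Inl g) \<longleftrightarrow> (\<exists>f. t w = Some (Inl f) \<and> g = h f)"
  and relab_Inr: "relab h t w = Some (Inr x) \<longleftrightarrow> t w = Some (Inr x)"
  and relab_None: "relab h t w = None \<longleftrightarrow> t w = None"
  by (cases "t w"; cases "the (t w)"; auto simp: relab_def)+

lemma tvars_relab: "tvars (relab h t) = tvars t"
  by (simp add: tvars_def relab_Inr)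

lemma relab_subst: "relab h (subst s \<sigma>) = subst (relab h s) (\<lambda>x. relab h (\<sigma> x))"
proof
  show "relab h (subst s \<sigma>) w = subst (relab h s) (\<lambda>x. relab h (\<sigma> x)) w" for w
  proof (induction w arbitrary: s)
    case Nil
    show ?case by (cases "s []"; cases "the (s [])") (auto simp: relab_def)
  next
    case (Cons i w)
    have "relab h (subst (subterm s [i]) \<sigma>) w =
      subst (subterm (relab h s) [i]) (\<lambda>x. relab h (\<sigma> x)) w"
      using Cons.IH by (simp add: subterm_relab)
    then show ?case by (cases "s []"; cases "the (s [])") (auto simp: relab_def)
  qed
qed

lemma is_term_relab:
  assumes "\<And>f. ar' (h f) = ar f"
  shows "is_term ar' (relab h t) \<longleftrightarrow> is_term ar t"
proof -
  have "(\<exists>g. relab h t w = Some (Inl g) \<and> 1 \<le> i \<and> i \<le> ar' g) \<longleftrightarrow>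
    (\<exists>f. t w = Some (Inl f) \<and> 1 \<le> i \<and> i \<le> ar f)" for w i
    by (auto simp: relab_Inl assms)
  then show ?thesis unfolding is_term_def relab_None by (simp only:)
qed

text \<open>
  An annotation \<open>Some (R, b)\<close> at an operator marks an occurrence of a redex of the rule \<open>R\<close>; the
  bit \<open>b\<close> singles out some of the marked redexes.
\<close>

type_synonym ('f, 'v) alabel = "'f \<times> (('f, 'v) trule \<times> bool) option"
type_synonym ('f, 'v) aterm = "(('f, 'v) alabel, 'v) pterm"

text \<open>Right-hand sides enter a development through \<open>plain\<close>, so redexes created by
  a contraction are never marked; only residuals are.\<close>

abbreviation plain :: "('f, 'v) pterm \<Rightarrow> ('f, 'v) aterm" where
  "plain \<equiv> relab (\<lambda>f. (f, None))"

abbreviation strip :: "('f, 'v) aterm \<Rightarrow> ('f, 'v) pterm" where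
  "strip \<equiv> relab fst"

lemma strip_plain [simp]: "strip (plain t) = t"
proof
  show "strip (plain t) w = t w" for w
    by (cases "t w"; cases "the (t w)") (auto simp: relab_def)
qed

definition contracted :: "bool \<Rightarrow> ('f, 'v) aterm \<Rightarrow> ('f, 'v) trule option" where
  "contracted only t = (case t [] of
     Some (Inl (f, Some (R, b))) \<Rightarrow>
       if (only \<longrightarrow> b) \<and> (\<exists>g. snd R [] = Some (Inl g)) then Some R else None
   | _ \<Rightarrow> None)"

lemma contracted_SomeD:
  assumes "contracted only t = Some R"
  obtains f b g where "t [] = Some (Inl (f, Some (R, b)))" "only \<longrightarrow> b" "snd R [] = Some (Inl g)"
  using assms unfolding contracted_def
  by (auto split: option.splits sum.splits if_splits)

lemma contracted_cong: "t [] = t' [] \<Longrightarrow> contracted only t = contracted only t'"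
  by (simp add: contracted_def)

definition dev_step ::
  "bool \<Rightarrow> (('f, 'v) aterm \<Rightarrow> ('f, 'v) aterm) \<Rightarrow> ('f, 'v) aterm \<Rightarrow> ('f, 'v) aterm" where
  "dev_step only D t = (case contracted only t of
     None \<Rightarrow> (\<lambda>w. case w of [] \<Rightarrow> t [] | i # u \<Rightarrow> D (subterm t [i]) u)
   | Some R \<Rightarrow> subst (plain (snd R)) (\<lambda>x. D (subterm t (var_pos (fst R) x))))"

text \<open>
  As no right-hand side is a variable, every contraction produces an operator, so that
  \<open>length w + 1\<close> iterations determine the label at \<open>w\<close>, even for infinitely many nested redexes.
  The test for an operator in \<open>contracted\<close> makes the recursion equation \<open>dev_eq\<close> unconditional.
\<close>

definition dev :: "bool \<Rightarrow> ('f, 'v) aterm \<Rightarrow> ('f, 'v) aterm" where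
  "dev only t w = (dev_step only ^^ Suc (length w)) (\<lambda>_. Map.empty) t w"

text \<open>Guardedness: \<open>u\<close> is nonempty because the root of \<open>s\<close> is an
  operator. Hence the label at \<open>w\<close> depends on \<sigma> at strictly shorter words
  \<open>v\<close> only, which is what drives the inductions on \<open>length w\<close>.\<close>

lemma subst_word_op:
  fixes s :: "('f, 'v) pterm"
  assumes "s [] = Some (Inl c)"
  shows "(\<exists>y. (\<forall>\<sigma>. (subst s \<sigma> :: ('f, 'x) pterm) w = y) \<and> (y = None \<or> (\<exists>f. s w = Some (Inl f) \<and> y = Some (Inl f)))) \<or>
   (\<exists>x u v. w = u @ v \<and> u \<noteq> [] \<and> s u = Some (Inr x) \<and> (\<forall>\<sigma>. (subst s \<sigma> :: ('f, 'x) pterm) w = \<sigma> x v))"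
  using subst_word[of s w, where ?'x = 'x]
proof (elim disjE exE conjE, goal_cases)
  case (3 x u v)
  then have "u \<noteq> []" using assms by auto
  then show ?case using 3 by blast
qed blast+

lemma subst_word_op_cong:
  fixes \<sigma> \<tau> :: "'v \<Rightarrow> ('f, 'x) pterm"
  assumes "s [] = Some (Inl c)" "\<And>x v. length v < length w \<Longrightarrow> \<sigma> x v = \<tau> x v"
  shows "subst s \<sigma> w = subst s \<tau> w"
  using subst_word_op[where s = s and ?'x = 'x, OF assms(1), of w]
proof (elim disjE exE conjE, goal_cases)
  case (3 x u v)
  then show ?case using assms(2)[of v x] by simp
qed simp_all

text \<open>Each unfolding settles one more level, either by descending to an argument or by
  guardedness of the contractum. With more than \<open>length w\<close> unfoldings the start
  function \<open>D\<close> is never consulted.\<close>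

lemma dev_step_funpow:
  assumes "length w < n" "length w < m"
  shows "(dev_step only ^^ n) D t w = (dev_step only ^^ m) D t w"
  using assms
proof (induction "length w" arbitrary: w n m t rule: less_induct)
  case less
  obtain n' m' where nm: "n = Suc n'" "m = Suc m'"
    using less.prems by (metis gr_implies_not0 not0_implies_Suc)
  show ?case
  proof (cases "contracted only t")
    case None
    show ?thesis
    proof (cases w)
      case (Cons i u)
      then show ?thesis using less.hyps[of u n' m'] less.prems nm None by (simp add: dev_step_def)
    qed (use nm None in \<open>simp add: dev_step_def\<close>)
  next
    case (Some R)
    then obtain g where "snd R [] = Some (Inl g)" by (rule contracted_SomeD)
    then have g: "plain (snd R) [] = Some (Inl (g, None))" by (simp add: relab_Inl)
    have "subst (plain (snd R)) (\<lambda>x. (dev_step only ^^ n') D (subterm t (var_pos (fst R) x))) w =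
      subst (plain (snd R)) (\<lambda>x. (dev_step only ^^ m') D (subterm t (var_pos (fst R) x))) w"
      by (rule subst_word_op_cong[where s = "plain (snd R)", OF g])
        (rule less.hyps, use less.prems nm in simp_all)
    then show ?thesis
      using Some nm by (simp add: dev_step_def)
  qed
qed

lemma dev_eq: "dev only t = dev_step only (dev only) t"
proof
  fix w
  show "dev only t w = dev_step only (dev only) t w"
  proof (cases "contracted only t")
    case None
    then show ?thesis
      by (cases w) (simp_all add: dev_def dev_step_def)
  next
    case (Some R)
    then obtain g where "snd R [] = Some (Inl g)" by (rule contracted_SomeD)
    then have g: "plain (snd R) [] = Some (Inl (g, None))" by (simp add: relab_Inl)
    \<comment> \<open>At a word \<open>v\<close> below a variable, unfolding the left side leaves
      \<open>length w\<close> iterations, whereas \<open>dev\<close> uses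
      \<open>Suc (length v)\<close>. Both exceed \<open>length v\<close>, as \<open>v\<close> is
      shorter than \<open>w\<close>.\<close>
    have "subst (plain (snd R)) (\<lambda>x. (dev_step only ^^ length w) (\<lambda>_. Map.empty) (subterm t (var_pos (fst R) x))) w =
      subst (plain (snd R)) (\<lambda>x. dev only (subterm t (var_pos (fst R) x))) w"
      by (rule subst_word_op_cong[where s = "plain (snd R)", OF g])
        (unfold dev_def, rule dev_step_funpow, simp_all)
    then show ?thesis
      using Some by (simp add: dev_def dev_step_def)
  qed
qed

lemma dev_Nil: "contracted only t = None \<Longrightarrow> dev only t [] = t []"
  by (subst dev_eq) (simp add: dev_step_def)

lemma dev_Cons: "contracted only t = None \<Longrightarrow> dev only t (i # w) = dev only (subterm t [i]) w"
  by (subst dev_eq) (simp add: dev_step_def)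

lemma subterm_dev:
  "contracted only t = None \<Longrightarrow> subterm (dev only t) [i] = dev only (subterm t [i])"
  by (rule ext) (simp add: dev_Cons subterm_def)

lemma dev_Some:
  "contracted only t = Some R \<Longrightarrow>
   dev only t = subst (plain (snd R)) (\<lambda>x. dev only (subterm t (var_pos (fst R) x)))"
  by (subst dev_eq) (simp add: dev_step_def)

lemma plain_rhs_root:
  assumes "contracted only t = Some R"
  obtains g where "plain (snd R) [] = Some (Inl (g, None))"
  using assms by (auto elim!: contracted_SomeD simp: relab_Inl)

lemma dev_empty [simp]: "dev only Map.empty = Map.empty"
proof
  show "dev only Map.empty w = None" for w
    by (induction w) (simp_all add: dev_Nil dev_Cons contracted_def)
qed

lemma dev_root_None: "t [] = None \<Longrightarrow> dev only t [] = None"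
  by (simp add: dev_Nil contracted_def)

lemma dev_inactive:
  assumes "\<And>w. contracted only (subterm t w) = None"
  shows "dev only t = t"
proof
  show "dev only t w = t w" for w
    using assms
  proof (induction w arbitrary: t)
    case Nil
    then show ?case using Nil[of "[]"] by (simp add: dev_Nil)
  next
    case (Cons i w)
    have "dev only (subterm t [i]) w = subterm t [i] w"
      by (rule Cons.IH) (simp add: Cons.prems)
    then show ?case using Cons.prems[of "[]"] by (simp add: dev_Cons subterm_apply[of t "[i]" w])
  qed
qed

lemma subterm_subst_op:
  assumes "\<And>x. s [] \<noteq> Some (Inr x)"
  shows "subterm (subst s \<sigma>) [i] = subst (subterm s [i]) \<sigma>"
proof
  show "subterm (subst s \<sigma>) [i] w = subst (subterm s [i]) \<sigma> w" for w
    using assms by (cases "s []"; cases "the (s [])") (auto simp: subterm_apply[of "subst s \<sigma>" "[i]" w])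
qed

text \<open>A plain context carries no annotations, so only the substituted terms are developed. In
  the triangle property this handles a root that has just been contracted.\<close>

lemma dev_subst_plain: "dev only (subst (plain s) \<sigma>) = subst (plain s) (\<lambda>x. dev only (\<sigma> x))"
proof
  show "dev only (subst (plain s) \<sigma>) w = subst (plain s) (\<lambda>x. dev only (\<sigma> x)) w" for w
  proof (induction w arbitrary: s)
    case Nil
    show ?case
      by (cases "s []"; cases "the (s [])")
        (auto simp: relab_def subst_Inr_root contracted_def intro!: dev_Nil[THEN trans])
  next
    case (Cons i w)
    show ?case
    proof (cases "\<exists>x. s [] = Some (Inr x)")
      case True
      then obtain x where "plain s [] = Some (Inr x)" by (auto simp: relab_Inr)
      then show ?thesis by (simp add: subst_Inr_root del: subst.simps)
    next
      case False
      then have nv: "plain s [] \<noteq> Some (Inr x)" for x by (simp add: relab_Inr)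
      have "contracted only (subst (plain s) \<sigma>) = None"
        using False by (cases "s []"; cases "the (s [])") (auto simp: contracted_def relab_def)
      then have "dev only (subst (plain s) \<sigma>) (i # w) =
        dev only (subst (plain (subterm s [i])) \<sigma>) w"
        by (simp add: dev_Cons subterm_subst_op nv subterm_relab del: subst.simps)
      also have "\<dots> = subst (plain (subterm s [i])) (\<lambda>x. dev only (\<sigma> x)) w"
        by (rule Cons.IH)
      also have "\<dots> = subterm (subst (plain s) (\<lambda>x. dev only (\<sigma> x))) [i] w"
        by (simp add: subterm_subst_op nv subterm_relab del: subst.simps)
      finally show ?thesis by (simp add: subterm_def del: subst.simps)
    qed
  qed
qed

text \<open>The redexes selected by \<open>contracted\<close> are all that a development sees of the
  annotations; \<open>strip\<close> hides the annotations left over. Two uses: resetting all bits,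
  and reading \<open>dev True\<close> as the full development of the redexes with bit
  \<open>True\<close>.\<close>

lemma strip_dev_relab:
  fixes h :: "('f, 'v) alabel \<Rightarrow> ('f, 'v) alabel"
  assumes h: "\<And>g. fst (h g) = fst g"
    and c: "\<And>s :: ('f, 'v) aterm. contracted only' (relab h s) = contracted only s"
  shows "strip (dev only' (relab h t)) = strip (dev only t)"
proof
  have hc: "fst \<circ> h = fst" using h by auto
  show "strip (dev only' (relab h t)) w = strip (dev only t) w" for w
  proof (induction "length w" arbitrary: w t rule: less_induct)
    case less
    show ?case
    proof (cases "contracted only t")
      case None
      then have n: "contracted only' (relab h t) = None" by (simp add: c)
      show ?thesis
      proof (cases w)
        case Nil
        have "strip (relab h t) w = strip t w" by (simp add: relab_relab hc)
        then show ?thesis using None n Nil by (simp add: relab_def dev_Nil)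
      next
        case (Cons i u)
        then show ?thesis using less[of u "subterm t [i]"] None n
          by (simp add: relab_def dev_Cons) (simp add: subterm_def)
      qed
    next
      case (Some R)
      then have n: "contracted only' (relab h t) = Some R" by (simp add: c)
      obtain g where "snd R [] = Some (Inl g)" using Some by (rule contracted_SomeD)
      then show ?thesis
        unfolding dev_Some[OF Some] dev_Some[OF n] relab_subst strip_plain
        by (rule subst_word_op_cong) (simp add: less subterm_relab)
    qed
  qed
qed

lemma replace_at_Cons:
  "replace_at t (i # w) s (j # u) = (if i = j then replace_at (subterm t [i]) w s u else t (j # u))"
  by (auto simp: replace_at_def subterm_apply)

text \<open>Links \<open>dev True\<close> with one step of \<open>reduces\<close>. The last premise
  places the substituted subterms strictly below \<open>w\<close>, where no redex is selected, so
  they are copied unchanged.\<close>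

lemma dev_single:
  assumes "contracted True (subterm t w) = Some R"
    and "\<And>u. u \<noteq> w \<Longrightarrow> contracted True (subterm t u) = None"
    and "\<And>x. x \<in> tvars (snd R) \<Longrightarrow> var_pos (fst R) x \<noteq> []"
  shows "dev True t = replace_at t w (subst (plain (snd R)) (\<lambda>x. subterm t (w @ var_pos (fst R) x)))"
    (is "_ = replace_at t w (?s t w)")
proof
  fix u
  show "dev True t u = replace_at t w (?s t w) u"
    using assms(1,2)
  proof (induction w arbitrary: t u)
    case Nil
    have "dev True (subterm t (var_pos (fst R) x)) = subterm t (var_pos (fst R) x)"
      if "x \<in> tvars (snd R)" for x
      by (rule dev_inactive) (use Nil.prems(2) assms(3)[OF that] in simp)
    then have "dev True t = ?s t []"
      using Nil.prems(1) by (simp add: dev_Some) (rule subst_cong_vars, simp add: tvars_relab)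
    then show ?case by (simp add: replace_at_def)
  next
    case (Cons i w)
    have n: "contracted True t = None" using Cons.prems(2)[of "[]"] by simp
    show ?case
    proof (cases u)
      case Nil
      then show ?thesis using n by (simp add: dev_Nil replace_at_def)
    next
      case u: (Cons j v)
      show ?thesis
      proof (cases "i = j")
        case True
        have "dev True (subterm t [i]) v = replace_at (subterm t [i]) w (?s (subterm t [i]) w) v"
          by (rule Cons.IH) (use Cons.prems in simp_all)
        then show ?thesis using n u True by (simp add: dev_Cons replace_at_Cons)
      next
        case False
        have "dev True (subterm t [j]) = subterm t [j]"
          by (rule dev_inactive) (use Cons.prems(2) False in simp)
        then show ?thesis using n u False
          by (simp add: dev_Cons replace_at_Cons subterm_apply[of t "[j]" v])
      qed
    qed
  qed
qed

section \<open>Well-annotated terms, the triangle property and rationality\<close>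

context noncollapsing_orthogonal
begin

text \<open>Besides the presence of the pattern, the inner part of the pattern must be free of
  annotations. This is non-overlap in local form: contracting other marked redexes cannot damage the
  pattern.\<close>

definition redex_root :: "('f, 'v) aterm \<Rightarrow> bool" where
  "redex_root t \<longleftrightarrow> (\<forall>f R b. t [] = Some (Inl (f, Some (R, b))) \<longrightarrow> R \<in> S \<and>
     (\<forall>v g. fst R v = Some (Inl g) \<longrightarrow> (\<exists>a. t v = Some (Inl (g, a)) \<and> (v \<noteq> [] \<longrightarrow> a = None))))"

definition well_annotated :: "('f, 'v) aterm \<Rightarrow> bool" where
  "well_annotated t \<longleftrightarrow> is_term (ar \<circ> fst) t \<and> (\<forall>w. redex_root (subterm t w))"

lemma redex_rootD:
  assumes "redex_root t" "t [] = Some (Inl (f, Some (R, b)))"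
  shows "R \<in> S" "fst R v = Some (Inl g) \<Longrightarrow> \<exists>a. t v = Some (Inl (g, a)) \<and> (v \<noteq> [] \<longrightarrow> a = None)"
  using assms unfolding redex_root_def by blast+

lemma well_annotated_subterm: "well_annotated t \<Longrightarrow> well_annotated (subterm t w)"
  by (auto simp: well_annotated_def is_term_subterm)

lemma well_annotated_root: "well_annotated t \<Longrightarrow> redex_root t"
  using subterm_Nil[of t] unfolding well_annotated_def by (elim conjE allE[of _ "[]"]) simp

lemma well_annotated_strip: "well_annotated t \<Longrightarrow> is_term ar (strip t)"
  by (simp add: well_annotated_def is_term_relab[of ar fst "ar \<circ> fst"])

text \<open>It suffices that every annotation is a genuine redex: a second annotation inside a
  pattern would be an overlap, so \<open>no_overlap\<close> supplies the rest of
  \<open>redex_root\<close>.\<close>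

lemma well_annotatedI:
  assumes t: "is_term ar (strip t)"
    and m: "\<And>w f R b. t w = Some (Inl (f, Some (R, b))) \<Longrightarrow> R \<in> S \<and> matches (fst R) (subterm (strip t) w)"
  shows "well_annotated t"
  unfolding well_annotated_def
proof (intro conjI allI)
  show "is_term (ar \<circ> fst) t" using t by (simp add: is_term_relab[of ar fst "ar \<circ> fst"])
  fix w
  show "redex_root (subterm t w)"
    unfolding redex_root_def
  proof (intro allI impI conjI)
    fix f R b assume a: "subterm t w [] = Some (Inl (f, Some (R, b)))"
    then have R: "R \<in> S" "matches (fst R) (subterm (strip t) w)" using m[of w] by auto
    then show "R \<in> S" by simp
    fix v g assume v: "fst R v = Some (Inl g)"
    then obtain c where c: "t (w @ v) = Some (Inl (g, c))"
      using R(2) by (auto simp: matches_def subterm_apply relab_Inl)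
    have "c = None" if "v \<noteq> []"
    proof (rule ccontr)
      assume "c \<noteq> None"
      then obtain R' b' where "c = Some (R', b')" by auto
      then have "R' \<in> S" "matches (fst R') (subterm (subterm (strip t) w) v)"
        using m[of "w @ v"] c by auto
      then show False
        using no_overlap[OF R(1) _ is_term_subterm[OF t] R(2) _ v] that by blast
    qed
    then show "\<exists>a. subterm t w v = Some (Inl (g, a)) \<and> (v \<noteq> [] \<longrightarrow> a = None)"
      using c by (simp add: subterm_apply)
  qed
qed

lemma well_annotated_matches:
  assumes "well_annotated t" "t w = Some (Inl (f, Some (R, b)))"
  shows "R \<in> S" "matches (fst R) (subterm (strip t) w)"
proof -
  have root: "redex_root (subterm t w)" "subterm t w [] = Some (Inl (f, Some (R, b)))"
    using well_annotated_root[OF well_annotated_subterm[OF assms(1)]] assms(2) by auto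
  show "R \<in> S" by (rule redex_rootD(1)[OF root])
  show "matches (fst R) (subterm (strip t) w)"
    unfolding matches_def subterm_relab relab_Inl
    using redex_rootD(2)[OF root] by (auto simp del: split_paired_Ex) (metis fst_conv)
qed

lemma contracted_rule:
  assumes "well_annotated t" "contracted only t = Some R"
  shows "R \<in> S"
proof -
  obtain f b where "t [] = Some (Inl (f, Some (R, b)))" using assms(2) by (rule contracted_SomeD)
  then show ?thesis by (rule well_annotated_matches(1)[OF assms(1)])
qed

lemma contracted_all:
  assumes "well_annotated t" "t [] = Some (Inl (f, Some (R, b)))"
  shows "contracted False t = Some R" "contracted True t = (if b then Some R else None)"
  using well_annotated_matches(1)[OF assms(1), of "[]"] assms(2) noncollapsing[of R]
  by (auto simp: contracted_def)

text \<open>No contraction happens on the way to \<open>v\<close>: the root is kept by assumption,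
  and the other proper prefixes of \<open>v\<close> are inner positions of the pattern, hence
  unannotated. Thus the arguments of a redex that is kept are developed one by one.\<close>

lemma dev_path:
  assumes t: "well_annotated t" "t [] = Some (Inl (f, Some (R, b)))" "contracted only t = None"
    and v: "fst R v \<noteq> None"
  shows "subterm (dev only t) v = dev only (subterm t v)"
  using v
proof (induction v rule: rev_induct)
  case (snoc i v)
  have R: "R \<in> S" by (rule well_annotated_matches(1)[OF t(1,2)])
  obtain g where g: "fst R v = Some (Inl g)"
    using is_term_snocD[OF lhs_term[OF R] snoc.prems] by blast
  then obtain a where a: "t v = Some (Inl (g, a))" "v \<noteq> [] \<longrightarrow> a = None"
    using redex_rootD(2)[OF well_annotated_root[OF t(1)] t(2)] by blast
  have "contracted only (subterm t v) = None"
    using a t(3) by (cases "v = []") (auto simp: contracted_def)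
  then have "subterm (dev only (subterm t v)) [i] = dev only (subterm t (v @ [i]))"
    by (simp add: subterm_dev)
  then show ?case using snoc.IH g by (metis option.distinct(1) subterm_subterm)
qed simp

lemma is_term_dev:
  assumes "well_annotated t"
  shows "is_term (ar \<circ> fst) (dev only t)"
proof -
  have "\<exists>f. dev only t w = Some (Inl f) \<and> 1 \<le> i \<and> i \<le> ar (fst f)" if "dev only t (w @ [i]) \<noteq> None" for w i
    using assms that
  proof (induction "length w" arbitrary: w t rule: less_induct)
    case less
    show ?case
    proof (cases "contracted only t")
      case None
      show ?thesis
      proof (cases w)
        case Nil
        have "t [i] \<noteq> None"
          using less.prems(2) dev_root_None[of "subterm t [i]" only] None Nil by (force simp: dev_Cons)
        then obtain f where "t [] = Some (Inl f)" "1 \<le> i" "i \<le> ar (fst f)"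
          using less.prems(1) is_term_snocD[of "ar \<circ> fst" t "[]" i] by (auto simp: well_annotated_def)
        then show ?thesis using None Nil by (simp add: dev_Nil)
      next
        case (Cons j u)
        then show ?thesis
          using less.hyps[of u "subterm t [j]"] less.prems None
          by (simp add: dev_Cons well_annotated_subterm)
      qed
    next
      case (Some R)
      define \<sigma> where "\<sigma> x = dev only (subterm t (var_pos (fst R) x))" for x
      have d: "dev only t = subst (plain (snd R)) \<sigma>"
        unfolding \<sigma>_def by (rule dev_Some[OF Some])
      have r: "is_term (ar \<circ> fst) (plain (snd R))"
        using rhs_term[OF contracted_rule[OF less.prems(1) Some]]
        by (simp add: is_term_relab[of _ _ ar])
      obtain g where g: "plain (snd R) [] = Some (Inl (g, None))" by (rule plain_rhs_root[OF Some])
      show ?thesis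
        using subst_word_op[where s = "plain (snd R)" and ?'x = 'v, OF g, of "w @ [i]"]
      proof (elim disjE exE conjE, goal_cases)
        case (1 y)
        then show ?case using less.prems(2) d by metis
      next
        case (2 y f)
        then obtain f' where "plain (snd R) w = Some (Inl f')" "1 \<le> i \<and> i \<le> ar (fst f')"
          using is_term_snocD[OF r, of w i] by auto
        then show ?case using subst_at_op[OF r] d by metis
      next
        case (3 x u v)
        show ?case
        \<comment> \<open>If \<open>v\<close> is empty, \<open>w @ [i]\<close> is itself a variable
          occurrence and its parent still belongs to the right-hand side. Otherwise parent and child
          both lie in the substituted term and the induction hypothesis applies.\<close>
        proof (cases v rule: rev_cases)
          case Nil
          then obtain f' where "plain (snd R) w = Some (Inl f')" "1 \<le> i \<and> i \<le> ar (fst f')"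
            using is_term_snocD[OF r, of w i] 3 by auto
          then show ?thesis using subst_at_op[OF r] d by metis
        next
          case (snoc v' j)
          then have ww: "w = u @ v'" "j = i" using 3(1) by auto
          have "\<sigma> x (v' @ [i]) \<noteq> None" using less.prems(2) d 3 snoc ww by metis
          then have "\<exists>f. \<sigma> x v' = Some (Inl f) \<and> 1 \<le> i \<and> i \<le> ar (fst f)"
            using less.hyps[of v' "subterm t (var_pos (fst R) x)"] less.prems(1) ww 3(2)
            by (simp add: \<sigma>_def well_annotated_subterm)
          then show ?thesis using subst_at_var[OF r 3(3), of \<sigma> v'] ww d by simp
        qed
      qed
    qed
  qed
  then show ?thesis by (simp add: is_term_def)
qed

text \<open>Residuals are again genuine redexes. The pattern of a redex that is kept survives by
  \<open>dev_path\<close>; a contracted right-hand side is plain; below its variables the position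
  has become shorter.\<close>

lemma well_annotated_dev:
  assumes "well_annotated t"
  shows "well_annotated (dev True t)"
proof -
  have "redex_root (subterm (dev True t) w)" for w
    using assms
  proof (induction "length w" arbitrary: w t rule: less_induct)
    case less
    show ?case
    proof (cases "contracted True t")
      case None
      show ?thesis
      proof (cases w)
        case Nil
        have "\<exists>a. dev True t v = Some (Inl (g, a)) \<and> (v \<noteq> [] \<longrightarrow> a = None)"
          if t: "t [] = Some (Inl (f, Some (R, b)))" and v: "fst R v = Some (Inl g)" for f R b v g
        proof -
          obtain a where a: "t v = Some (Inl (g, a))" "v \<noteq> [] \<longrightarrow> a = None"
            using redex_rootD(2)[OF well_annotated_root[OF less.prems] t v] by blast
          have "contracted True (subterm t v) = None"
            using a None by (cases "v = []") (auto simp: contracted_def)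
          then have "dev True (subterm t v) [] = t v" by (simp add: dev_Nil)
          then have "dev True t v = t v"
            using dev_path[OF less.prems t None, of v] v by (metis option.distinct(1) subterm_apply_Nil)
          then show ?thesis using a by simp
        qed
        then show ?thesis
          using Nil None well_annotated_root[OF less.prems] by (auto simp: redex_root_def dev_Nil)
      next
        case (Cons i u)
        have "subterm (dev True t) w = subterm (dev True (subterm t [i])) u"
          using subterm_dev[OF None, of i] Cons by (metis append_Cons append_Nil subterm_subterm)
        then show ?thesis using less.hyps[of u "subterm t [i]"] less.prems Cons
          by (simp add: well_annotated_subterm)
      qed
    next
      case (Some R)
      define \<sigma> where "\<sigma> x = dev True (subterm t (var_pos (fst R) x))" for x
      have d: "dev True t = subst (plain (snd R)) \<sigma>"
        unfolding \<sigma>_def by (rule dev_Some[OF Some])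
      have r: "is_term (ar \<circ> fst) (plain (snd R))"
        using rhs_term[OF contracted_rule[OF less.prems(1) Some]]
        by (simp add: is_term_relab[of _ _ ar])
      obtain g where g: "plain (snd R) [] = Some (Inl (g, None))" by (rule plain_rhs_root[OF Some])
      show ?thesis
        using subst_word_op[where s = "plain (snd R)" and ?'x = 'v, OF g, of w]
      proof (elim disjE exE conjE, goal_cases)
        case (1 y)
        then show ?case using d by (simp add: redex_root_def)
      next
        case (2 y f)
        then show ?case using d by (auto simp: redex_root_def relab_Inl)
      next
        case (3 x u v)
        have "subterm (dev True t) w = subterm (\<sigma> x) v"
          using subterm_subst_var[OF r 3(3), of \<sigma>] d 3(1) by (metis subterm_subterm)
        then show ?case
          using less.hyps[of v] less.prems 3 by (simp add: \<sigma>_def well_annotated_subterm)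
      qed
    qed
  qed
  then show ?thesis using is_term_dev[OF assms] by (simp add: well_annotated_def)
qed

text \<open>The triangle property, by the fate of the root. If it is contracted in the first pass,
  the second pass acts inside the substitution (\<open>dev_subst_plain\<close>). If it is contracted
  in the second, its arguments were developed separately in the first (\<open>dev_path\<close>). In
  both cases the contractum is guarded and the induction hypothesis applies to shorter
  words.\<close>

lemma dev_False_dev_True:
  assumes "well_annotated t"
  shows "dev False (dev True t) = dev False t"
proof
  show "dev False (dev True t) w = dev False t w" for w
    using assms
  proof (induction "length w" arbitrary: w t rule: less_induct)
    case less
    show ?case
    proof (cases "contracted True t")
      case (Some R)
      have f: "contracted False t = Some R"
        using Some by (auto simp: contracted_def split: option.splits sum.splits if_splits)
      obtain g where g: "plain (snd R) [] = Some (Inl (g, None))" by (rule plain_rhs_root[OF Some])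
      show ?thesis
        unfolding dev_Some[OF Some] dev_subst_plain dev_Some[OF f]
        by (rule subst_word_op_cong[where s = "plain (snd R)", OF g]) (simp add: less well_annotated_subterm)
    next
      case None
      have c: "contracted False (dev True t) = contracted False t"
        by (rule contracted_cong) (simp add: None dev_Nil)
      show ?thesis
      proof (cases "contracted False t")
        case N: None
        show ?thesis
        proof (cases w)
          case (Cons i u)
          then show ?thesis using N None c less.hyps[of u "subterm t [i]"] less.prems
            by (simp add: dev_Cons subterm_dev well_annotated_subterm)
        qed (simp add: N None c dev_Nil)
      next
        case (Some R)
        obtain g where g: "plain (snd R) [] = Some (Inl (g, None))" by (rule plain_rhs_root[OF Some])
        obtain f b where t: "t [] = Some (Inl (f, Some (R, b)))" using Some by (rule contracted_SomeD)
        note RS = contracted_rule[OF less.prems Some]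
        have "subterm (dev True t) (var_pos (fst R) x) = dev True (subterm t (var_pos (fst R) x))"
          if x: "x \<in> tvars (snd R)" for x
        proof -
          obtain v where "fst R v = Some (Inr x)" using x rhs_vars[OF RS] by (auto simp: tvars_def)
          then have "fst R (var_pos (fst R) x) \<noteq> None" using var_pos_eq[OF lhs_linear[OF RS]] by simp
          then show ?thesis by (rule dev_path[OF less.prems t None])
        qed
        then have "dev False (dev True t) = subst (plain (snd R)) (\<lambda>x. dev False (dev True (subterm t (var_pos (fst R) x))))"
          using dev_Some[of False "dev True t" R] c Some
          by (simp, intro subst_cong_vars) (simp add: tvars_relab)
        then show ?thesis
          unfolding dev_Some[OF Some]
          by simp (rule subst_word_op_cong[where s = "plain (snd R)", OF g], simp add: less well_annotated_subterm)
      qed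
    qed
  qed
qed

text \<open>A subterm of a development is either the development of a subterm of \<open>t\<close> or
  an instance \<open>I R s q\<close> of a subterm \<open>q\<close> of a right-hand side; these form
  the finite set \<open>F\<close>. When \<open>q\<close> is a variable, the second kind falls back
  to the first, so one-letter steps stay in \<open>F\<close>.\<close>

lemma rational_dev:
  assumes t: "well_annotated t" "rational t"
  shows "rational (dev only t)"
proof (rule rational_subterm_closed)
  define I where "I R s = (\<lambda>q. subst (plain q) (\<lambda>x. dev only (subterm s (var_pos (fst R) x))))"
    for R :: "('f, 'v) trule" and s :: "('f, 'v) aterm"
  define F where "F = dev only ` range (subterm t) \<union>
    (\<Union>R\<in>S. \<Union>s\<in>range (subterm t). I R s ` range (subterm (snd R)))"
  have ft: "finite (range (subterm t))" using t(2) by (simp add: rational_def)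
  have fr: "finite (range (subterm (snd R)))" if "R \<in> S" for R
    using rational_rhs[OF that] by (simp add: rational_def)
  show "finite F"
    unfolding F_def
    by (intro finite_UnI finite_UN_I finite_imageI[OF ft] finite_imageI[OF fr] finite_rules ft)
  have F: "dev only (subterm t w) \<in> F" for w
    unfolding F_def by (intro UnI1 imageI rangeI)
  have IF: "I R (subterm t w) (subterm (snd R) v) \<in> F" if "R \<in> S" for R w v
    unfolding F_def using that by (intro UnI2 UN_I[of R] UN_I[of "subterm t w"] imageI rangeI)
  show "dev only t \<in> F"
    using F[of "[]"] by simp
  fix s i assume s: "s \<in> F"
  have dv: "subterm (dev only (subterm t w)) [i] \<in> F" for w
  proof (cases "contracted only (subterm t w)")
    case None
    then show ?thesis using F by (simp add: subterm_dev)
  next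
    case (Some R)
    obtain g where "plain (snd R) [] = Some (Inl (g, None))" by (rule plain_rhs_root[OF Some])
    then have "subterm (dev only (subterm t w)) [i] = I R (subterm t w) (subterm (snd R) [i])"
      unfolding dev_Some[OF Some] I_def by (simp add: subterm_subst_op flip: subterm_relab)
    moreover have "R \<in> S" using contracted_rule[OF well_annotated_subterm[OF t(1)] Some] .
    ultimately show ?thesis using IF by simp
  qed
  consider w where "s = dev only (subterm t w)"
    | R w v where "R \<in> S" "s = I R (subterm t w) (subterm (snd R) v)"
    using s unfolding F_def by (elim UnE UN_E imageE rangeE) auto
  then show "subterm s [i] \<in> F"
  proof cases
    case 1
    then show ?thesis using dv by simp
  next
    case (2 R w v)
    define q where "q = subterm (snd R) v"
    show ?thesis
    proof (cases "\<exists>x. q [] = Some (Inr x)")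
      case True
      then obtain x where "plain q [] = Some (Inr x)" by (auto simp: relab_Inr)
      then have "s = dev only (subterm t (w @ var_pos (fst R) x))"
        using 2 by (simp add: I_def subst_Inr_root flip: q_def)
      then show ?thesis using dv by simp
    next
      case False
      then have "subterm s [i] = I R (subterm t w) (subterm q [i])"
        using 2 by (simp add: I_def subterm_subst_op relab_Inr flip: subterm_relab q_def)
      then have "subterm s [i] = I R (subterm t w) (subterm (snd R) (v @ [i]))"
        by (simp add: q_def)
      then show ?thesis using IF[OF 2(1)] by simp
    qed
  qed
qed

end


section \<open>Developments and parallel reduction\<close>

declare split_paired_All [simp del] split_paired_Ex [simp del]

lemma rational_relab: "rational t \<Longrightarrow> rational (relab h t)"
  by (rule rational_mapped[where F = "relab h"]) (simp_all add: subterm_relab)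

lemma relab_replace_at: "relab h (replace_at t w s) = replace_at (relab h t) w (relab h s)"
  by (auto simp: relab_def replace_at_def)

lemma Map_graph_iff: "(w, R) \<in> Map.graph M \<longleftrightarrow> M w = Some R"
  by (simp add: Map.graph_def)

lemma Map_graph_empty: "Map.graph M = {} \<longleftrightarrow> M = Map.empty"
proof
  assume e: "Map.graph M = {}"
  have "M w = None" for w
  proof (cases "M w")
    case (Some R)
    then have "(w, R) \<in> Map.graph M" by (simp add: Map_graph_iff)
    then show ?thesis using e by simp
  qed
  then show "M = Map.empty" by blast
qed (simp add: Map.graph_def)

lemma fst_Map_graph: "fst ` Map.graph M = dom M"
  by (force simp: Map.graph_def)

lemma finite_short_positions:
  assumes "is_term ar t"
  shows "finite {w. t w \<noteq> None \<and> length w < n}"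
proof (induction n)
  case (Suc n)
  define A where "A = {w. t w \<noteq> None \<and> length w < n}"
  define B where "B = insert [] (\<Union>w\<in>A. \<Union>f\<in>{f. t w = Some (Inl f)}. (\<lambda>i. w @ [i]) ` {..ar f})"
  have "finite {f. t w = Some (Inl f)}" for w
    by (rule finite_subset[of _ "{projl (the (t w))}"]) auto
  then have "finite B" using Suc.IH by (auto simp: B_def A_def)
  moreover have "w \<in> B" if w: "t w \<noteq> None" "length w < Suc n" for w
  proof (cases w rule: rev_cases)
    case (snoc u i)
    then obtain f where f: "t u = Some (Inl f)" "1 \<le> i" "i \<le> ar f"
      using is_term_snocD[OF assms] w(1) by blast
    then have "u \<in> A" using w(2) snoc by (simp add: A_def)
    then show ?thesis using f snoc by (auto simp: B_def)
  qed (simp add: B_def)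
  then have "{w. t w \<noteq> None \<and> length w < Suc n} \<subseteq> B" by blast
  ultimately show ?case by (rule rev_finite_subset)
qed simp

section \<open>Chains, least upper bounds and continuity of developments\<close>

lemma term_chain_mono:
  assumes "term_chain T" "i \<le> j"
  shows "T i \<subseteq>\<^sub>m T j"
  using assms(2,1) by (induction rule: dec_induct) (auto simp: term_chain_def intro: map_le_trans)

text \<open>A least upper bound among terms is the pointwise union: the restriction \<open>u\<close>
  of \<open>t\<close> to the positions defined in some \<open>T i\<close> is again a term and an
  upper bound, so \<open>t\<close> lies below it.\<close>

lemma is_lub_term_iff:
  assumes T: "term_chain T" "\<And>i. is_term ar (T i)"
  shows "is_lub_term ar T t \<longleftrightarrow>
    is_term ar t \<and> (\<forall>i. T i \<subseteq>\<^sub>m t) \<and> (\<forall>w y. t w = Some y \<longrightarrow> (\<exists>i. T i w = Some y))"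
proof
  assume L: "is_lub_term ar T t"
  define u where "u w = (if \<exists>i. T i w \<noteq> None then t w else None)" for w
  have le: "T i \<subseteq>\<^sub>m t" for i using L by (simp add: is_lub_term_def)
  then have eq: "t w = T i w" if "T i w \<noteq> None" for i w
    using that unfolding map_le_def by (metis domIff)
  have "T i \<subseteq>\<^sub>m u" for i
    unfolding map_le_def u_def using eq by (metis domIff)
  moreover have "is_term ar u"
    unfolding is_term_def
  proof (intro allI impI)
    fix w k assume "u (w @ [k]) \<noteq> None"
    then obtain i where i: "T i (w @ [k]) \<noteq> None" by (auto simp: u_def split: if_splits)
    then obtain f where f: "T i w = Some (Inl f)" "1 \<le> k" "k \<le> ar f"
      using is_term_snocD[OF T(2)] by blast
    then have "u w = Some (Inl f)" using eq[of i w] unfolding u_def by (metis option.distinct(1))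
    then show "\<exists>f. u w = Some (Inl f) \<and> 1 \<le> k \<and> k \<le> ar f" using f by blast
  qed
  ultimately have tu: "t \<subseteq>\<^sub>m u" using L by (simp add: is_lub_term_def)
  have "\<exists>i. T i w = Some y" if "t w = Some y" for w y
  proof -
    have "u w = Some y" using tu that unfolding map_le_def by (metis domI)
    then obtain i where "T i w \<noteq> None" by (auto simp: u_def split: if_splits)
    then show ?thesis using eq[of i w] that by auto
  qed
  then show "is_term ar t \<and> (\<forall>i. T i \<subseteq>\<^sub>m t) \<and> (\<forall>w y. t w = Some y \<longrightarrow> (\<exists>i. T i w = Some y))"
    using L by (auto simp: is_lub_term_def)
next
  assume R: "is_term ar t \<and> (\<forall>i. T i \<subseteq>\<^sub>m t) \<and> (\<forall>w y. t w = Some y \<longrightarrow> (\<exists>i. T i w = Some y))"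
  have "t \<subseteq>\<^sub>m u" if "\<forall>i. T i \<subseteq>\<^sub>m u" for u
    unfolding map_le_def
  proof
    fix w assume "w \<in> dom t"
    then obtain y where "t w = Some y" by auto
    moreover then obtain i where "T i w = Some y" using R by blast
    ultimately show "t w = u w" using that unfolding map_le_def by (metis domI)
  qed
  then show "is_lub_term ar T t" using R by (simp add: is_lub_term_def)
qed

lemma subterm_map_le: "s \<subseteq>\<^sub>m t \<Longrightarrow> subterm s w \<subseteq>\<^sub>m subterm t w"
  by (auto simp: map_le_def subterm_def)

lemma map_le_SomeD: "s \<subseteq>\<^sub>m t \<Longrightarrow> s w = Some y \<Longrightarrow> t w = Some y"
  unfolding map_le_def by (metis domI)

text \<open>An undefined root makes \<open>s\<close> empty; otherwise \<open>s\<close> and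
  \<open>t\<close> share the root. As \<open>contracted\<close> looks at the root label alone, and
  not at the whole pattern, both then take the same decision, even if \<open>s\<close> lacks part of
  the pattern.\<close>

lemma dev_mono:
  assumes "is_term ar' s" "s \<subseteq>\<^sub>m t"
  shows "dev only s \<subseteq>\<^sub>m dev only t"
proof -
  have "dev only t w = Some y" if "dev only s w = Some y" for w y
    using assms that
  proof (induction "length w" arbitrary: w s t rule: less_induct)
    case less
    have "s [] \<noteq> None"
    proof
      assume "s [] = None"
      then have "s = Map.empty" by (rule is_term_None_root[OF less.prems(1)])
      then show False using less.prems(3) by simp
    qed
    then have root: "t [] = s []" using map_le_SomeD[OF less.prems(2), of "[]"] by auto
    then have c: "contracted only t = contracted only s" by (rule contracted_cong)
    show ?case
    proof (cases "contracted only s")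
      case None
      show ?thesis
      proof (cases w)
        case Nil
        then show ?thesis using None c root less.prems(3) by (simp add: dev_Nil)
      next
        case (Cons i u)
        then have "dev only (subterm s [i]) u = Some y"
          using less.prems(3) None by (simp add: dev_Cons)
        then have "dev only (subterm t [i]) u = Some y"
          using less.hyps[of u "subterm s [i]" "subterm t [i]"] less.prems Cons
          by (simp add: is_term_subterm subterm_map_le)
        then show ?thesis using None c Cons by (simp add: dev_Cons)
      qed
    next
      case (Some R)
      obtain g where g: "plain (snd R) [] = Some (Inl (g, None))" by (rule plain_rhs_root[OF Some])
      have d: "dev only s = subst (plain (snd R)) (\<lambda>x. dev only (subterm s (var_pos (fst R) x)))"
        "dev only t = subst (plain (snd R)) (\<lambda>x. dev only (subterm t (var_pos (fst R) x)))"
        by (rule dev_Some, simp add: Some c)+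
      show ?thesis
        using subst_word_op[where s = "plain (snd R)" and ?'x = 'b, OF g, of w]
      proof (elim disjE exE conjE, goal_cases)
        case (3 x u v)
        then have "dev only (subterm s (var_pos (fst R) x)) v = Some y"
          using less.prems(3) d(1) by simp
        then have "dev only (subterm t (var_pos (fst R) x)) v = Some y"
          using less.hyps[of v "subterm s (var_pos (fst R) x)" "subterm t (var_pos (fst R) x)"] less.prems 3
          by (simp add: is_term_subterm subterm_map_le)
        then show ?case using 3 d(2) by simp
      qed (use less.prems(3) d in simp_all)
    qed
  qed
  then show ?thesis unfolding map_le_def by (metis domD)
qed

text \<open>A label of the result depends on finitely many labels of \<open>t\<close>, each of which
  appears at some stage of the chain.\<close>

lemma dev_continuous:
  assumes "\<And>i. T i \<subseteq>\<^sub>m t" "term_chain T" "\<And>w y. t w = Some y \<Longrightarrow> \<exists>i. T i w = Some y"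
    and "is_term ar' t" "dev only t w = Some y"
  shows "\<exists>i. dev only (T i) w = Some y"
  using assms
proof (induction "length w" arbitrary: w t T rule: less_induct)
  case less
  have "t [] \<noteq> None"
  proof
    assume "t [] = None"
    then have "t = Map.empty" by (rule is_term_None_root[OF less.prems(4)])
    then show False using less.prems(5) by simp
  qed
  then obtain i where i: "T i [] = t []" using less.prems(3) by (metis option.exhaust)
  \<comment> \<open>The chain from the stage at which the root is settled; from there on all members
    contract at the root exactly as \<open>t\<close> does.\<close>
  define T' where "T' j = T (i + j)" for j
  have root: "T' j [] = t []" for j
    using i \<open>t [] \<noteq> None\<close> term_chain_mono[OF less.prems(2), of i "i + j"]
    using map_le_SomeD[of "T i" "T (i + j)" "[]"] unfolding T'_def by auto
  have c: "contracted only (T' j) = contracted only t" for j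
    by (rule contracted_cong) (rule root)
  have step: "\<exists>j. dev only (subterm (T' j) p) v = Some y"
    if "length v < length w" "dev only (subterm t p) v = Some y" for p v
  proof (rule less.hyps)
    show "length v < length w" "dev only (subterm t p) v = Some y" by fact+
    show "subterm (T' j) p \<subseteq>\<^sub>m subterm t p" for j
      using less.prems(1) by (simp add: T'_def subterm_map_le)
    show "term_chain (\<lambda>j. subterm (T' j) p)"
      using less.prems(2) by (simp add: T'_def term_chain_def subterm_map_le)
    show "is_term ar' (subterm t p)" using less.prems(4) by (rule is_term_subterm)
    show "\<exists>j. subterm (T' j) p u = Some z" if tz: "subterm t p u = Some z" for u z
    proof -
      have "\<exists>k. T k (p @ u) = Some z"
        by (rule less.prems(3)) (use tz in \<open>simp add: subterm_apply\<close>)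
      then obtain k where "T k (p @ u) = Some z" ..
      then have "T (i + k) (p @ u) = Some z"
        by (rule map_le_SomeD[OF term_chain_mono[OF less.prems(2)], rotated]) simp
      then have "subterm (T' k) p u = Some z" by (simp add: T'_def subterm_apply)
      then show ?thesis ..
    qed
  qed
  have "\<exists>j. dev only (T' j) w = Some y"
  proof (cases "contracted only t")
    case None
    show ?thesis
    proof (cases w)
      case Nil
      then show ?thesis using None c root less.prems(5) by (simp add: dev_Nil)
    next
      case (Cons k u)
      then show ?thesis using step[of u "[k]"] None c less.prems(5) by (simp add: dev_Cons)
    qed
  next
    case (Some R)
    obtain g where g: "plain (snd R) [] = Some (Inl (g, None))" by (rule plain_rhs_root[OF Some])
    have d: "dev only t = subst (plain (snd R)) (\<lambda>x. dev only (subterm t (var_pos (fst R) x)))"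
      "dev only (T' j) = subst (plain (snd R)) (\<lambda>x. dev only (subterm (T' j) (var_pos (fst R) x)))" for j
      by (rule dev_Some, simp add: Some c)+
    show ?thesis
      using subst_word_op[where s = "plain (snd R)" and ?'x = 'b, OF g, of w]
    proof (elim disjE exE conjE, goal_cases)
      case (3 x u v)
      then have "dev only (subterm t (var_pos (fst R) x)) v = Some y"
        using less.prems(5) d(1) by simp
      then obtain j where "dev only (subterm (T' j) (var_pos (fst R) x)) v = Some y"
        using step[of v "var_pos (fst R) x"] 3 by auto
      then have "dev only (T' j) w = Some y" using 3 d(2) by simp
      then show ?case ..
    qed (use less.prems(5) d in simp_all)
  qed
  then show ?case by (auto simp: T'_def)
qed

text \<open>A set of redexes is represented by a partial map \<open>M\<close> from occurrences to
  rules, since orthogonality admits one rule per occurrence. \<open>W\<close> supplies the bits.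
  Entries of \<open>M\<close> outside the operator positions of \<open>t\<close> have no effect,
  which helps when \<open>t\<close> is replaced by an approximation.\<close>

definition annot :: "(occ \<Rightarrow> ('f, 'v) trule option) \<Rightarrow> occ set \<Rightarrow> ('f, 'v) pterm \<Rightarrow> ('f, 'v) aterm" where
  "annot M W t = (\<lambda>w. map_option (map_sum (\<lambda>f. (f, map_option (\<lambda>R. (R, w \<in> W)) (M w))) id) (t w))"

lemma annot_Inl:
  "annot M W t w = Some (Inl (f, a)) \<longleftrightarrow> t w = Some (Inl f) \<and> a = map_option (\<lambda>R. (R, w \<in> W)) (M w)"
  by (cases "t w"; cases "the (t w)") (auto simp: annot_def)

lemma strip_annot [simp]: "strip (annot M W t) = t"
proof
  show "strip (annot M W t) w = t w" for w
    by (cases "t w"; cases "the (t w)") (auto simp: annot_def relab_def)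
qed

definition annotation :: "('f, 'v) aterm \<Rightarrow> occ \<Rightarrow> ('f, 'v) trule option" where
  "annotation t w = (case t w of Some (Inl (f, a)) \<Rightarrow> map_option fst a | _ \<Rightarrow> None)"

lemma annotation_Some:
  "annotation t w = Some R \<longleftrightarrow> (\<exists>f b. t w = Some (Inl (f, Some (R, b))))"
proof (cases "t w")
  case (Some y)
  then show ?thesis
    by (cases y; cases "snd (projl y)") (auto simp: annotation_def)
qed (simp add: annotation_def)

lemma annot_annotation:
  "annot (annotation t) {w. \<exists>f R. t w = Some (Inl (f, Some (R, True)))} (strip t) = t"
proof
  show "annot (annotation t) {w. \<exists>f R. t w = Some (Inl (f, Some (R, True)))} (strip t) w = t w" for w
  proof (cases "t w")
    case (Some y)
    then show ?thesis
      by (cases y) (auto simp: annot_def relab_def annotation_def map_option_case split: option.splits)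
  qed (simp add: annot_def relab_def)
qed

section \<open>Finite and infinite parallel reduction as full developments\<close>

context noncollapsing_orthogonal
begin

definition redexes :: "(occ \<Rightarrow> ('f, 'v) trule option) \<Rightarrow> ('f, 'v) pterm \<Rightarrow> bool" where
  "redexes M t \<longleftrightarrow> is_term ar t \<and> (\<forall>w R. M w = Some R \<longrightarrow> R \<in> S \<and> is_redex ar t (w, R))"

definition full_dev :: "(occ \<Rightarrow> ('f, 'v) trule option) \<Rightarrow> ('f, 'v) pterm \<Rightarrow> ('f, 'v) pterm" where
  "full_dev M t = strip (dev False (annot M {} t))"

lemma redexes_annot: "redexes M t \<Longrightarrow> well_annotated (annot M W t)"
proof (rule well_annotatedI)
  assume M: "redexes M t"
  then show "is_term ar (strip (annot M W t))" by (simp add: redexes_def)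
  fix w f R b assume "annot M W t w = Some (Inl (f, Some (R, b)))"
  then have "M w = Some R" by (cases "M w") (simp_all add: annot_Inl)
  then show "R \<in> S \<and> matches (fst R) (subterm (strip (annot M W t)) w)"
    using M is_redex_iff unfolding redexes_def strip_annot by blast
qed

lemma redexes_annotation: "well_annotated t \<Longrightarrow> redexes (annotation t) (strip t)"
  unfolding redexes_def
proof (intro conjI allI impI)
  assume t: "well_annotated t"
  then show s: "is_term ar (strip t)" by (rule well_annotated_strip)
  fix w R assume "annotation t w = Some R"
  then obtain f b where "t w = Some (Inl (f, Some (R, b)))" unfolding annotation_Some by blast
  note R = well_annotated_matches[OF t this]
  then show "R \<in> S" "is_redex ar (strip t) (w, R)" by (auto simp: is_redex_iff[OF R(1) s])
qed

lemma redexesD: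
  assumes "redexes M t" "M w = Some R"
  shows "R \<in> S" "matches (fst R) (subterm t w)" "\<exists>f. t w = Some (Inl f)"
proof -
  show R: "R \<in> S" and m: "matches (fst R) (subterm t w)"
    using assms is_redex_iff unfolding redexes_def by blast+
  obtain f where "fst R [] = Some (Inl f)" using lhs_root[OF R] by blast
  then have "subterm t w [] = Some (Inl f)" using m unfolding matches_def by blast
  then show "\<exists>f. t w = Some (Inl f)" by simp
qed

lemma full_dev_bits: "strip (dev False (annot M W t)) = full_dev M t"
proof -
  define h :: "('f, 'v) alabel \<Rightarrow> ('f, 'v) alabel"
    where "h = (\<lambda>(f, a). (f, map_option (\<lambda>(R, b). (R, False)) a))"
  have c: "contracted False (relab h s) = contracted False s" for s
    by (auto simp: contracted_def relab_def h_def split: option.splits sum.splits)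
  have "annot M {} t = relab h (annot M W t)"
  proof
    show "annot M {} t w = relab h (annot M W t) w" for w
      by (cases "t w"; cases "the (t w)"; cases "M w") (auto simp: annot_def relab_def h_def)
  qed
  then have "full_dev M t = strip (dev False (relab h (annot M W t)))"
    by (simp add: full_dev_def)
  also have "\<dots> = strip (dev False (annot M W t))"
    by (rule strip_dev_relab[OF _ c]) (simp add: h_def split: prod.splits)
  finally show ?thesis by simp
qed

lemma full_dev_annotation: "full_dev (annotation t) (strip t) = strip (dev False t)"
  using full_dev_bits[of "annotation t" "{w. \<exists>f R. t w = Some (Inl (f, Some (R, True)))}" "strip t"]
  unfolding annot_annotation by (rule sym)

lemma full_dev_none: "full_dev Map.empty t = t"
proof -
  have "contracted False (subterm (annot Map.empty {} t) w) = None" for w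
    by (cases "t w"; cases "the (t w)") (auto simp: contracted_def annot_def)
  then show ?thesis by (simp add: full_dev_def dev_inactive)
qed

lemma var_pos_lhs:
  assumes "R \<in> S" "x \<in> tvars (snd R)"
  shows "fst R (var_pos (fst R) x) = Some (Inr x)" "var_pos (fst R) x \<noteq> []"
proof -
  obtain v where v: "fst R v = Some (Inr x)"
    using rhs_vars[OF assms(1)] assms(2) by (auto simp: tvars_def)
  then show *: "fst R (var_pos (fst R) x) = Some (Inr x)"
    using var_pos_eq[OF lhs_linear[OF assms(1)] v] by simp
  then show "var_pos (fst R) x \<noteq> []" using lhs_root[OF assms(1)] by auto
qed

text \<open>The annotations that survive a single contraction are the residuals as defined: symbols
  of the contractum are plain, a copy at a variable occurrence of \<open>r\<close> keeps the
  annotations found below the occurrence of this variable in \<open>l\<close>, and positions not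
  below \<open>w\<close> are untouched.\<close>

lemma residuals_dev:
  assumes M: "redexes M t" "M w = Some R"
    and b: "b = replace_at (annot M {w} t) w
      (subst (plain (snd R)) (\<lambda>x. subterm (annot M {w} t) (w @ var_pos (fst R) x)))"
  shows "Map.graph (annotation b) = (\<Union>\<Delta>\<in>Map.graph M. residuals (w, R) \<Delta>)"
proof -
  obtain l r where lr: "R = (l, r)" by fastforce
  note RS = redexesD(1)[OF M]
  have r: "is_term (ar \<circ> fst) (plain r)"
    using rhs_term[OF RS] lr by (simp add: is_term_relab[of _ _ ar])
  have rvar: "l (var_pos l x) = Some (Inr x)" "var_pos l x \<noteq> []" if "r u = Some (Inr x)" for u x
    using var_pos_lhs[OF RS, of x] that lr by (auto simp: tvars_def)
  have ann: "(\<exists>f b. annot M {w} t u = Some (Inl (f, Some (R', b)))) \<longleftrightarrow> M u = Some R'" for u R'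
    using redexesD(3)[OF M(1), of u R'] by (cases "M u") (auto simp: annot_Inl)
  have "(u, R') \<in> Map.graph (annotation b) \<longleftrightarrow> (u, R') \<in> (\<Union>\<Delta>\<in>Map.graph M. residuals (w, R) \<Delta>)"
    for u R'
  proof (cases "prefix w u")
    case False
    have "(u, R') \<in> (\<Union>\<Delta>\<in>Map.graph M. residuals (w, R) \<Delta>) \<longleftrightarrow> M u = Some R'"
    proof
      assume "(u, R') \<in> (\<Union>\<Delta>\<in>Map.graph M. residuals (w, R) \<Delta>)"
      then show "M u = Some R'"
        using False lr by (force simp: Map.graph_def split: if_splits)
    next
      assume "M u = Some R'"
      then have "(u, R') \<in> Map.graph M" by (simp add: Map.graph_def)
      moreover have "(u, R') \<in> residuals (w, R) (u, R')" using False lr by auto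
      ultimately show "(u, R') \<in> (\<Union>\<Delta>\<in>Map.graph M. residuals (w, R) \<Delta>)" by blast
    qed
    moreover have "b u = annot M {w} t u" using False b by (simp add: replace_at_def)
    ultimately show ?thesis
      using ann[of u R'] unfolding Map_graph_iff annotation_Some by metis
  next
    case True
    then obtain u' where u: "u = w @ u'" by (auto simp: prefix_def)
    have bu: "b u = subst (plain r) (\<lambda>x. subterm (annot M {w} t) (w @ var_pos l x)) u'"
      using u b lr by (simp add: replace_at_def)
    show ?thesis
    proof
      assume "(u, R') \<in> Map.graph (annotation b)"
      then obtain f c where fc: "b u = Some (Inl (f, Some (R', c)))"
        by (auto simp: Map.graph_def annotation_Some)
      show "(u, R') \<in> (\<Union>\<Delta>\<in>Map.graph M. residuals (w, R) \<Delta>)"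
        using subst_word[of "plain r" u', where ?'x = 'v]
      proof (elim disjE exE conjE, goal_cases)
        case (1 y)
        then show ?case using fc bu by simp
      next
        case (2 y g)
        then show ?case using fc bu by (auto simp: relab_Inl)
      next
        case (3 x p q)
        then have x: "r p = Some (Inr x)" by (simp add: relab_Inr)
        have "annot M {w} t (w @ var_pos l x @ q) = Some (Inl (f, Some (R', c)))"
          using fc bu 3 by (simp add: subterm_apply)
        then have "M (w @ var_pos l x @ q) = Some R'" using ann by blast
        then have "(w @ var_pos l x @ q, R') \<in> Map.graph M" by (simp add: Map.graph_def)
        moreover have "(u, R') \<in> residuals (w, R) (w @ var_pos l x @ q, R')"
          using u 3(1) x rvar[OF x] lr by auto
        ultimately show ?case by blast
      qed
    next
      assume "(u, R') \<in> (\<Union>\<Delta>\<in>Map.graph M. residuals (w, R) \<Delta>)"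
      then obtain w' R'' where w': "M w' = Some R''" "(u, R') \<in> residuals (w, R) (w', R'')"
        by (auto simp: Map.graph_def)
      have "prefix w w'"
        using w'(2) True lr by (auto split: if_splits)
      then obtain p v v' x where v: "u = w @ p @ v'" "R'' = R'" "w' = w @ v @ v'"
        "l v = Some (Inr x)" "r p = Some (Inr x)"
        using w'(2) lr by (auto split: if_splits)
      have "var_pos l x = v" using var_pos_eq[OF lhs_linear[OF RS]] v(4) lr by simp
      moreover have "subst (plain r) (\<lambda>x. subterm (annot M {w} t) (w @ var_pos l x)) (p @ v') =
        subterm (annot M {w} t) (w @ var_pos l x) v'"
        using v(5) by (intro subst_at_var[OF r]) (simp add: relab_Inr)
      ultimately have "b u = annot M {w} t w'" using bu u v by (simp add: subterm_apply)
      then show "(u, R') \<in> Map.graph (annotation b)"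
        using ann[of w' R'] w'(1) v(2) by (simp add: Map.graph_def annotation_Some)
    qed
  qed
  then show ?thesis by auto
qed

text \<open>With the bit set at \<open>w\<close> alone, \<open>dev True\<close> is the given
  reduction, and the triangle property says that the full development of the residuals is the full
  development of the original set.\<close>

lemma contract_one:
  assumes M: "redexes M t" "M w = Some R" and red: "reduces ar t (w, R) t'"
  obtains M' where "Map.graph M' = (\<Union>\<Delta>\<in>Map.graph M. residuals (w, R) \<Delta>)"
    "redexes M' t'" "full_dev M' t' = full_dev M t"
proof -
  define s where "s = annot M {w} t"
  define b where "b = dev True s"
  note RS = redexesD(1)[OF M]
  have wa: "well_annotated s" unfolding s_def by (rule redexes_annot[OF M(1)])
  obtain f where f: "t w = Some (Inl f)" using redexesD(3)[OF M] by blast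
  have "s w = Some (Inl (f, Some (R, True)))" using f M(2) by (simp add: s_def annot_Inl)
  then have "contracted True (subterm s w) = Some R"
    using contracted_all(2)[OF well_annotated_subterm[OF wa], of w f R True] by simp
  moreover have "contracted True (subterm s u) = None" if "u \<noteq> w" for u
    using that by (cases "t u"; cases "the (t u)"; cases "M u") (auto simp: contracted_def s_def annot_def)
  ultimately have b: "b = replace_at s w (subst (plain (snd R)) (\<lambda>x. subterm s (w @ var_pos (fst R) x)))"
    unfolding b_def using var_pos_lhs(2)[OF RS] by (intro dev_single)
  have "strip b = replace_at t w (subst (snd R) (\<lambda>x. subterm t (w @ var_pos (fst R) x)))"
    unfolding b s_def relab_replace_at relab_subst strip_plain strip_annot subterm_relab[symmetric] ..
  also have "\<dots> = t'"
    using red reduces_iff[of ar "fst R" "snd R" t w t'] rule[OF RS] lhs_linear[OF RS] M(1)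
    by (simp add: redexes_def)
  finally have t': "strip b = t'" .
  have wb: "well_annotated b" unfolding b_def by (rule well_annotated_dev[OF wa])
  have "full_dev (annotation b) t' = strip (dev False b)"
    using full_dev_annotation[of b] t' by simp
  also have "\<dots> = full_dev M t"
    unfolding b_def dev_False_dev_True[OF wa] by (simp add: s_def full_dev_bits)
  finally show ?thesis
    using that[of "annotation b"] residuals_dev[OF M b[unfolded s_def]] redexes_annotation[OF wb] t'
    by simp
qed

text \<open>\<open>full_dev\<close> is invariant along the steps of a complete development and the
  identity when no redex remains.\<close>

lemma complete_dev_unique:
  assumes "complete_dev ar t \<Phi> t'" "\<Phi> = Map.graph M" "redexes M t"
  shows "t' = full_dev M t"
  using assms
proof (induction arbitrary: M)
  case (finished t)
  then have "M = Map.empty" using Map_graph_empty[of M] by simp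
  then show ?case by (simp add: full_dev_none)
next
  case (step \<Delta> \<Phi> t t' t'')
  obtain w R where \<Delta>: "\<Delta> = (w, R)" by fastforce
  then have "M w = Some R" using step.hyps(1) step.prems(1) by (simp add: Map.graph_def)
  moreover have "reduces ar t (w, R) t'" using step.hyps(2) \<Delta> by simp
  ultimately obtain M' where M': "Map.graph M' = (\<Union>\<Delta>'\<in>Map.graph M. residuals (w, R) \<Delta>')"
    "redexes M' t'" "full_dev M' t' = full_dev M t"
    by (rule contract_one[OF step.prems(2)])
  show ?case
    using step.IH[OF _ M'(2)] M'(1,3) step.prems(1) \<Delta> by simp
qed

text \<open>Always contract a redex at maximal depth. No marked redex lies strictly below it, so
  nothing is duplicated and the set shrinks. Another choice could create infinitely many residuals,
  as right-hand sides may be infinite.\<close>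

lemma complete_dev_exists:
  assumes "redexes M t" "finite (Map.graph M)"
  shows "complete_dev ar t (Map.graph M) (full_dev M t)"
  using assms
proof (induction "card (Map.graph M)" arbitrary: M t rule: less_induct)
  case less
  show ?case
  proof (cases "Map.graph M = {}")
    case True
    then have "M = Map.empty" by (simp add: Map_graph_empty)
    then show ?thesis unfolding True by (simp add: full_dev_none complete_dev.finished)
  next
    case False
    have "finite (length ` fst ` Map.graph M)" using less.prems(2) by simp
    moreover have "length ` fst ` Map.graph M \<noteq> {}" using False by simp
    ultimately have "Max (length ` fst ` Map.graph M) \<in> length ` fst ` Map.graph M"
      by (rule Max_in)
    then obtain w R where w: "(w, R) \<in> Map.graph M" "length w = Max (length ` fst ` Map.graph M)"
      by auto
    have mx: "length w' \<le> length w" if "(w', R') \<in> Map.graph M" for w' R'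
      unfolding w(2) using less.prems(2) that by (intro Max_ge) (auto intro!: image_eqI[of _ _ w'] image_eqI[of _ _ "(w', R')"])
    have MR: "M w = Some R" using w(1) by (simp add: Map.graph_def)
    note RS = redexesD(1,2)[OF less.prems(1) MR]
    have it: "is_term ar t" using less.prems(1) by (simp add: redexes_def)
    obtain t' where red: "reduces ar t (w, R) t'"
      using reduces_iff[of ar "fst R" "snd R" t w] RS rule[OF RS(1)] lhs_linear[OF RS(1)] it by simp
    obtain M' where M': "Map.graph M' = (\<Union>\<Delta>\<in>Map.graph M. residuals (w, R) \<Delta>)"
      "redexes M' t'" "full_dev M' t' = full_dev M t"
      by (rule contract_one[OF less.prems(1) MR red])
    have "residuals (w, R) (w', R') \<subseteq> Map.graph M - {(w, R)}" if "(w', R') \<in> Map.graph M" for w' R'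
    proof (cases "prefix w w'")
      case True
      then have "w' = w" using mx[OF that] by (auto simp: prefix_def)
      then have "R' = R" using that MR unfolding Map_graph_iff by (metis option.inject)
      then show ?thesis using \<open>w' = w\<close> by (cases R) simp
    next
      case False
      then show ?thesis using that by (cases R) auto
    qed
    then have sub: "Map.graph M' \<subseteq> Map.graph M - {(w, R)}" unfolding M'(1) by fast
    then have "card (Map.graph M') < card (Map.graph M)"
      using w(1) less.prems(2) by (intro psubset_card_mono) auto
    moreover have "finite (Map.graph M')" using sub less.prems(2) by (meson finite_Diff finite_subset)
    ultimately have "complete_dev ar t' (Map.graph M') (full_dev M' t')"
      using less.hyps M'(2) by blast
    then show ?thesis
      unfolding M'(1,3) by (rule complete_dev.step[OF w(1) red])
  qed
qed

text \<open>On an approximation \<open>T\<close>, the redexes still present are those whose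
  occurrence is defined. Since undefined occurrences cannot be annotated,
  \<open>annot M {} T\<close> describes them for all members of a chain with the same
  \<open>M\<close>, as continuity requires.\<close>

lemma redexes_restrict:
  assumes M: "redexes M t" and T: "is_term ar T" "T \<subseteq>\<^sub>m t"
    and d: "\<forall>\<Delta>\<in>Map.graph M. is_redex ar T \<Delta> \<or> T (fst \<Delta>) = None"
  shows "{\<Delta> \<in> Map.graph M. is_redex ar T \<Delta>} = Map.graph (M |` dom T)"
    and "redexes (M |` dom T) T"
    and "annot (M |` dom T) {} T = annot M {} T"
proof -
  have *: "is_redex ar T (w, R) \<longleftrightarrow> T w \<noteq> None" if "M w = Some R" for w R
  proof
    assume "is_redex ar T (w, R)"
    moreover have RS: "R \<in> S" using redexesD(1)[OF M that] .
    ultimately have "matches (fst R) (subterm T w)" using is_redex_iff T(1) by blast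
    then show "T w \<noteq> None"
      using lhs_root[OF RS] unfolding matches_def by (metis option.distinct(1) subterm_apply_Nil)
  next
    assume "T w \<noteq> None"
    moreover have "(w, R) \<in> Map.graph M" using that by (simp add: Map.graph_def)
    ultimately show "is_redex ar T (w, R)" using d by fastforce
  qed
  show "{\<Delta> \<in> Map.graph M. is_redex ar T \<Delta>} = Map.graph (M |` dom T)" (is "?A = ?B")
  proof -
    have "(w, R) \<in> ?A \<longleftrightarrow> (w, R) \<in> ?B" for w R
      using *[of w R] by (cases "T w") (auto simp: Map_graph_iff restrict_map_def domIff)
    then show ?thesis by fast
  qed
  show "redexes (M |` dom T) T"
    unfolding redexes_def
  proof (intro conjI allI impI T(1))
    fix w R assume "(M |` dom T) w = Some R"
    then have "M w = Some R" "T w \<noteq> None" by (auto simp: restrict_map_def split: if_splits)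
    then show "R \<in> S" "is_redex ar T (w, R)" using * redexesD(1)[OF M] by auto
  qed
  show "annot (M |` dom T) {} T = annot M {} T"
    by (auto simp: annot_def fun_eq_iff restrict_map_def domIff)
qed

lemma annot_mono: "s \<subseteq>\<^sub>m t \<Longrightarrow> annot M W s \<subseteq>\<^sub>m annot M W t"
  by (auto simp: map_le_def annot_def dom_def)

lemma is_lub_full_dev:
  assumes M: "redexes M t" and T: "term_chain T" "\<And>i. is_term ar (T i)" "is_lub_term ar T t"
    and d: "\<And>i. d i = strip (dev False (annot M {} (T i)))" "\<And>i. is_term ar (d i)"
  shows "is_lub_term ar d (full_dev M t)" "term_chain d"
proof -
  have L: "\<And>i. T i \<subseteq>\<^sub>m t" "\<And>w y. t w = Some y \<Longrightarrow> \<exists>i. T i w = Some y" "is_term ar t"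
    using is_lub_term_iff[of T ar t] T by auto
  have sm: "strip s \<subseteq>\<^sub>m strip s'" if "s \<subseteq>\<^sub>m s'" for s s' :: "('f, 'v) aterm"
    using that by (auto simp: map_le_def relab_def dom_def)
  have ia: "is_term (ar \<circ> fst) (annot M {} s)" if "is_term ar s" for s
    using that is_term_relab[of ar fst "ar \<circ> fst" "annot M {} s"] by simp
  have ch: "term_chain (\<lambda>i. annot M {} (T i))"
    using T(1) by (simp add: term_chain_def annot_mono)
  show dch: "term_chain d"
    unfolding term_chain_def d(1)
    using T(1) by (auto intro!: sm dev_mono[OF ia[OF T(2)]] annot_mono simp: term_chain_def)
  have up: "d i \<subseteq>\<^sub>m full_dev M t" for i
    unfolding d(1) full_dev_def by (intro sm dev_mono[OF ia[OF T(2)]] annot_mono L(1))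
  have it: "is_term ar (full_dev M t)"
    unfolding full_dev_def using is_term_dev[OF redexes_annot[OF M]]
    by (simp add: is_term_relab[of ar fst "ar \<circ> fst"])
  have "\<exists>i. d i w = Some y" if "full_dev M t w = Some y" for w y
  proof -
    have "\<exists>z. dev False (annot M {} t) w = Some z \<and> y = map_sum fst id z"
      using that by (auto simp: full_dev_def relab_def)
    then obtain z where z: "dev False (annot M {} t) w = Some z" "y = map_sum fst id z"
      by blast
    have "\<exists>i. dev False (annot M {} (T i)) w = Some z"
    proof (rule dev_continuous[OF _ ch _ ia[OF L(3)] z(1)])
      show "annot M {} (T i) \<subseteq>\<^sub>m annot M {} t" for i by (intro annot_mono L(1))
      show "\<exists>i. annot M {} (T i) u = Some c" if uc: "annot M {} t u = Some c" for u c
      proof -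
        obtain c' where c': "t u = Some c'" using uc by (auto simp: annot_def)
        then obtain i where "T i u = Some c'" using L(2) by blast
        then have "annot M {} (T i) u = Some c" using uc c' by (simp add: annot_def)
        then show ?thesis ..
      qed
    qed
    then show ?thesis using z(2) by (auto simp: d(1) relab_def)
  qed
  then show "is_lub_term ar d (full_dev M t)"
    using is_lub_term_iff[OF dch d(2)] it up by blast
qed

lemma full_dev_term: "redexes M t \<Longrightarrow> is_term ar (full_dev M t)"
  unfolding full_dev_def using is_term_dev[OF redexes_annot]
  by (simp add: is_term_relab[of ar fst "ar \<circ> fst"])

text \<open>Whatever chain is chosen, its developments are those of the annotated approximations,
  whose least upper bound is \<open>full_dev M t\<close> by continuity. So the result is independent
  of the chain.\<close>

lemma inf_par_red_unique:
  assumes M: "redexes M t" and p: "inf_par_red ar t (Map.graph M) t'"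
  shows "t' = full_dev M t"
proof -
  obtain T d where T: "\<And>i. is_term ar (T i)" "term_chain T" "is_lub_term ar T t"
    and r: "\<And>i. \<forall>\<Delta>\<in>Map.graph M. is_redex ar (T i) \<Delta> \<or> T i (fst \<Delta>) = None"
    and c: "\<And>i. complete_dev ar (T i) {\<Delta> \<in> Map.graph M. is_redex ar (T i) \<Delta>} (d i)"
    and d: "is_lub_term ar d t'"
    using p unfolding inf_par_red_def by blast
  have le: "T i \<subseteq>\<^sub>m t" for i using T(3) by (simp add: is_lub_term_def)
  note rr = redexes_restrict[OF M T(1) le r]
  have di: "d i = full_dev (M |` dom (T i)) (T i)" for i
    using complete_dev_unique[OF c[of i]] rr[of i] by blast
  have "is_lub_term ar d (full_dev M t)"
  proof (rule is_lub_full_dev(1)[OF M T(2,1,3)])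
    show "d i = strip (dev False (annot M {} (T i)))" for i
      unfolding di full_dev_def rr(3) ..
    show "is_term ar (d i)" for i
      unfolding di by (rule full_dev_term) (rule rr(2))
  qed
  then show ?thesis using d unfolding is_lub_term_def by (meson map_le_antisym)
qed

text \<open>
  The approximations cut the term at all redexes at depth at least \<open>i\<close>. A redex that is not cut
  keeps its pattern because the redexes do not overlap.
\<close>

lemma inf_par_red_exists:
  assumes M: "redexes M t"
  shows "inf_par_red ar t (Map.graph M) (full_dev M t)"
proof -
  define cut where "cut i w \<longleftrightarrow> (\<exists>u. prefix u w \<and> i \<le> length u \<and> M u \<noteq> None)" for i w
  define T where "T i w = (if cut i w then None else t w)" for i w
  define d where "d i = full_dev (M |` dom (T i)) (T i)" for i
  have t: "is_term ar t" using M by (simp add: redexes_def)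
  have cut_mono: "cut i w \<Longrightarrow> cut i (w @ v)" for i w v
    unfolding cut_def by (blast intro: prefix_prefix)
  have Tt: "is_term ar (T i)" for i
    unfolding is_term_def
  proof (intro allI impI)
    fix w k assume a: "T i (w @ [k]) \<noteq> None"
    then have "\<not> cut i w" using cut_mono[of i w "[k]"] by (auto simp: T_def split: if_splits)
    then show "\<exists>f. T i w = Some (Inl f) \<and> 1 \<le> k \<and> k \<le> ar f"
      using a is_term_snocD[OF t, of w k] by (auto simp: T_def split: if_splits)
  qed
  have "cut (Suc i) w \<Longrightarrow> cut i w" for i w
    unfolding cut_def using Suc_leD by blast
  then have ch: "term_chain T"
    by (auto simp: term_chain_def map_le_def T_def split: if_splits)
  have le: "T i \<subseteq>\<^sub>m t" for i
    by (auto simp: map_le_def T_def split: if_splits)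
  have nc: "\<not> cut (Suc (length w)) w" for w
    by (auto simp: cut_def dest: prefix_length_le)
  have lub: "is_lub_term ar T t"
    unfolding is_lub_term_iff[OF ch Tt]
  proof (intro conjI allI impI t le)
    fix w y assume "t w = Some y"
    then have "T (Suc (length w)) w = Some y" using nc by (simp add: T_def)
    then show "\<exists>i. T i w = Some y" ..
  qed
  have red: "\<forall>\<Delta>\<in>Map.graph M. is_redex ar (T i) \<Delta> \<or> T i (fst \<Delta>) = None" for i
  proof
    fix \<Delta> assume "\<Delta> \<in> Map.graph M"
    then obtain w R where \<Delta>: "\<Delta> = (w, R)" "M w = Some R" by (cases \<Delta>) (simp add: Map.graph_def)
    note R = redexesD(1,2)[OF M \<Delta>(2)]
    have "is_redex ar (T i) (w, R)" if "T i w \<noteq> None"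
    proof -
      have w: "\<not> cut i w" using that by (auto simp: T_def)
      have "subterm (T i) w v = Some (Inl f)" if v: "fst R v = Some (Inl f)" for v f
      proof -
        have "\<not> cut i (w @ v)"
        proof
          assume "cut i (w @ v)"
          then obtain u where u: "prefix u (w @ v)" "i \<le> length u" "M u \<noteq> None"
            by (auto simp: cut_def)
          have "\<not> prefix u w" using u(2,3) w by (auto simp: cut_def)
          then obtain v' where v': "u = w @ v'" "v' \<noteq> []" "prefix v' v"
            using u(1) by (auto simp: prefix_append)
          then obtain v'' where v'': "v = v' @ v''" by (auto simp: prefix_def)
          obtain g where g: "fst R v' = Some (Inl g)"
            using is_term_prefix_op[OF lhs_term[OF R(1)], of v' v''] v v'' by (cases "v'' = []") auto
          obtain R' where R': "M (w @ v') = Some R'" using u(3) v'(1) by auto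
          have "matches (fst R') (subterm (subterm t w) v')"
            using redexesD(2)[OF M R'] by simp
          then show False
            using no_overlap[OF R(1) redexesD(1)[OF M R'] is_term_subterm[OF t] R(2) _ g] v'(2) by blast
        qed
        then show ?thesis
          using R(2) v by (simp add: subterm_apply T_def matches_def)
      qed
      then have "matches (fst R) (subterm (T i) w)" by (simp add: matches_def)
      then show ?thesis using is_redex_iff[OF R(1) Tt] by blast
    qed
    then show "is_redex ar (T i) \<Delta> \<or> T i (fst \<Delta>) = None" using \<Delta>(1) by auto
  qed
  note rr = redexes_restrict[OF M Tt le red]
  \<comment> \<open>A redex at depth at least \<open>i\<close> cuts its own occurrence, so the
    surviving ones lie at depth below \<open>i\<close>; there are finitely many such positions
    because arities are finite.\<close>
  have fin: "finite (Map.graph (M |` dom (T i)))" for i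
  proof (rule finite_subset)
    show "Map.graph (M |` dom (T i)) \<subseteq> {w. t w \<noteq> None \<and> length w < i} \<times> S"
    proof
      fix \<Delta> assume "\<Delta> \<in> Map.graph (M |` dom (T i))"
      then obtain w R where \<Delta>: "\<Delta> = (w, R)" "M w = Some R" "T i w \<noteq> None"
        by (cases \<Delta>) (auto simp: Map.graph_def restrict_map_def split: if_splits)
      then have "\<not> cut i w" "t w \<noteq> None" by (auto simp: T_def split: if_splits)
      then show "\<Delta> \<in> {w. t w \<noteq> None \<and> length w < i} \<times> S"
        using \<Delta> redexesD(1)[OF M \<Delta>(2)] by (auto simp: cut_def not_le)
    qed
    show "finite ({w. t w \<noteq> None \<and> length w < i} \<times> S)"
      using finite_short_positions[OF t] finite_rules by simp
  qed
  have "is_lub_term ar d (full_dev M t)"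
  proof (rule is_lub_full_dev(1)[OF M ch Tt lub])
    show "d i = strip (dev False (annot M {} (T i)))" for i
      unfolding d_def full_dev_def rr(3) ..
    show "is_term ar (d i)" for i
      unfolding d_def by (rule full_dev_term) (rule rr(2))
  qed
  moreover have "complete_dev ar (T i) (Map.graph (M |` dom (T i))) (d i)" for i
    unfolding d_def by (rule complete_dev_exists[OF rr(2) fin])
  ultimately show ?thesis
    unfolding inf_par_red_def using Tt ch lub red fin rr(1)
    by (intro exI[of _ T] exI[of _ d]) simp
qed

text \<open>Rules at a common occurrence coincide by \<open>matches_unique\<close>, so \<Phi> is the
  graph of a map, and the finite and the infinite case have the same explicit result. Chains and
  residuals are not mentioned after this point.\<close>

lemma par_red_iff:
  assumes t: "is_term ar (t :: ('f, 'v) pterm)"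
  shows "par_red ar S t \<Phi> t' \<longleftrightarrow> (\<exists>M. \<Phi> = Map.graph M \<and> redexes M t \<and> t' = full_dev M t)"
proof
  assume p: "par_red ar S t \<Phi> t'"
  have u: "R = R'" if "(w, R) \<in> \<Phi>" "(w, R') \<in> \<Phi>" for w R R'
  proof -
    have "R \<in> S" "R' \<in> S" "is_redex ar t (w, R)" "is_redex ar t (w, R')"
      using p that unfolding par_red_def by fastforce+
    then show ?thesis
      using matches_unique[OF _ _ is_term_subterm[OF t]] is_redex_iff[OF _ t] by blast
  qed
  define M where "M w = (if \<exists>R. (w, R) \<in> \<Phi> then Some (THE R. (w, R) \<in> \<Phi>) else None)" for w
  have Mw: "M w = Some R \<longleftrightarrow> (w, R) \<in> \<Phi>" for w R
  proof
    assume "M w = Some R"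
    then have "\<exists>R. (w, R) \<in> \<Phi>" "R = (THE R. (w, R) \<in> \<Phi>)" by (auto simp: M_def split: if_splits)
    then show "(w, R) \<in> \<Phi>" using theI'[of "\<lambda>R. (w, R) \<in> \<Phi>"] u by blast
  next
    assume R: "(w, R) \<in> \<Phi>"
    then have "(THE R. (w, R) \<in> \<Phi>) = R" using u by blast
    then show "M w = Some R" using R by (auto simp: M_def)
  qed
  then have \<Phi>: "\<Phi> = Map.graph M" by (auto simp: Map.graph_def)
  have rM: "redexes M t"
    using p t Mw unfolding redexes_def par_red_def by fastforce
  have "t' = full_dev M t"
  proof (cases "finite \<Phi>")
    case True
    then show ?thesis using p complete_dev_unique[OF _ \<Phi> rM] by (simp add: par_red_def)
  next
    case False
    then show ?thesis using p inf_par_red_unique[OF rM] \<Phi> by (simp add: par_red_def)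
  qed
  then show "\<exists>M. \<Phi> = Map.graph M \<and> redexes M t \<and> t' = full_dev M t" using \<Phi> rM by blast
next
  assume "\<exists>M. \<Phi> = Map.graph M \<and> redexes M t \<and> t' = full_dev M t"
  then obtain M where M: "\<Phi> = Map.graph M" "redexes M t" "t' = full_dev M t" by blast
  then have "\<forall>\<Delta>\<in>\<Phi>. snd \<Delta> \<in> S \<and> is_redex ar t \<Delta>"
    by (auto simp: Map.graph_def redexes_def simp del: split_paired_All)
  then show "par_red ar S t \<Phi> t'"
    using M complete_dev_exists[OF M(2)] inf_par_red_exists[OF M(2)] by (simp add: par_red_def)
qed

text \<open>The term with marked occurrences is a relabelling of \<open>t\<close>, so rationality of
  the annotated term is just what a rational step requires.\<close>

lemma rat_par_stepI:
  assumes t: "well_annotated t" "rational t"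
  shows "rat_par_step ar S (strip t) (strip (dev False t))"
proof -
  have "par_red ar S (strip t) (Map.graph (annotation t)) (strip (dev False t))"
    unfolding par_red_iff[OF well_annotated_strip[OF t(1)]]
    by (intro exI[of _ "annotation t"] conjI refl redexes_annotation[OF t(1)] full_dev_annotation[symmetric])
  moreover have "mark (dom (annotation t)) (strip t) = relab (\<lambda>(f, a). (f, a \<noteq> None)) t"
  proof
    show "mark (dom (annotation t)) (strip t) w = relab (\<lambda>(f, a). (f, a \<noteq> None)) t w" for w
      by (cases "t w"; cases "the (t w)") (auto simp: mark_def relab_def annotation_def dom_def)
  qed
  ultimately show ?thesis
    unfolding rat_par_step_def using rational_relab[OF t(2)]
    by (intro exI[of _ "Map.graph (annotation t)"]) (simp add: fst_Map_graph)
qed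

section \<open>The development of all redexes\<close>

definition redex_rule :: "('f, 'v) pterm \<Rightarrow> ('f, 'v) trule option" where
  "redex_rule t = (if \<exists>R\<in>S. matches (fst R) t then Some (THE R. R \<in> S \<and> matches (fst R) t) else None)"

lemma redex_rule_Some:
  assumes "is_term ar t"
  shows "redex_rule t = Some R \<longleftrightarrow> R \<in> S \<and> matches (fst R) t"
proof -
  let ?P = "\<lambda>R. R \<in> S \<and> matches (fst R) t"
  have the: "(THE R. ?P R) = R" if "?P R" for R
  proof (rule the_equality)
    fix R' assume "?P R'"
    then show "R' = R" by (intro matches_unique[OF _ _ assms]) (simp_all add: that)
  qed (rule that)
  show ?thesis
  proof
    assume r: "redex_rule t = Some R"
    then have "\<exists>R\<in>S. matches (fst R) t" unfolding redex_rule_def by (meson option.distinct(1))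
    then obtain R' where R': "?P R'" by blast
    then have "redex_rule t = Some (THE R. ?P R)" unfolding redex_rule_def by meson
    then show "?P R" using r the[OF R'] R' by simp
  next
    assume R: "?P R"
    then have "redex_rule t = Some (THE R. ?P R)" unfolding redex_rule_def by meson
    then show "redex_rule t = Some R" using the[OF R] by simp
  qed
qed

definition all_redexes :: "('f, 'v) pterm \<Rightarrow> occ \<Rightarrow> ('f, 'v) trule option" where
  "all_redexes t w = redex_rule (subterm t w)"

lemma all_redexes_Some:
  "is_term ar t \<Longrightarrow> all_redexes t w = Some R \<longleftrightarrow> R \<in> S \<and> is_redex ar t (w, R)"
  unfolding all_redexes_def by (auto simp: redex_rule_Some is_term_subterm is_redex_iff)

lemma redexes_all: "is_term ar t \<Longrightarrow> redexes (all_redexes t) t"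
  by (simp add: redexes_def all_redexes_Some del: split_paired_All)

text \<open>Whether an occurrence is a redex, and of which rule, is a function of the subterm there.
  So annotating all redexes, with the marks as bits, is a local operation on the marked
  term.\<close>

lemma rational_annot_all:
  assumes t: "rational (mark W t)" "is_term ar t"
  shows "rational (annot (all_redexes t) W t)"
proof (rule rational_mapped[OF t(1)])
  define F :: "('f \<times> bool, 'v) pterm \<Rightarrow> ('f, 'v) aterm" where
    "F s = (\<lambda>u. map_option (map_sum (\<lambda>(f, b).
      (f, map_option (\<lambda>R. (R, b)) (redex_rule (subterm (relab fst s) u)))) id) (s u))" for s
  have st: "relab fst (mark W t) = t"
  proof
    show "relab fst (mark W t) w = t w" for w
      by (cases "t w"; cases "the (t w)") (auto simp: relab_def mark_def)
  qed
  show "subterm (annot (all_redexes t) W t) w = F (subterm (mark W t) w)" for w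
  proof
    fix u
    show "subterm (annot (all_redexes t) W t) w u = F (subterm (mark W t) w) u"
      unfolding F_def subterm_relab[symmetric] subterm_subterm st
      by (cases "t (w @ u)"; cases "the (t (w @ u))")
        (auto simp: annot_def all_redexes_def subterm_apply mark_def)
  qed
qed

text \<open>In the term \<open>annot (all_redexes t) (dom M) t\<close> all redexes are annotated and
  the bits single out those of the given step. Its \<open>dev True\<close> erases to
  \<open>b\<close> and carries the residuals of the others. These form a rational step because
  \<open>rational_dev\<close> preserves rationality together with the annotations.\<close>

lemma rat_par_step_triangle:
  assumes t: "is_term ar t" and s: "rat_par_step ar S t b"
  shows "is_term ar b" "rat_par_step ar S b (full_dev (all_redexes t) t)"
proof -
  obtain M where M: "redexes M t" "b = full_dev M t" and rt: "rational (mark (dom M) t)"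
    using s unfolding rat_par_step_def par_red_iff[OF t] by (auto simp: fst_Map_graph)
  define s where "s = annot (all_redexes t) (dom M) t"
  \<comment> \<open>Drops the redexes that do not belong to the step, so that the full development
    of \<open>M\<close> can be compared with \<open>dev True s\<close>.\<close>
  define h :: "('f, 'v) alabel \<Rightarrow> ('f, 'v) alabel"
    where "h = (\<lambda>(f, a). (f, case a of Some (R, True) \<Rightarrow> Some (R, False) | _ \<Rightarrow> None))"
  have c: "contracted False (relab h s) = contracted True s" for s
    by (cases "s []"; cases "the (s [])"; cases "snd (projl (the (s [])))")
      (auto simp: contracted_def relab_def h_def split: bool.splits)
  have sub: "all_redexes t w = Some R" if "M w = Some R" for w R
    using M(1) that by (auto simp: redexes_def all_redexes_Some)
  have "annot M {} t = relab h s"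
  proof
    show "annot M {} t w = relab h s w" for w
      using sub[of w] by (cases "t w"; cases "the (t w)"; cases "M w"; cases "all_redexes t w")
        (auto simp: annot_def relab_def h_def s_def domIff)
  qed
  then have "b = strip (dev False (relab h s))" using M(2) by (simp add: full_dev_def)
  also have "\<dots> = strip (dev True s)"
    by (rule strip_dev_relab[OF _ c]) (simp add: h_def split: prod.splits)
  finally have b: "b = strip (dev True s)" .
  have wa: "well_annotated s" unfolding s_def by (rule redexes_annot[OF redexes_all[OF t]])
  have ra: "rational s" unfolding s_def by (rule rational_annot_all[OF rt t])
  note wb = well_annotated_dev[OF wa]
  show "is_term ar b" unfolding b by (rule well_annotated_strip[OF wb])
  show "rat_par_step ar S b (full_dev (all_redexes t) t)"
    using rat_par_stepI[OF wb rational_dev[OF wa ra]]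
    unfolding dev_False_dev_True[OF wa] b unfolding s_def full_dev_bits .
qed

end


section \<open>Unraveling\<close>

lemma path_end_append: "path_end G n (u @ v) = Option.bind (path_end G n u) (\<lambda>m. path_end G m v)"
  by (induction u arbitrary: n) (auto split: option.splits)

lemma path_end_nodes:
  assumes "is_graph ar G" "n \<in> nodes G" "path_end G n w = Some m"
  shows "m \<in> nodes G"
  using assms(2,3)
proof (induction w arbitrary: n)
  case (Cons i w)
  then obtain ns where ns: "sucs G n = Some ns" "1 \<le> i" "i \<le> length ns" "path_end G (ns ! (i - 1)) w = Some m"
    by (auto split: option.splits if_splits)
  then obtain f where "lab G n = Some f"
    using assms(1) unfolding is_graph_def by blast
  then have "ns ! (i - 1) \<in> nodes G" using ns assms(1) unfolding is_graph_def
    by (metis One_nat_def diff_less less_le_trans nth_mem subsetD zero_less_one)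
  then show ?case using Cons.IH ns by blast
qed simp

lemma sucs_Some:
  assumes "is_graph ar G" "lab G n = Some f"
  obtains ns where "sucs G n = Some ns" "length ns = ar f" "set ns \<subseteq> nodes G"
  using assms unfolding is_graph_def by blast

lemma sucs_None: "is_graph ar G \<Longrightarrow> lab G n = None \<Longrightarrow> sucs G n = None"
  unfolding is_graph_def by blast

text \<open>\<open>unravel\<close> with an arbitrary partial labelling of nodes. Plain and annotated
  terms, with variable nodes read as variables or as undefined, become instances over the same
  paths.\<close>

definition unr :: "('f, 'n) tgraph \<Rightarrow> ('n \<Rightarrow> ('g + 'v) option) \<Rightarrow> 'n \<Rightarrow> ('g, 'v) pterm" where
  "unr G lb n = (\<lambda>w. Option.bind (path_end G n w) lb)"

lemma unr_Nil [simp]: "unr G lb n [] = lb n"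
  by (simp add: unr_def)

lemma unr_at: "path_end G n w = Some m \<Longrightarrow> unr G lb n w = lb m"
  by (simp add: unr_def)

lemma subterm_unr: "path_end G n w = Some m \<Longrightarrow> subterm (unr G lb n) w = unr G lb m"
  by (simp add: unr_def subterm_def path_end_append)

lemma subterm_unr_None: "path_end G n w = None \<Longrightarrow> subterm (unr G lb n) w = Map.empty"
  by (simp add: unr_def subterm_def path_end_append)

lemma relab_unr: "relab h (unr G lb n) = unr G (\<lambda>m. map_option (map_sum h id) (lb m)) n"
  by (rule ext) (simp add: relab_def unr_def split: bind_split)

text \<open>Each subterm is the unraveling from some node or, off the paths, empty. As
  \<open>lb\<close> is arbitrary, annotations attached to nodes are covered, which is why parallel
  steps induced by graphs are rational.\<close>

lemma rational_unr:
  assumes "is_graph ar G" "n \<in> nodes G"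
  shows "rational (unr G lb n)"
proof -
  have "subterm (unr G lb n) w \<in> insert Map.empty (unr G lb ` nodes G)" for w
    using subterm_unr[of G n w _ lb] subterm_unr_None[of G n w lb] path_end_nodes[OF assms, of w]
    by (cases "path_end G n w") auto
  moreover have "finite (insert Map.empty (unr G lb ` nodes G))"
    using assms(1) by (simp add: is_graph_def)
  ultimately show ?thesis
    unfolding rational_def by (meson finite_subset image_subsetI)
qed

text \<open>The parameter \<open>c\<close> says as which variables, if any, the variable nodes are read.\<close>

definition glab :: "('f, 'n) tgraph \<Rightarrow> ('n \<Rightarrow> 'v option) \<Rightarrow> 'n \<Rightarrow> ('f + 'v) option" where
  "glab G c m = (case lab G m of Some f \<Rightarrow> Some (Inl f) | None \<Rightarrow> map_option Inr (c m))"

definition aglab :: "('f, 'n) tgraph \<Rightarrow> ('n \<Rightarrow> (('f, 'v) trule \<times> bool) option) \<Rightarrow> ('n \<Rightarrow> 'v option) \<Rightarrow>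
    'n \<Rightarrow> (('f, 'v) alabel + 'v) option" where
  "aglab G \<alpha> c m = (case lab G m of Some f \<Rightarrow> Some (Inl (f, \<alpha> m)) | None \<Rightarrow> map_option Inr (c m))"

abbreviation "uterm G c \<equiv> unr G (glab G c)"
abbreviation "aterm G \<alpha> c \<equiv> unr G (aglab G \<alpha> c)"

lemma strip_aterm: "strip (aterm G \<alpha> c n) = uterm G c n"
proof -
  have "map_option (map_sum fst id) (aglab G \<alpha> c m) = glab G c m" for m
    by (cases "lab G m"; cases "c m") (simp_all add: aglab_def glab_def)
  then show ?thesis unfolding relab_unr by simp
qed

lemma plain_uterm: "plain (uterm G c n) = aterm G (\<lambda>_. None) c n"
proof -
  have "map_option (map_sum (\<lambda>f. (f, None)) id) (glab G c m) = aglab G (\<lambda>_. None) c m" for m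
    by (cases "lab G m"; cases "c m") (simp_all add: aglab_def glab_def)
  then show ?thesis unfolding relab_unr by simp
qed

lemma unravel_uterm: "unravel G n = uterm G Some n"
  by (rule ext) (simp add: unravel_def unr_def glab_def bind_split split: option.splits)

lemma glab_Inl: "glab G c m = Some (Inl f) \<longleftrightarrow> lab G m = Some f"
  by (cases "c m") (auto simp: glab_def split: option.splits)

lemma is_term_uterm:
  assumes "is_graph ar G"
  shows "is_term ar (uterm G c n)"
  unfolding is_term_def
proof (intro allI impI)
  fix w i assume "uterm G c n (w @ [i]) \<noteq> None"
  then obtain m ns where m: "path_end G n w = Some m" "sucs G m = Some ns" "1 \<le> i" "i \<le> length ns"
    by (auto simp: unr_def path_end_append bind_eq_None_conv split: option.splits if_splits)
  then obtain f where f: "lab G m = Some f" "length ns = ar f"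
    using assms unfolding is_graph_def by blast
  then have "uterm G c n w = Some (Inl f)" using m by (simp add: unr_at glab_def)
  then show "\<exists>f. uterm G c n w = Some (Inl f) \<and> 1 \<le> i \<and> i \<le> ar f" using f m by auto
qed

lemma unr_Cons:
  assumes "sucs G n = Some ns"
  shows "unr G lb n (i # w) = (if 1 \<le> i \<and> i \<le> length ns then unr G lb (ns ! (i - 1)) w else None)"
  using assms by (simp add: unr_def)

lemma unr_Cons_None: "sucs G n = None \<Longrightarrow> unr G lb n (i # w) = None"
  by (simp add: unr_def)

lemma subterm_unr_Cons:
  assumes "sucs G n = Some ns"
  shows "subterm (unr G lb n) [i] = (if 1 \<le> i \<and> i \<le> length ns then unr G lb (ns ! (i - 1)) else Map.empty)"
  using subterm_unr[of G n "[i]" _ lb] subterm_unr_None[of G n "[i]" lb] assms by auto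

lemma nth_in_nodes: "set ns \<subseteq> N \<Longrightarrow> 1 \<le> i \<Longrightarrow> i \<le> length ns \<Longrightarrow> ns ! (i - 1) \<in> N"
  by (metis One_nat_def Suc_le_lessD Suc_pred nth_mem subsetD zero_less_one order_less_le_trans)

text \<open>The premise on \<sigma> serves two purposes at once: renaming the variable nodes of a
  right-hand side, and erasing variable nodes in \<open>unravel_ground\<close>.\<close>

lemma subst_unravel:
  assumes G: "is_graph ar G" "n \<in> nodes G"
    and \<sigma>: "\<And>m. m \<in> nodes G \<Longrightarrow> lab G m = None \<Longrightarrow> \<sigma> m = (\<lambda>w. if w = [] then map_option Inr (c m) else None)"
  shows "subst (unravel G n) \<sigma> = uterm G c n"
proof
  show "subst (unravel G n) \<sigma> w = uterm G c n w" for w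
    using G(2)
  proof (induction w arbitrary: n)
    case Nil
    then show ?case using \<sigma>[of n] by (simp add: unravel_uterm glab_def split: option.splits)
  next
    case (Cons i w)
    show ?case
    proof (cases "lab G n")
      case None
      then show ?thesis
        using \<sigma>[OF Cons.prems None] sucs_None[OF G(1) None]
        by (simp add: unravel_uterm glab_def unr_Cons_None)
    next
      case (Some f)
      obtain ns where ns: "sucs G n = Some ns" "set ns \<subseteq> nodes G"
        by (rule sucs_Some[OF G(1) Some])
      have "subst (subterm (unravel G n) [i]) \<sigma> w = uterm G c n (i # w)"
        using Cons.IH[OF nth_in_nodes[OF ns(2), of i]] ns(1)
        by (simp add: unravel_uterm subterm_unr_Cons unr_Cons)
      moreover have "unravel G n [] = Some (Inl f)" using Some by (simp add: unravel_uterm glab_Inl)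
      ultimately show ?thesis by simp
    qed
  qed
qed

lemma unravel_ground_uterm:
  assumes "is_graph ar G" "n \<in> nodes G"
  shows "unravel_ground (G, n) = uterm G (\<lambda>_. None) n"
  unfolding unravel_ground_def unravel_pointed_def prod.case
  by (rule subst_unravel[OF assms]) auto

text \<open>A morphism may send an unlabelled node to a labelled one and so enlarge the unraveling.
  The left inverse \<open>k'\<close>, being a morphism too, excludes this.\<close>

lemma uterm_morphism:
  assumes C: "is_graph ar C" "morphism C C' k" "morphism C' C k'" "\<And>x. x \<in> nodes C \<Longrightarrow> k' (k x) = x"
    and C': "is_graph ar C'"
    and c: "\<And>m. m \<in> var_nodes C \<Longrightarrow> c' (k m) = c m"
    and n: "n \<in> nodes C"
  shows "uterm C' c' (k n) = uterm C c n"
proof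
  show "uterm C' c' (k n) w = uterm C c n w" for w
    using n
  proof (induction w arbitrary: n)
    case Nil
    show ?case
    proof (cases "lab C n")
      case None
      have "lab C' (k n) = None"
      proof (rule ccontr)
        assume "lab C' (k n) \<noteq> None"
        then have "lab C (k' (k n)) \<noteq> None"
          using C(2,3) Nil unfolding morphism_def by metis
        then show False using C(4)[OF Nil] None by simp
      qed
      then show ?thesis using None c[of n] Nil by (simp add: glab_def var_nodes_def)
    next
      case (Some f)
      then have "lab C' (k n) = Some f" using C(2) Nil unfolding morphism_def by simp
      then show ?thesis using Some by (simp add: glab_def)
    qed
  next
    case (Cons i w)
    show ?case
    proof (cases "lab C n")
      case None
      have "lab C' (k n) = None"
      proof (rule ccontr)
        assume "lab C' (k n) \<noteq> None"
        then have "lab C (k' (k n)) \<noteq> None"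
          using C(2,3) Cons.prems unfolding morphism_def by metis
        then show False using C(4)[OF Cons.prems] None by simp
      qed
      then show ?thesis
        using sucs_None[OF C(1) None] sucs_None[OF C'] by (simp add: unr_Cons_None)
    next
      case (Some f)
      obtain ns where ns: "sucs C n = Some ns" "set ns \<subseteq> nodes C"
        by (rule sucs_Some[OF C(1) Some])
      then have "sucs C' (k n) = Some (map k ns)" using C(2) Cons.prems Some unfolding morphism_def by simp
      then show ?thesis
        using ns Cons.IH[OF nth_in_nodes[OF ns(2), of i]] by (auto simp: unr_Cons)
    qed
  qed
qed

lemma morphism_path:
  assumes "is_graph ar L" "morphism L G g" "n \<in> nodes L" "path_end L n w = Some x"
  shows "path_end G (g n) w = Some (g x)"
  using assms(3,4)
proof (induction w arbitrary: n)
  case (Cons i w)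
  then obtain ns where ns: "sucs L n = Some ns" "1 \<le> i" "i \<le> length ns" "path_end L (ns ! (i - 1)) w = Some x"
    by (auto split: option.splits if_splits)
  then obtain f where f: "lab L n = Some f" using assms(1) unfolding is_graph_def by blast
  then have "set ns \<subseteq> nodes L" using assms(1) ns(1) unfolding is_graph_def by blast
  then have "ns ! (i - 1) \<in> nodes L" using ns by (intro nth_in_nodes)
  moreover have "sucs G (g n) = Some (map g ns)"
    using assms(2) Cons.prems(1) f ns(1) unfolding morphism_def by simp
  ultimately show ?case using Cons.IH ns by simp
qed simp

text \<open>Both \<open>k' \<circ> k\<close> and the identity mediate from the first pushout to
  itself, so they agree on its nodes.\<close>

lemma pushout_unique:
  assumes "is_pushout ar K A B f g C i j" "is_pushout ar K A B f g C' i' j'"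
  obtains k k' where "morphism C C' k" "morphism C' C k'" "\<And>x. x \<in> nodes C \<Longrightarrow> k' (k x) = x"
    "\<And>x. x \<in> nodes B \<Longrightarrow> k (j x) = j' x"
proof -
  have u: "\<exists>h. morphism C X h \<and> (\<forall>x \<in> nodes A. h (i x) = i' x) \<and> (\<forall>x \<in> nodes B. h (j x) = j' x) \<and>
     (\<forall>h'. morphism C X h' \<longrightarrow> (\<forall>x \<in> nodes A. h' (i x) = i' x) \<longrightarrow>
        (\<forall>x \<in> nodes B. h' (j x) = j' x) \<longrightarrow> (\<forall>x \<in> nodes C. h' x = h x))"
    if "is_pushout ar K A B f g C i j" "is_graph ar X" "morphism A X i'" "morphism B X j'"
      "\<forall>x \<in> nodes K. i' (f x) = j' (g x)" for C i j i' j' and X :: "('a, 'b) tgraph"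
    using that unfolding is_pushout_def by blast
  have C: "is_graph ar C" "morphism A C i" "morphism B C j" "\<forall>x \<in> nodes K. i (f x) = j (g x)"
    and C': "is_graph ar C'" "morphism A C' i'" "morphism B C' j'" "\<forall>x \<in> nodes K. i' (f x) = j' (g x)"
    using assms unfolding is_pushout_def by blast+
  obtain k where k: "morphism C C' k" "\<forall>x \<in> nodes A. k (i x) = i' x" "\<forall>x \<in> nodes B. k (j x) = j' x"
    using u[OF assms(1) C'] by blast
  obtain k' where k': "morphism C' C k'" "\<forall>x \<in> nodes A. k' (i' x) = i x" "\<forall>x \<in> nodes B. k' (j' x) = j x"
    using u[OF assms(2) C] by blast
  obtain h where h: "\<And>h'. morphism C C h' \<Longrightarrow> \<forall>x \<in> nodes A. h' (i x) = i x \<Longrightarrow>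
      \<forall>x \<in> nodes B. h' (j x) = j x \<Longrightarrow> \<forall>x \<in> nodes C. h' x = h x"
    using u[OF assms(1) C] by blast
  have "morphism C C (k' \<circ> k)"
    using k(1) k'(1) unfolding morphism_def by (auto simp: option.map_comp)
  then have 1: "\<forall>x \<in> nodes C. (k' \<circ> k) x = h x"
    by (rule h) (use k k' in auto)
  have "morphism C C id" unfolding morphism_def by (simp add: option.map_id)
  then have 2: "\<forall>x \<in> nodes C. id x = h x" by (rule h) auto
  show ?thesis
    using that[of k k'] k k' 1 2 by simp
qed


section \<open>Evaluation rules and direct derivations\<close>

locale eval_rule =
  fixes ar :: "'f \<Rightarrow> nat" and p :: "('f, 'n) grule"
  assumes eval: "evaluation_rule ar p"
begin

abbreviation "L \<equiv> lhs p"
abbreviation "R \<equiv> rhs p"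
abbreviation "root \<equiv> rt p"
abbreviation "r \<equiv> rmor p"

lemma graphs: "is_graph ar L" "is_graph ar (itf p)" "is_graph ar R"
  and tree: "is_tree L root"
  and itf: "itf p = unlabel L root"
  and r_morphism: "morphism (itf p) R r"
  and r_vars: "bij_betw r (var_nodes L) (var_nodes R)"
  and itf_morphism: "morphism (itf p) L id"
  using eval unfolding evaluation_rule_def by blast+

lemma nodes_itf [simp]: "nodes (itf p) = nodes L"
  by (simp add: itf unlabel_def)

lemma r_inj: "inj_on r (nodes L)"
  using eval unfolding evaluation_rule_def by simp

lemma root_node: "root \<in> nodes L"
  using tree by (simp add: is_tree_def)

text \<open>An unlabelled root has no successors, so the tree would be a single unlabelled
  node.\<close>

lemma root_labelled: "lab L root \<noteq> None"
proof
  assume n: "lab L root = None"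
  have "m = root" if m: "m \<in> nodes L" for m
  proof -
    obtain w where "path_end L root w = Some m" using tree m unfolding is_tree_def by blast
    then show ?thesis using sucs_None[OF graphs(1) n] by (cases w) auto
  qed
  then have "nodes L = {root}" using root_node by blast
  then show False using eval n unfolding evaluation_rule_def by blast
qed

lemma r_nodes: "x \<in> nodes L \<Longrightarrow> r x \<in> nodes R"
  using r_morphism by (simp add: morphism_def)

lemma r_unlabelled:
  assumes "y \<in> nodes R" "lab R y = None"
  obtains x where "x \<in> nodes L" "lab L x = None" "y = r x"
proof -
  have "y \<in> r ` var_nodes L" using r_vars assms by (auto simp: bij_betw_def var_nodes_def)
  then show ?thesis using that by (auto simp: var_nodes_def)
qed

text \<open>The variable nodes of \<open>R\<close> are already the images of those of
  \<open>L\<close>, so by injectivity a labelled node cannot go there. Applied to the root, which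
  has no label in the interface, this shows that the rule is not collapsing.\<close>

lemma r_labelled: "x \<in> nodes L \<Longrightarrow> lab R (r x) = None \<longleftrightarrow> lab L x = None"
proof
  assume x: "x \<in> nodes L"
  then show "lab R (r x) = None \<Longrightarrow> lab L x = None"
    by (metis inj_onD r_inj r_nodes r_unlabelled)
  show "lab L x = None \<Longrightarrow> lab R (r x) = None"
    using r_vars x by (auto simp: bij_betw_def var_nodes_def)
qed

definition rinv :: "'n \<Rightarrow> 'n" where
  "rinv y = (THE x. x \<in> var_nodes L \<and> r x = y)"

lemma rinv: "x \<in> var_nodes L \<Longrightarrow> rinv (r x) = x"
  unfolding rinv_def by (rule the_equality) (auto simp: var_nodes_def inj_onD[OF r_inj])

lemma fst_unravel_rule: "fst (unravel_rule p) = uterm L Some root"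
  by (simp add: unravel_rule_def unravel_uterm)

lemma snd_unravel_rule: "snd (unravel_rule p) = uterm R (\<lambda>y. Some (rinv y)) (r root)"
proof -
  have "subst (unravel R (r root)) (\<lambda>x. tvar (rinv x)) = uterm R (\<lambda>y. Some (rinv y)) (r root)"
    by (rule subst_unravel[OF graphs(3) r_nodes[OF root_node]]) (auto simp: tvar_def)
  then show ?thesis by (simp add: unravel_rule_def rinv_def)
qed

lemma rhs_root: "\<exists>f. snd (unravel_rule p) [] = Some (Inl f)"
  using r_labelled[OF root_node] root_labelled by (auto simp: snd_unravel_rule glab_Inl)

lemma rhs_rational: "rational (snd (unravel_rule p))"
  unfolding snd_unravel_rule by (rule rational_unr[OF graphs(3) r_nodes[OF root_node]])

lemma lhs_Inr: "fst (unravel_rule p) v = Some (Inr x) \<longleftrightarrow> path_end L root v = Some x \<and> lab L x = None"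
  unfolding fst_unravel_rule unr_def glab_def by (auto split: option.splits bind_splits)

lemma lhs_Inl: "fst (unravel_rule p) v = Some (Inl f) \<longleftrightarrow> (\<exists>x. path_end L root v = Some x \<and> lab L x = Some f)"
  unfolding fst_unravel_rule unr_def glab_def by (auto split: option.splits bind_splits)

lemma matches_morphism:
  assumes "morphism L G g"
  shows "matches (fst (unravel_rule p)) (uterm G c (g root))"
  unfolding matches_def
proof (intro allI impI)
  fix v f assume "fst (unravel_rule p) v = Some (Inl f)"
  then obtain x where x: "path_end L root v = Some x" "lab L x = Some f" by (auto simp: lhs_Inl)
  have "path_end G (g root) v = Some (g x)"
    by (rule morphism_path[OF graphs(1) assms root_node x(1)])
  moreover have "lab G (g x) = Some f"
    using assms x(2) path_end_nodes[OF graphs(1) root_node x(1)] unfolding morphism_def by simp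
  ultimately show "uterm G c (g root) v = Some (Inl f)" by (simp add: unr_at glab_def)
qed

text \<open>In the tree \<open>L\<close> a node is reached by exactly one path; \<open>g\<close>
  sends it to the end of the path with the same occurrence in \<open>G\<close>. That path exists
  because matching labels have equal arities.\<close>

lemma matching_morphism:
  assumes G: "is_graph ar G" "m \<in> nodes G" and m: "matches (fst (unravel_rule p)) (uterm G c m)"
  obtains g where "morphism L G g" "g root = m"
proof -
  define path where "path x = (THE w. path_end L root w = Some x)" for x
  have path: "path x = w" if "path_end L root w = Some x" for x w
  proof -
    have "x \<in> nodes L" by (rule path_end_nodes[OF graphs(1) root_node that])
    then have "\<exists>!w. path_end L root w = Some x" using tree unfolding is_tree_def by blast
    then show ?thesis unfolding path_def using that by (rule the1_equality)
  qed
  have ex: "\<exists>w. path_end L root w = Some x" if "x \<in> nodes L" for x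
    using tree that unfolding is_tree_def by blast
  define g where "g x = the (path_end G m (path x))" for x
  have lab: "lab G z = Some f" if "path_end L root w = Some x" "lab L x = Some f" "path_end G m w = Some z" for w x f z
  proof -
    have "uterm G c m w = Some (Inl f)" using m that(1,2) lhs_Inl unfolding matches_def by blast
    then show ?thesis using that(3) by (simp add: unr_at glab_Inl)
  qed
  have g: "path_end G m w = Some (g x)" if "path_end L root w = Some x" for w x
  proof -
    have "\<exists>z. path_end G m w = Some z"
      using that
    proof (induction w arbitrary: x rule: rev_induct)
      case (snoc i w)
      then obtain x' ns where x': "path_end L root w = Some x'" "sucs L x' = Some ns" "1 \<le> i" "i \<le> length ns"
        by (auto simp: path_end_append split: bind_splits option.splits if_splits)
      then obtain f where f: "lab L x' = Some f" "length ns = ar f"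
        using graphs(1) unfolding is_graph_def by blast
      obtain z where z: "path_end G m w = Some z" using snoc.IH[OF x'(1)] by blast
      then have "lab G z = Some f" using lab x' f by blast
      then obtain ns' where "sucs G z = Some ns'" "length ns' = ar f" by (rule sucs_Some[OF G(1)])
      then show ?case using z x' f by (simp add: path_end_append)
    qed simp
    then show ?thesis using path[OF that] by (auto simp: g_def)
  qed
  have "morphism L G g"
    unfolding morphism_def
  proof (intro conjI ballI impI)
    fix x assume x: "x \<in> nodes L"
    then obtain w where w: "path_end L root w = Some x" using ex by blast
    show "g x \<in> nodes G" by (rule path_end_nodes[OF G g[OF w]])
    assume "lab L x \<noteq> None"
    then obtain f where f: "lab L x = Some f" by blast
    have gf: "lab G (g x) = Some f" by (rule lab[OF w f g[OF w]])
    then show "lab G (g x) = lab L x" using f by simp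
    obtain ns where ns: "sucs L x = Some ns" "length ns = ar f" by (rule sucs_Some[OF graphs(1) f])
    obtain ns' where ns': "sucs G (g x) = Some ns'" "length ns' = ar f" by (rule sucs_Some[OF G(1) gf])
    have "ns' = map g ns"
    proof (rule nth_equalityI)
      fix i assume i: "i < length ns'"
      have "path_end L root (w @ [Suc i]) = Some (ns ! i)"
        using w ns ns' i by (simp add: path_end_append)
      then have "path_end G m (w @ [Suc i]) = Some (g (ns ! i))" by (rule g)
      then show "ns' ! i = map g ns ! i"
        using g[OF w] ns ns' i by (simp add: path_end_append)
    qed (simp add: ns ns')
    then show "sucs G (g x) = map_option (map g) (sucs L x)" using ns ns' by simp
  qed
  moreover have "g root = m" using g[of "[]" root] by simp
  ultimately show ?thesis by (rule that)
qed

text \<open>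
  The canonical result of a direct derivation: the root of the redex takes over the label and the
  successors of \<open>r root\<close>, and the nodes of \<open>R\<close> outside the image of \<open>r\<close> are added under fresh
  names \<open>\<iota>\<close>. Its track function is the identity.
\<close>

definition emb :: "('n \<Rightarrow> 'n) \<Rightarrow> ('n \<Rightarrow> 'n) \<Rightarrow> 'n \<Rightarrow> 'n" where
  "emb g \<iota> y = (if y \<in> r ` nodes L then g (inv_into (nodes L) r y) else \<iota> y)"

text \<open>\<open>r root\<close> counts as new although its image in the result is the old node
  \<open>g root\<close>: its label and successors come from \<open>R\<close>.\<close>

definition new_nodes :: "'n set" where
  "new_nodes = insert (r root) (nodes R - r ` nodes L)"

text \<open>\<open>emb\<close> need not be injective on all of \<open>R\<close>, since
  \<open>g\<close> may identify nodes. It is injective on \<open>new_nodes\<close>, and only there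
  is it inverted.\<close>

definition result :: "('n \<Rightarrow> 'n) \<Rightarrow> ('n \<Rightarrow> 'n) \<Rightarrow> ('f, 'n) tgraph \<Rightarrow> ('f, 'n) tgraph" where
  "result g \<iota> G =
    \<lparr>nodes = nodes G \<union> emb g \<iota> ` nodes R,
     sucs = (\<lambda>m. if m \<in> nodes G - {g root} then sucs G m
       else if m \<in> emb g \<iota> ` new_nodes then map_option (map (emb g \<iota>)) (sucs R (inv_into new_nodes (emb g \<iota>) m))
       else None),
     lab = (\<lambda>m. if m \<in> nodes G - {g root} then lab G m
       else if m \<in> emb g \<iota> ` new_nodes then lab R (inv_into new_nodes (emb g \<iota>) m)
       else None)\<rparr>"

lemma emb_r: "x \<in> nodes L \<Longrightarrow> emb g \<iota> (r x) = g x"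
  by (simp add: emb_def r_inj)

lemma new_nodes_R: "new_nodes \<subseteq> nodes R"
  using r_nodes[OF root_node] by (auto simp: new_nodes_def)

text \<open>\<open>not_root\<close> forbids identifying another labelled pattern node with the redex
  root: the context \<open>D\<close> has lost the label there, so \<open>g\<close> would not be a
  morphism on the interface. Variable nodes may well be mapped to \<open>g root\<close>, as happens
  in cyclic graphs.\<close>

context
  fixes G :: "('f, 'n) tgraph" and g \<iota> :: "'n \<Rightarrow> 'n"
  assumes G: "is_graph ar G" and g: "morphism L G g"
    and not_root: "\<And>x. x \<in> nodes L \<Longrightarrow> lab L x \<noteq> None \<Longrightarrow> g x = g root \<Longrightarrow> x = root"
    and fresh: "inj_on \<iota> (nodes R)" "\<iota> ` nodes R \<inter> nodes G = {}"
begin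

private abbreviation "H \<equiv> result g \<iota> G"
private abbreviation "D \<equiv> unlabel G (g root)"

lemma g_nodes: "x \<in> nodes L \<Longrightarrow> g x \<in> nodes G"
  using g by (simp add: morphism_def)

lemma emb_new:
  assumes "y \<in> nodes R - r ` nodes L"
  shows "emb g \<iota> y = \<iota> y" "emb g \<iota> y \<notin> nodes G"
  using assms fresh(2) by (auto simp: emb_def)

lemma inj_emb: "inj_on (emb g \<iota>) new_nodes"
proof (rule inj_onI)
  fix y z assume "y \<in> new_nodes" "z \<in> new_nodes" "emb g \<iota> y = emb g \<iota> z"
  then show "y = z"
    using emb_r[OF root_node, of g \<iota>] emb_new g_nodes[OF root_node] inj_onD[OF fresh(1)]
    unfolding new_nodes_def by (metis Diff_iff insert_iff)
qed

lemma emb_new_nodes: "y \<in> new_nodes \<Longrightarrow> emb g \<iota> y \<notin> nodes G - {g root}"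
  using emb_r[OF root_node, of g \<iota>] emb_new unfolding new_nodes_def by (metis Diff_iff insert_iff singletonI)

lemma nodes_result: "nodes H = nodes G \<union> emb g \<iota> ` nodes R"
  by (simp add: result_def)

lemma result_old:
  assumes "m \<in> nodes G" "m \<noteq> g root"
  shows "lab H m = lab G m" "sucs H m = sucs G m"
  using assms by (simp_all add: result_def)

lemma result_new:
  assumes "y \<in> new_nodes"
  shows "lab H (emb g \<iota> y) = lab R y" "sucs H (emb g \<iota> y) = map_option (map (emb g \<iota>)) (sucs R y)"
  using assms emb_new_nodes[OF assms] inv_into_f_f[OF inj_emb assms] by (auto simp: result_def)

lemma node_cases:
  assumes "m \<in> nodes H"
  obtains "m \<in> nodes G" "m \<noteq> g root" | y where "y \<in> new_nodes" "m = emb g \<iota> y"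
proof -
  consider "m \<in> nodes G - {g root}" | "m = g root" | y where "y \<in> nodes R" "m = emb g \<iota> y"
    using assms unfolding nodes_result by blast
  then show ?thesis
  proof cases
    case 2
    then show ?thesis using that(2)[of "r root"] emb_r[OF root_node, of g \<iota>] by (simp add: new_nodes_def)
  next
    case (3 y)
    show ?thesis
    proof (cases "y \<in> r ` nodes L")
      case True
      then obtain x where "x \<in> nodes L" "y = r x" by blast
      then have "m = g x" "x \<in> nodes L" using 3 emb_r by auto
      then show ?thesis
        using that(1) that(2)[of "r root"] g_nodes emb_r[OF root_node, of g \<iota>]
        by (cases "g x = g root") (auto simp: new_nodes_def)
    next
      case False
      then show ?thesis using that(2)[of y] 3 by (simp add: new_nodes_def)
    qed
  qed (use that in auto)
qed

lemma is_graph_result: "is_graph ar H"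
  unfolding is_graph_def
proof (intro conjI allI impI)
  show "finite (nodes H)"
    using G graphs(3) by (simp add: nodes_result is_graph_def)
  have dG: "lab G m = None \<longleftrightarrow> sucs G m = None" for m
    using G unfolding is_graph_def by blast
  have dR: "lab R m = None \<longleftrightarrow> sucs R m = None" for m
    using graphs(3) unfolding is_graph_def by blast
  show "dom (lab H) = dom (sucs H)"
  proof -
    have "lab H m = None \<longleftrightarrow> sucs H m = None" for m
      using dG dR by (simp add: result_def)
    then show ?thesis by (intro set_eqI) (simp only: domIff)
  qed
  show "dom (lab H) \<subseteq> nodes H"
  proof
    fix m assume "m \<in> dom (lab H)"
    then have "m \<in> nodes G - {g root} \<or> m \<in> emb g \<iota> ` new_nodes"
      by (auto simp: result_def dom_def split: if_splits)
    then show "m \<in> nodes H" using new_nodes_R unfolding nodes_result by blast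
  qed
  fix m f ns assume m: "lab H m = Some f" "sucs H m = Some ns"
  then have "m \<in> nodes H" using \<open>dom (lab H) \<subseteq> nodes H\<close> by blast
  then have "length ns = ar f \<and> set ns \<subseteq> nodes H"
  proof (cases rule: node_cases)
    case 1
    then show ?thesis
      using m result_old[OF 1] G unfolding is_graph_def nodes_result by (metis le_supI1)
  next
    case (2 y)
    then obtain ns' where "lab R y = Some f" "sucs R y = Some ns'" "ns = map (emb g \<iota>) ns'"
      using m result_new[OF 2(1)] by auto
    moreover then have "length ns' = ar f" "set ns' \<subseteq> nodes R"
      using graphs(3) unfolding is_graph_def by blast+
    ultimately show ?thesis unfolding nodes_result by auto
  qed
  then show "length ns = ar f" "set ns \<subseteq> nodes H" by auto
qed

lemma morphism_itf: "morphism (itf p) D g"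
  unfolding morphism_def
proof (intro conjI ballI impI)
  fix x assume x: "x \<in> nodes (itf p)"
  show "g x \<in> nodes D" using x g_nodes by (simp add: unlabel_def)
  assume "lab (itf p) x \<noteq> None"
  then have l: "x \<noteq> root" "lab L x \<noteq> None" by (auto simp: itf unlabel_def split: if_splits)
  then have "g x \<noteq> g root" using not_root x by auto
  then show "lab D (g x) = lab (itf p) x" "sucs D (g x) = map_option (map g) (sucs (itf p) x)"
    using l x g unfolding morphism_def by (auto simp: itf unlabel_def)
qed

lemma is_graph_context: "is_graph ar D"
  using G unfolding is_graph_def by (auto simp: unlabel_def dom_def split: if_splits)

lemma morphism_emb: "morphism R H (emb g \<iota>)"
  unfolding morphism_def
proof (intro conjI ballI impI)
  fix y assume y: "y \<in> nodes R"
  then show "emb g \<iota> y \<in> nodes H" by (simp add: nodes_result)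
  assume l: "lab R y \<noteq> None"
  have "lab H (emb g \<iota> y) = lab R y \<and> sucs H (emb g \<iota> y) = map_option (map (emb g \<iota>)) (sucs R y)"
  proof (cases "y \<in> new_nodes")
    case False
    then obtain x where x: "x \<in> nodes L" "y = r x" "x \<noteq> root" using y by (auto simp: new_nodes_def)
    have lx: "lab L x \<noteq> None" using l r_labelled[OF x(1)] x(2) by simp
    then have gx: "g x \<noteq> g root" using not_root[OF x(1)] x(3) by blast
    have "lab R y = lab L x" "sucs R y = map_option (map r) (sucs L x)"
      using r_morphism x lx unfolding morphism_def by (auto simp: itf unlabel_def)
    moreover obtain f where "lab L x = Some f" using lx by blast
    moreover then obtain ns where ns: "sucs L x = Some ns" "set ns \<subseteq> nodes L" by (rule sucs_Some[OF graphs(1)])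
    moreover have "lab G (g x) = lab L x" "sucs G (g x) = map_option (map g) (sucs L x)"
      using g x(1) lx unfolding morphism_def by auto
    ultimately show ?thesis
      using emb_r[OF x(1)] x(2) result_old[OF g_nodes[OF x(1)] gx] emb_r by auto
  qed (simp add: result_new)
  then show "lab H (emb g \<iota> y) = lab R y" "sucs H (emb g \<iota> y) = map_option (map (emb g \<iota>)) (sucs R y)"
    by auto
qed

text \<open>\<open>D\<close> and \<open>G\<close> have the same nodes, so \<open>j'\<close> itself
  mediates. Only the label at \<open>g root\<close> has to be checked, and \<open>i'\<close>
  provides it.\<close>

lemma left_pushout: "is_pushout ar (itf p) L D id g G g id"
  unfolding is_pushout_def
proof (intro conjI allI impI graphs is_graph_context G g morphism_itf)
  show "morphism (itf p) L id" by (rule itf_morphism)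
  show "morphism D G id"
    unfolding morphism_def by (auto simp: unlabel_def option.map_id)
  show "\<forall>x\<in>nodes (itf p). g (id x) = id (g x)" by simp
  fix X :: "('f, 'n) tgraph" and i' j'
  assume X: "is_graph ar X" "morphism L X i'" "morphism D X j'" "\<forall>x\<in>nodes (itf p). i' (id x) = j' (g x)"
  then have ij: "j' (g x) = i' x" if "x \<in> nodes L" for x using that by simp
  have "morphism G X j'"
    unfolding morphism_def
  proof (intro conjI ballI impI)
    fix m assume m: "m \<in> nodes G"
    then show "j' m \<in> nodes X" using X(3) by (simp add: morphism_def unlabel_def)
    assume l: "lab G m \<noteq> None"
    have "lab X (j' m) = lab G m \<and> sucs X (j' m) = map_option (map j') (sucs G m)"
    proof (cases "m = g root")
      case False
      then show ?thesis using X(3) m l by (simp add: morphism_def unlabel_def)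
    next
      case True
      obtain f where f: "lab L root = Some f" using root_labelled by blast
      then obtain ns where ns: "sucs L root = Some ns" "set ns \<subseteq> nodes L" by (rule sucs_Some[OF graphs(1)])
      have "lab G (g root) = Some f" "sucs G (g root) = Some (map g ns)"
        using g root_node f ns unfolding morphism_def by auto
      moreover have "lab X (i' root) = Some f" "sucs X (i' root) = Some (map i' ns)"
        using X(2) root_node f ns unfolding morphism_def by auto
      ultimately show ?thesis using True ij[OF root_node] ns ij by auto
    qed
    then show "lab X (j' m) = lab G m" "sucs X (j' m) = map_option (map j') (sucs G m)" by auto
  qed
  then show "\<exists>h. morphism G X h \<and> (\<forall>x\<in>nodes L. h (g x) = i' x) \<and> (\<forall>x\<in>nodes D. h (id x) = j' x) \<and>
    (\<forall>h'. morphism G X h' \<longrightarrow> (\<forall>x\<in>nodes L. h' (g x) = i' x) \<longrightarrow> (\<forall>x\<in>nodes D. h' (id x) = j' x) \<longrightarrow>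
      (\<forall>x\<in>nodes G. h' x = h x))"
    using ij by (intro exI[of _ j']) (auto simp: unlabel_def)
qed

text \<open>The mediating map \<open>k\<close> is \<open>j'\<close> on old nodes and
  \<open>i'\<close> on added ones. At \<open>g root\<close>, an old node labelled from
  \<open>R\<close>, the two agree because the test square commutes.\<close>

lemma right_pushout: "is_pushout ar (itf p) R D r g H (emb g \<iota>) id"
  unfolding is_pushout_def
proof (intro conjI allI impI graphs is_graph_context is_graph_result r_morphism morphism_itf morphism_emb)
  show "morphism D H id"
    unfolding morphism_def
    by (auto simp: unlabel_def option.map_id nodes_result result_old)
  show "\<forall>x\<in>nodes (itf p). emb g \<iota> (r x) = id (g x)" by (simp add: emb_r)
  fix X :: "('f, 'n) tgraph" and i' j'
  assume X: "is_graph ar X" "morphism R X i'" "morphism D X j'" "\<forall>x\<in>nodes (itf p). i' (r x) = j' (g x)"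
  then have ij: "j' (g x) = i' (r x)" if "x \<in> nodes L" for x using that by simp
  define k where "k m = (if m \<in> nodes G then j' m else i' (inv_into new_nodes (emb g \<iota>) m))" for m
  have kR: "k (emb g \<iota> y) = i' y" if "y \<in> nodes R" for y
  proof (cases "y \<in> r ` nodes L")
    case True
    then obtain x where "x \<in> nodes L" "y = r x" by blast
    then show ?thesis using emb_r ij g_nodes by (simp add: k_def)
  next
    case False
    then have y: "y \<in> new_nodes" "y \<in> nodes R - r ` nodes L" using that by (auto simp: new_nodes_def)
    then show ?thesis using emb_new(2)[OF y(2)] inv_into_f_f[OF inj_emb y(1)] by (simp add: k_def)
  qed
  have "morphism H X k"
    unfolding morphism_def
  proof (intro conjI ballI impI)
    fix m assume m: "m \<in> nodes H"
    have "j' m' \<in> nodes X" if "m' \<in> nodes G" for m'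
      using X(3) that unfolding morphism_def by (simp add: unlabel_def)
    moreover have "k (emb g \<iota> y) \<in> nodes X" if "y \<in> nodes R" for y
      using X(2) that unfolding morphism_def kR[OF that] by blast
    ultimately show "k m \<in> nodes X"
      using m unfolding nodes_result by (cases "m \<in> nodes G") (simp add: k_def, blast)
    assume l: "lab H m \<noteq> None"
    from m have "lab X (k m) = lab H m \<and> sucs X (k m) = map_option (map k) (sucs H m)"
    proof (cases rule: node_cases)
      case 1
      obtain f where f: "lab G m = Some f" using l result_old[OF 1] by auto
      then obtain ns where ns: "sucs G m = Some ns" "set ns \<subseteq> nodes G" by (rule sucs_Some[OF G])
      have "lab X (j' m) = Some f" "sucs X (j' m) = Some (map j' ns)"
        using X(3) 1 f ns unfolding morphism_def by (auto simp: unlabel_def)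
      then show ?thesis using result_old[OF 1] f ns 1 by (auto simp: k_def)
    next
      case (2 y)
      obtain f where f: "lab R y = Some f" using l result_new[OF 2(1)] 2(2) by auto
      then obtain ns where ns: "sucs R y = Some ns" "set ns \<subseteq> nodes R" by (rule sucs_Some[OF graphs(3)])
      have y: "y \<in> nodes R" using 2(1) new_nodes_R by blast
      have "lab X (i' y) = Some f" "sucs X (i' y) = Some (map i' ns)"
        using X(2) y f ns unfolding morphism_def by auto
      then show ?thesis using result_new[OF 2(1)] f ns 2(2) kR y by auto
    qed
    then show "lab X (k m) = lab H m" "sucs X (k m) = map_option (map k) (sucs H m)" by auto
  qed
  moreover have "k x = j' x" if "x \<in> nodes G" for x using that by (simp add: k_def)
  moreover have "h' x = k x"
    if h': "\<forall>x\<in>nodes R. h' (emb g \<iota> x) = i' x" "\<forall>x\<in>nodes D. h' (id x) = j' x" and x: "x \<in> nodes H" for h' x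
  proof (cases "x \<in> nodes G")
    case True
    then show ?thesis using h'(2) by (simp add: k_def unlabel_def)
  next
    case False
    then obtain y where "y \<in> nodes R" "x = emb g \<iota> y" using x unfolding nodes_result by blast
    then show ?thesis using h'(1) kR by metis
  qed
  ultimately show "\<exists>h. morphism H X h \<and> (\<forall>x\<in>nodes R. h (emb g \<iota> x) = i' x) \<and> (\<forall>x\<in>nodes D. h (id x) = j' x) \<and>
    (\<forall>h'. morphism H X h' \<longrightarrow> (\<forall>x\<in>nodes R. h' (emb g \<iota> x) = i' x) \<longrightarrow> (\<forall>x\<in>nodes D. h' (id x) = j' x) \<longrightarrow>
      (\<forall>x\<in>nodes H. h' x = h x))"
    using kR by (intro exI[of _ k]) (simp add: unlabel_def)
qed

lemma direct_derivation_result: "direct_derivation ar p g G id H"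
  unfolding direct_derivation_def Let_def using left_pushout right_pushout by blast

text \<open>Derivations create no variable nodes: an unlabelled node of \<open>R\<close> is the
  image of a variable of \<open>L\<close>, hence not new. So a reading \<open>c\<close> of the
  variable nodes of \<open>G\<close> also suits the result.\<close>

lemma var_nodes_result: "var_nodes H \<subseteq> var_nodes G"
proof
  fix m assume "m \<in> var_nodes H"
  then have m: "m \<in> nodes H" "lab H m = None" by (auto simp: var_nodes_def)
  from m(1) show "m \<in> var_nodes G"
  proof (cases rule: node_cases)
    case 1
    then show ?thesis using m(2) by (simp add: result_old var_nodes_def)
  next
    case (2 y)
    then have y: "y \<in> nodes R" "lab R y = None" using m(2) new_nodes_R by (auto simp: result_new)
    then obtain x where "x \<in> nodes L" "lab L x = None" "y = r x" by (rule r_unlabelled)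
    moreover have "x \<noteq> root" using root_labelled calculation(2) by blast
    then have "r x \<noteq> r root" using inj_onD[OF r_inj _ calculation(1) root_node] by blast
    ultimately have False using 2(1) by (simp add: new_nodes_def)
    then show ?thesis ..
  qed
qed

end

end


section \<open>Reduction of term graphs and of their unravelings\<close>

lemma fresh_names:
  assumes "infinite (UNIV :: 'n set)" "finite (A :: 'a set)" "finite (B :: 'n set)"
  obtains \<iota> :: "'a \<Rightarrow> 'n" where "inj_on \<iota> A" "\<iota> ` A \<inter> B = {}"
proof -
  have "infinite (UNIV - B)" using assms(1,3) by (rule Diff_infinite_finite[rotated])
  then obtain C where C: "finite C" "card C = card A" "C \<subseteq> UNIV - B"
    using infinite_arbitrarily_large by blast
  then obtain \<iota> where "bij_betw \<iota> A C" using finite_same_card_bij[OF assms(2)] by metis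
  then show ?thesis using that[of \<iota>] C(3) by (auto simp: bij_betw_def)
qed

locale term_graph_rewriting =
  fixes ar :: "'f \<Rightarrow> nat" and P :: "('f, 'n) grule set"
  assumes infinite_names: "infinite (UNIV :: 'n set)"
    and orthogonal: "orthogonal_tgrs ar P"
begin

lemma eval_rule: "p \<in> P \<Longrightarrow> eval_rule ar p"
  using orthogonal by (simp add: orthogonal_tgrs_def eval_rule_def)

sublocale noncollapsing_orthogonal ar "unravel_rule ` P"
proof
  show "orthogonal_trs ar (unravel_rule ` P)" "finite (unravel_rule ` P)"
    using orthogonal by (simp_all add: orthogonal_tgrs_def)
  fix R assume "R \<in> unravel_rule ` P"
  then show "\<exists>f. snd R [] = Some (Inl f)" "rational (snd R)"
    using eval_rule.rhs_root[OF eval_rule] eval_rule.rhs_rational[OF eval_rule] by auto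
qed

text \<open>If the pattern node at \<open>w\<close> is identified with the root, the unraveling from
  there equals its own subterm at \<open>w\<close>, so the rule overlaps itself at \<open>w\<close>.
  This needs substitutions by infinite terms in \<open>non_overlapping\<close>.\<close>

lemma pattern_node_eq_root:
  assumes p: "p \<in> P" and G: "is_graph ar (G :: ('f, 'n) tgraph)" and g: "morphism (lhs p) G g"
    and x: "x \<in> nodes (lhs p)" "lab (lhs p) x \<noteq> None" "g x = g (rt p)"
  shows "x = rt p"
proof -
  interpret E: eval_rule ar p by (rule eval_rule[OF p])
  define c :: "'n \<Rightarrow> 'n option" where "c = Some"
  obtain w where w: "path_end (lhs p) (rt p) w = Some x"
    using E.tree x(1) unfolding is_tree_def by blast
  obtain f where f: "lab (lhs p) x = Some f" using x(2) by blast
  have "path_end G (g (rt p)) w = Some (g x)"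
    by (rule morphism_path[OF E.graphs(1) g E.root_node w])
  then have "subterm (uterm G c (g (rt p))) w = uterm G c (g (rt p))"
    by (simp add: subterm_unr x(3))
  then have "w = []"
    using no_overlap[of "unravel_rule p" "unravel_rule p" "uterm G c (g (rt p))" w f]
      E.matches_morphism[OF g, of c] is_term_uterm[OF G] p w f by (auto simp: E.lhs_Inl)
  then show ?thesis using w by simp
qed

lemma well_annotated_aterm:
  assumes G: "is_graph ar G" "n \<in> nodes G"
    and red: "\<And>m R b. m \<in> nodes G \<Longrightarrow> \<alpha> m = Some (R, b) \<Longrightarrow>
      R \<in> unravel_rule ` P \<and> matches (fst R) (uterm G c m)"
  shows "well_annotated (aterm G \<alpha> c n)"
proof (rule well_annotatedI)
  show "is_term ar (strip (aterm G \<alpha> c n))"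
    unfolding strip_aterm by (rule is_term_uterm[OF G(1)])
  fix w f R b assume "aterm G \<alpha> c n w = Some (Inl (f, Some (R, b)))"
  then obtain m where m: "path_end G n w = Some m" "\<alpha> m = Some (R, b)"
    by (cases "path_end G n w") (auto simp: unr_def aglab_def split: option.splits)
  then show "R \<in> unravel_rule ` P \<and> matches (fst R) (subterm (strip (aterm G \<alpha> c n)) w)"
    unfolding strip_aterm subterm_unr[OF m(1)] using red path_end_nodes[OF G m(1)] by blast
qed

text \<open>The bridge between graphs and terms: one derivation contracts all occurrences of a node
  simultaneously and keeps the annotations of other nodes as residuals. Paths below the redex may
  return to \<open>g (rt p)\<close>, giving infinitely nested contractions; guardedness makes the
  induction on \<open>length w\<close> go through even then.\<close>

lemma dev_aterm:
  assumes p: "p \<in> P" and G: "is_graph ar G" and g: "morphism (lhs p) G g"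
    and \<iota>: "inj_on \<iota> (nodes (rhs p))" "\<iota> ` nodes (rhs p) \<inter> nodes G = {}"
    and root: "\<alpha> (g (rt p)) = Some (unravel_rule p, True)"
    and others: "\<And>m R. m \<in> nodes G \<Longrightarrow> \<alpha> m = Some (R, True) \<Longrightarrow> m = g (rt p)"
    and red: "\<And>m R b. m \<in> nodes G \<Longrightarrow> \<alpha> m = Some (R, b) \<Longrightarrow>
      R \<in> unravel_rule ` P \<and> matches (fst R) (uterm G c m)"
    and n: "n \<in> nodes G"
  shows "dev True (aterm G \<alpha> c n) =
    aterm (eval_rule.result p g \<iota> G) (\<lambda>m. if m \<in> nodes G \<and> m \<noteq> g (rt p) then \<alpha> m else None) c n"
proof -
  interpret E: eval_rule ar p by (rule eval_rule[OF p])
  define H where "H = E.result g \<iota> G"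
  define \<alpha>' where "\<alpha>' m = (if m \<in> nodes G \<and> m \<noteq> g (rt p) then \<alpha> m else None)" for m
  note ctx = G g pattern_node_eq_root[OF p G g] \<iota>
  have gn: "g x \<in> nodes G" if "x \<in> nodes (lhs p)" for x
    using g that by (simp add: morphism_def)
  have embH: "morphism (rhs p) H (E.emb g \<iota>)"
    unfolding H_def by (rule E.morphism_emb) (use ctx in blast)+
  have old: "lab H m = lab G m" "sucs H m = sucs G m" if "m \<in> nodes G" "m \<noteq> g (rt p)" for m
    unfolding H_def by (rule E.result_old; use ctx that in blast)+
  \<comment> \<open>An annotated inner node of the pattern would be a redex overlapping the one at
    the root.\<close>
  have interior: "\<alpha> (g x) = None" if x: "x \<in> nodes (lhs p)" "lab (lhs p) x \<noteq> None" "x \<noteq> rt p" for x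
  proof (rule ccontr)
    assume "\<alpha> (g x) \<noteq> None"
    then obtain R b where R: "\<alpha> (g x) = Some (R, b)" by auto
    obtain w where w: "path_end (lhs p) (rt p) w = Some x"
      using E.tree x(1) unfolding is_tree_def by blast
    obtain f where f: "lab (lhs p) x = Some f" using x(2) by blast
    have "path_end G (g (rt p)) w = Some (g x)"
      by (rule morphism_path[OF E.graphs(1) g E.root_node w])
    then have "subterm (uterm G c (g (rt p))) w = uterm G c (g x)" by (rule subterm_unr)
    then have "w = []"
      using no_overlap[of "unravel_rule p" R "uterm G c (g (rt p))" w f]
        E.matches_morphism[OF g, of c] is_term_uterm[OF G] p w f red[OF gn[OF x(1)] R]
      by (auto simp: E.lhs_Inl)
    then show False using w x(3) by simp
  qed
  \<comment> \<open>The right-hand side may reuse inner nodes of the pattern. As these are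
    unannotated, the embedded right-hand side looks like
    \<open>plain (snd (unravel_rule p))\<close>.\<close>
  have emb_ann: "\<alpha>' (E.emb g \<iota> y) = None" if y: "y \<in> nodes (rhs p)" "lab (rhs p) y \<noteq> None" for y
  proof (cases "y \<in> rmor p ` nodes (lhs p)")
    case True
    then obtain x where x: "x \<in> nodes (lhs p)" "y = rmor p x" by blast
    then have "lab (lhs p) x \<noteq> None" using y(2) E.r_labelled by simp
    then show ?thesis using interior x E.emb_r[OF x(1)] by (cases "x = rt p") (auto simp: \<alpha>'_def)
  next
    case False
    then have "E.emb g \<iota> y \<notin> nodes G" using \<iota>(2) y(1) by (auto simp: E.emb_def)
    then show ?thesis by (simp add: \<alpha>'_def)
  qed
  have rhs: "subst (aterm (rhs p) (\<lambda>_. None) (\<lambda>y. Some (E.rinv y)) y) (\<lambda>x. aterm H \<alpha>' c (g x)) w =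
      aterm H \<alpha>' c (E.emb g \<iota> y) w" if "y \<in> nodes (rhs p)" for y w
    using that
  proof (induction w arbitrary: y)
    case Nil
    show ?case
    proof (cases "lab (rhs p) y")
      case None
      obtain x where x: "x \<in> nodes (lhs p)" "lab (lhs p) x = None" "y = rmor p x"
        by (rule E.r_unlabelled[OF Nil None])
      have "aterm (rhs p) (\<lambda>_. None) (\<lambda>y. Some (E.rinv y)) y [] = Some (Inr x)"
        using None x E.rinv[of x] by (simp add: aglab_def var_nodes_def)
      then show ?thesis using E.emb_r[OF x(1)] x(3) by (simp add: subst_Inr_root del: subst.simps)
    next
      case (Some f)
      have "lab H (E.emb g \<iota> y) = Some f" using embH Nil Some unfolding morphism_def by simp
      then show ?thesis
        using Some emb_ann[OF Nil] by (simp add: aglab_def)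
    qed
  next
    case (Cons i w)
    show ?case
    proof (cases "lab (rhs p) y")
      case None
      obtain x where x: "x \<in> nodes (lhs p)" "lab (lhs p) x = None" "y = rmor p x"
        by (rule E.r_unlabelled[OF Cons.prems None])
      have "aterm (rhs p) (\<lambda>_. None) (\<lambda>y. Some (E.rinv y)) y [] = Some (Inr x)"
        using None x E.rinv[of x] by (simp add: aglab_def var_nodes_def)
      then show ?thesis using E.emb_r[OF x(1)] x(3) by (simp add: subst_Inr_root del: subst.simps)
    next
      case (Some f)
      obtain ns where ns: "sucs (rhs p) y = Some ns" "set ns \<subseteq> nodes (rhs p)"
        by (rule sucs_Some[OF E.graphs(3) Some])
      have H: "sucs H (E.emb g \<iota> y) = Some (map (E.emb g \<iota>) ns)"
        using embH Cons.prems Some ns unfolding morphism_def by simp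
      have "aterm (rhs p) (\<lambda>_. None) (\<lambda>y. Some (E.rinv y)) y [] = Some (Inl (f, None))"
        using Some by (simp add: aglab_def)
      then show ?thesis
        using Cons.IH[OF nth_in_nodes[OF ns(2), of i]]
        by (auto simp: unr_Cons[OF H] subterm_unr_Cons[OF ns(1)] nth_map)
    qed
  qed
  have "dev True (aterm G \<alpha> c n) w = aterm H \<alpha>' c n w" if "n \<in> nodes G" for n w
    using that
  proof (induction "length w" arbitrary: w n rule: less_induct)
    case less
    show ?case
    proof (cases "n = g (rt p)")
      case False
      have "contracted True (aterm G \<alpha> c n) = None"
        using others[OF less.prems] False
        by (auto simp: contracted_def aglab_def split: option.splits)
      note dv = dev_Nil[OF this] dev_Cons[OF this]
      show ?thesis
      proof (cases w)
        case Nil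
        have "\<alpha>' n = \<alpha> n" using less.prems False by (simp add: \<alpha>'_def)
        then show ?thesis using dv(1) old(1)[OF less.prems False] Nil
          by (cases "lab G n") (simp_all add: aglab_def)
      next
        case (Cons i u)
        show ?thesis
        proof (cases "lab G n")
          case None
          have "sucs G n = None" by (rule sucs_None[OF G None])
          then have "subterm (aterm G \<alpha> c n) [i] = Map.empty" "aterm H \<alpha>' c n (i # u) = None"
            using old(2)[OF less.prems False] subterm_unr_None[of G n "[i]"] by (auto simp: unr_Cons_None)
          then show ?thesis using Cons dv(2) by simp
        next
          case (Some f)
          obtain ns where ns: "sucs G n = Some ns" "set ns \<subseteq> nodes G" by (rule sucs_Some[OF G Some])
          have H: "sucs H n = Some ns" using old(2)[OF less.prems False] ns by simp
          show ?thesis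
            using Cons dv(2) less.hyps[OF _ nth_in_nodes[OF ns(2), of i], of u]
            by (simp add: subterm_unr_Cons[OF ns(1)] unr_Cons[OF H])
        qed
      qed
    next
      case True
      obtain f0 where f0: "lab (lhs p) (rt p) = Some f0" using E.root_labelled by blast
      then have lG: "lab G n = Some f0" using g E.root_node True unfolding morphism_def by simp
      have ct: "contracted True (aterm G \<alpha> c n) = Some (unravel_rule p)"
        using E.rhs_root root lG True by (auto simp: contracted_def aglab_def)
      obtain k where k: "plain (snd (unravel_rule p)) [] = Some (Inl (k, None))"
        by (rule plain_rhs_root[OF ct])
      have sub: "subterm (aterm G \<alpha> c n) (var_pos (fst (unravel_rule p)) x) = aterm G \<alpha> c (g x)"
        "x \<in> nodes (lhs p)" if "x \<in> tvars (snd (unravel_rule p))" for x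
      proof -
        have "fst (unravel_rule p) (var_pos (fst (unravel_rule p)) x) = Some (Inr x)"
          using var_pos_lhs(1)[OF _ that] p by blast
        then have pe: "path_end (lhs p) (rt p) (var_pos (fst (unravel_rule p)) x) = Some x"
          by (simp add: E.lhs_Inr)
        show "x \<in> nodes (lhs p)" by (rule path_end_nodes[OF E.graphs(1) E.root_node pe])
        show "subterm (aterm G \<alpha> c n) (var_pos (fst (unravel_rule p)) x) = aterm G \<alpha> c (g x)"
          unfolding True by (rule subterm_unr[OF morphism_path[OF E.graphs(1) g E.root_node pe]])
      qed
      \<comment> \<open>The default outside the pattern nodes makes the two substitutions comparable
        at every \<open>x\<close>, although the induction hypothesis speaks about nodes of
        \<open>G\<close> only.\<close>
      have "dev True (aterm G \<alpha> c n) = subst (plain (snd (unravel_rule p)))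
          (\<lambda>x. if x \<in> nodes (lhs p) then dev True (aterm G \<alpha> c (g x)) else Map.empty)"
        unfolding dev_Some[OF ct] by (rule subst_cong_vars) (simp add: tvars_relab sub)
      then have "dev True (aterm G \<alpha> c n) w = subst (plain (snd (unravel_rule p)))
          (\<lambda>x. if x \<in> nodes (lhs p) then dev True (aterm G \<alpha> c (g x)) else Map.empty) w"
        by simp
      also have "\<dots> = subst (plain (snd (unravel_rule p)))
          (\<lambda>x. if x \<in> nodes (lhs p) then aterm H \<alpha>' c (g x) else Map.empty) w"
        by (rule subst_word_op_cong[where s = "plain (snd (unravel_rule p))", OF k])
          (simp add: less.hyps gn)
      also have "\<dots> = subst (plain (snd (unravel_rule p))) (\<lambda>x. aterm H \<alpha>' c (g x)) w"
        by (rule arg_cong[of _ _ "\<lambda>t. t w"], rule subst_cong_vars) (simp add: tvars_relab sub)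
      also have "\<dots> = aterm H \<alpha>' c n w"
        unfolding E.snd_unravel_rule plain_uterm using rhs[OF E.r_nodes[OF E.root_node]] E.emb_r[OF E.root_node] True
        by simp
      finally show ?thesis .
    qed
  qed
  then show ?thesis using n unfolding H_def \<alpha>'_def by blast
qed

lemma canonical_derivation:
  assumes p: "p \<in> P" and G: "is_graph ar G" and g: "morphism (lhs p) G g"
  obtains H where "direct_derivation ar p g G id H" "is_graph ar H" "nodes G \<subseteq> nodes H"
    "var_nodes H \<subseteq> var_nodes G"
    "\<And>m. m \<in> nodes G \<Longrightarrow> m \<noteq> g (rt p) \<Longrightarrow> lab H m = lab G m"
    "\<And>\<alpha> c n. \<alpha> (g (rt p)) = Some (unravel_rule p, True) \<Longrightarrow>
      (\<And>m R. m \<in> nodes G \<Longrightarrow> \<alpha> m = Some (R, True) \<Longrightarrow> m = g (rt p)) \<Longrightarrow>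
      (\<And>m R b. m \<in> nodes G \<Longrightarrow> \<alpha> m = Some (R, b) \<Longrightarrow>
        R \<in> unravel_rule ` P \<and> matches (fst R) (uterm G c m)) \<Longrightarrow> n \<in> nodes G \<Longrightarrow>
      dev True (aterm G \<alpha> c n) =
      aterm H (\<lambda>m. if m \<in> nodes G \<and> m \<noteq> g (rt p) then \<alpha> m else None) c (n :: 'n)"
proof -
  interpret E: eval_rule ar p by (rule eval_rule[OF p])
  obtain \<iota> where \<iota>: "inj_on \<iota> (nodes (rhs p))" "\<iota> ` nodes (rhs p) \<inter> nodes G = {}"
    using fresh_names[OF infinite_names, of "nodes (rhs p)" "nodes G"] E.graphs(3) G
    unfolding is_graph_def by metis
  note ctx = G g pattern_node_eq_root[OF p G g] \<iota>
  show ?thesis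
  proof (rule that[of "E.result g \<iota> G"])
    show "direct_derivation ar p g G id (E.result g \<iota> G)"
      by (rule E.direct_derivation_result) (use ctx in blast)+
    show "is_graph ar (E.result g \<iota> G)"
      by (rule E.is_graph_result) (use ctx in blast)+
    show "nodes G \<subseteq> nodes (E.result g \<iota> G)"
      by (simp add: E.result_def)
    show "var_nodes (E.result g \<iota> G) \<subseteq> var_nodes G"
      by (rule E.var_nodes_result) (use ctx in blast)+
    show "lab (E.result g \<iota> G) m = lab G m" if "m \<in> nodes G" "m \<noteq> g (rt p)" for m
      using that by (simp add: E.result_def)
  qed (rule dev_aterm[OF p G g \<iota>])
qed

text \<open>An arbitrary result \<open>H\<close> is isomorphic to the canonical one, so it has the
  same unravelings provided that the track function respects the reading of variable nodes. This is
  trivial if they are undefined, and holds for names if \<open>b\<close> fixes them.\<close>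

lemma step_rat_par_step:
  fixes c :: "'n \<Rightarrow> 'n option"
  assumes d: "direct_derivation ar p g G b H" and p: "p \<in> P" and n: "n \<in> nodes G"
    and c: "\<And>m. m \<in> var_nodes G \<Longrightarrow> c (b m) = c m"
  shows "rat_par_step ar (unravel_rule ` P) (uterm G c n) (uterm H c (b n))"
    and "is_graph ar H" "b n \<in> nodes H"
proof -
  interpret E: eval_rule ar p by (rule eval_rule[OF p])
  define D where "D = unlabel G (g (rt p))"
  obtain h where po: "is_pushout ar (itf p) (rhs p) D (rmor p) g H h b"
    and "is_pushout ar (itf p) (lhs p) D id g G g id"
    using d unfolding direct_derivation_def D_def Let_def by blast
  then have G: "is_graph ar G" "morphism (lhs p) G g" and H: "is_graph ar H" "morphism D H b"
    unfolding is_pushout_def by blast+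
  have ND: "nodes D = nodes G" by (simp add: D_def unlabel_def)
  show "is_graph ar H" "b n \<in> nodes H" using H n ND by (auto simp: morphism_def)
  obtain H' where H': "direct_derivation ar p g G id H'" "is_graph ar H'" "nodes G \<subseteq> nodes H'"
    "var_nodes H' \<subseteq> var_nodes G"
    and dev: "\<And>\<alpha> n. \<alpha> (g (rt p)) = Some (unravel_rule p, True) \<Longrightarrow>
      (\<And>m R. m \<in> nodes G \<Longrightarrow> \<alpha> m = Some (R, True) \<Longrightarrow> m = g (rt p)) \<Longrightarrow>
      (\<And>m R b. m \<in> nodes G \<Longrightarrow> \<alpha> m = Some (R, b) \<Longrightarrow>
        R \<in> unravel_rule ` P \<and> matches (fst R) (uterm G c m)) \<Longrightarrow> n \<in> nodes G \<Longrightarrow>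
      dev True (aterm G \<alpha> c n) =
      aterm H' (\<lambda>m. if m \<in> nodes G \<and> m \<noteq> g (rt p) then \<alpha> m else None) c n"
    by (rule canonical_derivation[OF p G]) blast
  obtain h' where po': "is_pushout ar (itf p) (rhs p) D (rmor p) g H' h' id"
    using H'(1) unfolding direct_derivation_def D_def Let_def by blast
  obtain k k' where k: "morphism H' H k" "morphism H H' k'" "\<And>x. x \<in> nodes H' \<Longrightarrow> k' (k x) = x"
    "\<And>x. x \<in> nodes D \<Longrightarrow> k (id x) = b x"
    by (rule pushout_unique[OF po' po]) blast
  have kn: "k m = b m" if "m \<in> nodes G" for m using k(4)[of m] that ND by simp
  have "uterm H c (k n) = uterm H' c n"
  proof (rule uterm_morphism[OF H'(2) k(1,2,3) H(1)])
    fix m assume "m \<in> var_nodes H'"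
    then have "m \<in> var_nodes G" "m \<in> nodes G" using H'(4) by (auto simp: var_nodes_def)
    then show "c (k m) = c m" using c kn by simp
  qed (use n H'(3) in auto)
  then have UH: "uterm H c (b n) = uterm H' c n" using kn[OF n] by simp
  define \<alpha> where "\<alpha> m = (if m = g (rt p) then Some (unravel_rule p, True) else None)" for m
  have red: "R \<in> unravel_rule ` P \<and> matches (fst R) (uterm G c m)" if "\<alpha> m = Some (R, b)" for m R b
    using that p E.matches_morphism[OF G(2), of c] by (auto simp: \<alpha>_def split: if_splits)
  have wa: "well_annotated (aterm G \<alpha> c n)"
    by (rule well_annotated_aterm[OF G(1) n red])
  have "dev True (aterm G \<alpha> c n) = aterm H' (\<lambda>m. if m \<in> nodes G \<and> m \<noteq> g (rt p) then \<alpha> m else None) c n"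
    by (rule dev[OF _ _ red n]) (auto simp: \<alpha>_def split: if_splits)
  also have "\<dots> = aterm H' (\<lambda>_. None) c n"
    by (simp add: \<alpha>_def cong: if_cong)
  finally have "dev False (aterm G \<alpha> c n) = dev False (plain (uterm H' c n))"
    using dev_False_dev_True[OF wa] by (simp add: plain_uterm)
  \<comment> \<open>The only annotated node has been contracted, so the second pass does nothing and
    the full development is this single derivation.\<close>
  also have "\<dots> = plain (uterm H' c n)"
  proof (rule dev_inactive)
    show "contracted False (subterm (plain (uterm H' c n)) w) = None" for w
      by (cases "uterm H' c n w"; cases "the (uterm H' c n w)") (auto simp: contracted_def relab_def)
  qed
  finally show "rat_par_step ar (unravel_rule ` P) (uterm G c n) (uterm H c (b n))"
    using rat_par_stepI[OF wa rational_unr[OF G(1) n]] unfolding UH by (simp add: strip_aterm)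
qed

lemma dev_aterm_bits:
  fixes G :: "('f, 'n) tgraph" and c :: "'n \<Rightarrow> 'n option"
  assumes "\<And>m. map_option fst (\<alpha> m) = map_option fst (\<beta> m)"
  shows "strip (dev False (aterm G \<alpha> c n)) = strip (dev False (aterm G \<beta> c n))"
proof -
  have "annotation (aterm G \<alpha> c n) w = annotation (aterm G \<beta> c n) w" for w
    using assms by (cases "path_end G n w"; cases "lab G (the (path_end G n w))"; cases "c (the (path_end G n w))")
      (simp_all add: annotation_def unr_def aglab_def)
  then have "annotation (aterm G \<alpha> c n) = annotation (aterm G \<beta> c n)" by blast
  then show ?thesis
    using full_dev_annotation[of "aterm G \<alpha> c n"] full_dev_annotation[of "aterm G \<beta> c n"]
    by (simp add: strip_aterm)
qed

text \<open>Finitely many derivations, one for each node of \<open>A\<close>, perform a development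
  of possibly infinitely many occurrences. By the triangle property, contracting one node and then
  the residuals of the others gives the same term as contracting all.\<close>

lemma contract_nodes:
  fixes c :: "'n \<Rightarrow> 'n option"
  assumes "is_graph ar G" "n \<in> nodes G" "A \<subseteq> nodes G"
    and "\<And>m. m \<in> A \<Longrightarrow> \<rho> m \<in> unravel_rule ` P \<and> matches (fst (\<rho> m)) (uterm G c m)"
  shows "\<exists>H. (graph_step_names ar P)\<^sup>*\<^sup>* (G, n) (H, n) \<and> is_graph ar H \<and> n \<in> nodes H \<and>
    uterm H c n = strip (dev False (aterm G (\<lambda>m. if m \<in> A then Some (\<rho> m, False) else None) c n))"
  using assms
proof (induction "card A" arbitrary: A G)
  case 0
  then have "A = {}" using finite_subset[of A "nodes G"] by (simp add: is_graph_def)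
  have "dev False (plain (uterm G c n)) = plain (uterm G c n)"
  proof (rule dev_inactive)
    show "contracted False (subterm (plain (uterm G c n)) w) = None" for w
      by (cases "uterm G c n w"; cases "the (uterm G c n w)") (auto simp: contracted_def relab_def)
  qed
  then show ?case
    using 0 \<open>A = {}\<close> by (intro exI[of _ G]) (simp flip: plain_uterm)
next
  case (Suc k)
  then obtain a where a: "a \<in> A" by fastforce
  then obtain p where p: "p \<in> P" "\<rho> a = unravel_rule p" "matches (fst (unravel_rule p)) (uterm G c a)"
    using Suc.prems(4) by fastforce
  have aG: "a \<in> nodes G" using a Suc.prems(3) by blast
  interpret E: eval_rule ar p by (rule eval_rule[OF p(1)])
  obtain g where g: "morphism (lhs p) G g" "g (rt p) = a"
    by (rule E.matching_morphism[OF Suc.prems(1) aG p(3)])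
  define \<alpha> where "\<alpha> m = (if m \<in> A then Some (\<rho> m, m = a) else None)" for m
  define B where "B = A - {a}"
  have red: "R \<in> unravel_rule ` P \<and> matches (fst R) (uterm G c m)" if "\<alpha> m = Some (R, b)" for m R b
    using that Suc.prems(4)[of m] by (auto simp: \<alpha>_def split: if_splits)
  have wa: "well_annotated (aterm G \<alpha> c m)" if "m \<in> nodes G" for m
    by (rule well_annotated_aterm[OF Suc.prems(1) that red])
  obtain H where H: "direct_derivation ar p g G id H" "is_graph ar H" "nodes G \<subseteq> nodes H"
    and labH: "\<And>m. m \<in> nodes G \<Longrightarrow> m \<noteq> g (rt p) \<Longrightarrow> lab H m = lab G m"
    and dev: "\<And>\<alpha> n. \<alpha> (g (rt p)) = Some (unravel_rule p, True) \<Longrightarrow>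
      (\<And>m R. m \<in> nodes G \<Longrightarrow> \<alpha> m = Some (R, True) \<Longrightarrow> m = g (rt p)) \<Longrightarrow>
      (\<And>m R b. m \<in> nodes G \<Longrightarrow> \<alpha> m = Some (R, b) \<Longrightarrow>
        R \<in> unravel_rule ` P \<and> matches (fst R) (uterm G c m)) \<Longrightarrow> n \<in> nodes G \<Longrightarrow>
      dev True (aterm G \<alpha> c n) =
      aterm H (\<lambda>m. if m \<in> nodes G \<and> m \<noteq> g (rt p) then \<alpha> m else None) c n"
    by (rule canonical_derivation[OF p(1) Suc.prems(1) g(1)]) blast
  define \<beta> where "\<beta> m = (if m \<in> B then Some (\<rho> m, False) else None)" for m
  have \<beta>: "(\<lambda>m. if m \<in> nodes G \<and> m \<noteq> g (rt p) then \<alpha> m else None) = \<beta>"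
    using Suc.prems(3) by (auto simp: fun_eq_iff \<alpha>_def \<beta>_def B_def g(2))
  have dH: "dev True (aterm G \<alpha> c m) = aterm H \<beta> c m" if "m \<in> nodes G" for m
    unfolding \<beta>[symmetric]
  proof (rule dev[OF _ _ _ that])
    show "\<alpha> (g (rt p)) = Some (unravel_rule p, True)" using a p(2) by (simp add: \<alpha>_def g(2))
    show "m' = g (rt p)" if "\<alpha> m' = Some (R, True)" for m' R
      using that by (simp add: \<alpha>_def g(2) split: if_splits)
    show "R \<in> unravel_rule ` P \<and> matches (fst R) (uterm G c m')" if "\<alpha> m' = Some (R, b)" for m' R b
      using red that by blast
  qed
  \<comment> \<open>A remaining node keeps its label and hence its annotation, and developed terms
    are well annotated, so its pattern still matches in \<open>H\<close>.\<close>
  have IHp: "\<rho> m \<in> unravel_rule ` P \<and> matches (fst (\<rho> m)) (uterm H c m)" if m: "m \<in> B" for m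
  proof -
    have mG: "m \<in> nodes G" "m \<in> A" "m \<noteq> a" using m Suc.prems(3) by (auto simp: B_def)
    have S: "\<rho> m \<in> unravel_rule ` P" "matches (fst (\<rho> m)) (uterm G c m)"
      using Suc.prems(4)[OF mG(2)] by auto
    obtain f where "fst (\<rho> m) [] = Some (Inl f)" using lhs_root[OF S(1)] by blast
    then have "uterm G c m [] = Some (Inl f)" using S(2) unfolding matches_def by blast
    then have "lab H m = Some f" using labH[OF mG(1)] mG(3) g(2) by (simp add: glab_Inl)
    then have "aterm H \<beta> c m [] = Some (Inl (f, Some (\<rho> m, False)))"
      using m by (simp add: aglab_def \<beta>_def)
    moreover have "well_annotated (aterm H \<beta> c m)"
      using well_annotated_dev[OF wa[OF mG(1)]] dH[OF mG(1)] by simp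
    ultimately show ?thesis using well_annotated_matches[of "aterm H \<beta> c m" "[]" f "\<rho> m" False]
      by (simp add: strip_aterm)
  qed
  have "k = card B" using Suc.hyps(2) a by (simp add: B_def)
  then obtain H' where H': "(graph_step_names ar P)\<^sup>*\<^sup>* (H, n) (H', n)" "is_graph ar H'" "n \<in> nodes H'"
    "uterm H' c n = strip (dev False (aterm H \<beta> c n))"
    using Suc.hyps(1)[of B H] H(2,3) Suc.prems(2,3) IHp unfolding \<beta>_def B_def by blast
  have "graph_step_names ar P (G, n) (H, n)"
    unfolding graph_step_names_def prod.case
    by (intro bexI[of _ p] exI[of _ g] exI[of _ id] conjI H(1) p(1)) simp_all
  then have "(graph_step_names ar P)\<^sup>*\<^sup>* (G, n) (H', n)" using H'(1) by simp
  moreover have "strip (dev False (aterm H \<beta> c n)) = strip (dev False (aterm G \<alpha> c n))"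
    using dev_False_dev_True[OF wa[OF Suc.prems(2)]] dH[OF Suc.prems(2)] by simp
  moreover have "strip (dev False (aterm G \<alpha> c n)) =
    strip (dev False (aterm G (\<lambda>m. if m \<in> A then Some (\<rho> m, False) else None) c n))"
    by (rule dev_aterm_bits) (simp add: \<alpha>_def)
  ultimately show ?case using H'(2-4) by auto
qed

section \<open>Iterated full developments and cofinality\<close>

definition star :: "('f, 'n) pterm \<Rightarrow> ('f, 'n) pterm" where
  "star t = full_dev (all_redexes t) t"

text \<open>Being a redex depends on the subterm, hence on the node reached. So annotating all redex
  nodes of the graph annotates exactly all redex occurrences of its unraveling.\<close>

lemma graph_star:
  fixes c :: "'n \<Rightarrow> 'n option"
  assumes G: "is_graph ar G" "n \<in> nodes G"
  shows "\<exists>H. (graph_step_names ar P)\<^sup>*\<^sup>* (G, n) (H, n) \<and> is_graph ar H \<and> n \<in> nodes H \<and>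
    uterm H c n = star (uterm G c n)"
proof -
  define A where "A = {m \<in> nodes G. redex_rule (uterm G c m) \<noteq> None}"
  define \<rho> where "\<rho> m = the (redex_rule (uterm G c m))" for m
  define \<alpha> where "\<alpha> m = (if m \<in> A then Some (\<rho> m, False) else None)" for m
  have "\<rho> m \<in> unravel_rule ` P \<and> matches (fst (\<rho> m)) (uterm G c m)" if "m \<in> A" for m
    using that redex_rule_Some[OF is_term_uterm[OF G(1)], of c m "\<rho> m"] by (auto simp: A_def \<rho>_def)
  then obtain H where H: "(graph_step_names ar P)\<^sup>*\<^sup>* (G, n) (H, n)" "is_graph ar H" "n \<in> nodes H"
    "uterm H c n = strip (dev False (aterm G \<alpha> c n))"
    using contract_nodes[OF G, of A \<rho> c] unfolding \<alpha>_def A_def by blast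
  have "annotation (aterm G \<alpha> c n) w = all_redexes (uterm G c n) w" for w
  proof (cases "path_end G n w")
    case None
    have "redex_rule Map.empty = None"
    proof (rule ccontr)
      assume "redex_rule Map.empty \<noteq> None"
      then obtain R where "redex_rule Map.empty = Some R" by blast
      moreover have "is_term ar Map.empty" by (simp add: is_term_def)
      ultimately have "R \<in> unravel_rule ` P" "matches (fst R) (Map.empty :: ('f, 'n) pterm)"
        using redex_rule_Some by blast+
      then show False using lhs_root[of R] by (auto simp: matches_def)
    qed
    then show ?thesis
      unfolding all_redexes_def subterm_unr_None[OF None]
      by (simp add: annotation_def unr_def None)
  next
    case (Some m)
    have m: "m \<in> nodes G" by (rule path_end_nodes[OF G Some])
    have "lab G m \<noteq> None" if R: "redex_rule (uterm G c m) = Some R" for R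
    proof -
      have "R \<in> unravel_rule ` P" "matches (fst R) (uterm G c m)"
        using redex_rule_Some[OF is_term_uterm[OF G(1)]] R by blast+
      then have "\<exists>f. uterm G c m [] = Some (Inl f)" using lhs_root[of R] unfolding matches_def by blast
      then show ?thesis by (auto simp: glab_Inl)
    qed
    then show ?thesis
      using Some m by (cases "redex_rule (uterm G c m)"; cases "lab G m"; cases "c m")
        (auto simp: all_redexes_def subterm_unr annotation_def unr_at aglab_def \<alpha>_def A_def \<rho>_def)
  qed
  then have "annotation (aterm G \<alpha> c n) = all_redexes (uterm G c n)" by blast
  then have "star (uterm G c n) = strip (dev False (aterm G \<alpha> c n))"
    using full_dev_annotation[of "aterm G \<alpha> c n"] by (simp add: star_def strip_aterm)
  then show ?thesis using H by auto
qed

abbreviation red :: "('f, 'n) pterm \<Rightarrow> ('f, 'n) pterm \<Rightarrow> bool" where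
  "red \<equiv> rat_par_step ar (unravel_rule ` P)"

lemma red_star:
  assumes "is_term ar s" "red s t"
  shows "is_term ar t" "red t (star s)"
  using rat_par_step_triangle[OF assms] by (simp_all add: star_def)

lemma reds_term: "red\<^sup>*\<^sup>* s t \<Longrightarrow> is_term ar s \<Longrightarrow> is_term ar t"
  by (induction rule: rtranclp_induct) (blast intro: red_star(1))+

lemma star_term: "is_term ar t \<Longrightarrow> is_term ar (star t)"
  unfolding star_def by (rule full_dev_term[OF redexes_all])

text \<open>The triangle twice: a step from \<open>t\<close> to \<open>u\<close> yields one from
  \<open>u\<close> to \<open>star t\<close>, and this one yields a step from \<open>star t\<close>
  to \<open>star u\<close>.\<close>

lemma reds_star_mono:
  assumes "red\<^sup>*\<^sup>* s t" "is_term ar s"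
  shows "red\<^sup>*\<^sup>* (star s) (star t)"
  using assms
proof (induction rule: rtranclp_induct)
  case (step t u)
  have t: "is_term ar t" by (rule reds_term[OF step.hyps(1) step.prems])
  have "red u (star t)" "is_term ar u" using red_star[OF t step.hyps(2)] by auto
  then have "red (star t) (star u)" using red_star(2) by blast
  then show ?case using step.IH step.prems by simp
qed simp

text \<open>Induction from the front. If \<open>s\<close> steps to \<open>u\<close>, then
  \<open>u\<close> steps to \<open>star s\<close>; by monotonicity the \<open>k\<close>-th iterate
  from \<open>u\<close>, which \<open>t\<close> reaches, reduces to the \<open>k\<close>-th iterate
  from \<open>star s\<close>.\<close>

lemma reds_star_cofinal:
  assumes "red\<^sup>*\<^sup>* s t" "is_term ar s"
  shows "\<exists>k. red\<^sup>*\<^sup>* t ((star ^^ k) s)"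
  using assms
proof (induction rule: converse_rtranclp_induct)
  case base
  then show ?case by (intro exI[of _ 0]) simp
next
  case (step s u)
  have u: "is_term ar u" "red u (star s)" using red_star[OF step.prems step.hyps(1)] by auto
  then obtain k where k: "red\<^sup>*\<^sup>* t ((star ^^ k) u)" using step.IH by blast
  have it: "is_term ar (star s)" using red_star(1)[OF u] .
  have "red\<^sup>*\<^sup>* ((star ^^ k) u) ((star ^^ k) (star s)) \<and> is_term ar ((star ^^ k) u)"
  proof (induction k)
    case (Suc k)
    have "red\<^sup>*\<^sup>* ((star ^^ Suc k) u) ((star ^^ Suc k) (star s))"
      using reds_star_mono Suc by simp
    moreover have "is_term ar ((star ^^ Suc k) u)"
      using star_term Suc by simp
    ultimately show ?case by blast
  qed (use u in auto)
  then have "red\<^sup>*\<^sup>* t ((star ^^ Suc k) s)"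
    using rtranclp_trans[OF k] by (simp add: funpow_swap1)
  then show ?case by blast
qed

lemma graph_star_iterate:
  fixes c :: "'n \<Rightarrow> 'n option"
  assumes G: "is_graph ar G" "n \<in> nodes G"
  shows "\<exists>H. (graph_step_names ar P)\<^sup>*\<^sup>* (G, n) (H, n) \<and> is_graph ar H \<and> n \<in> nodes H \<and>
    uterm H c n = (star ^^ k) (uterm G c n)"
proof (induction k)
  case 0
  then show ?case using G by (intro exI[of _ G]) simp
next
  case (Suc k)
  then obtain H where H: "(graph_step_names ar P)\<^sup>*\<^sup>* (G, n) (H, n)" "is_graph ar H" "n \<in> nodes H"
    "uterm H c n = (star ^^ k) (uterm G c n)" by blast
  obtain H' where "(graph_step_names ar P)\<^sup>*\<^sup>* (H, n) (H', n)" "is_graph ar H'" "n \<in> nodes H'"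
    "uterm H' c n = star (uterm H c n)"
    using graph_star[OF H(2,3), of c] by blast
  then show ?case using H rtranclp_trans[OF H(1)] by (intro exI[of _ H']) simp
qed

lemma cofinality:
  fixes c :: "'n \<Rightarrow> 'n option"
  assumes G: "is_graph ar G" "n \<in> nodes G" and r: "red\<^sup>*\<^sup>* (uterm G c n) b"
  shows "\<exists>H. (graph_step_names ar P)\<^sup>*\<^sup>* (G, n) (H, n) \<and> is_graph ar H \<and> n \<in> nodes H \<and>
    red\<^sup>*\<^sup>* b (uterm H c n)"
  using reds_star_cofinal[OF r is_term_uterm[OF G(1)]] graph_star_iterate[OF G, of c] by metis

text \<open>A redex occurrence ends in a node, at which matching gives a morphism and the canonical
  construction a derivation. The converse fails in general: unreachable nodes may carry
  redexes.\<close>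

lemma normal_form:
  fixes c :: "'n \<Rightarrow> 'n option"
  assumes G: "is_graph ar G" "n \<in> nodes G" and nf: "graph_normal_form ar P (G, n)"
  shows "term_normal_form ar (unravel_rule ` P) (uterm G c n)"
  unfolding term_normal_form_def
proof
  assume "\<exists>w. \<exists>R\<in>unravel_rule ` P. is_redex ar (uterm G c n) (w, R)"
  then obtain w p where p: "p \<in> P" "is_redex ar (uterm G c n) (w, unravel_rule p)" by blast
  then have m: "matches (fst (unravel_rule p)) (subterm (uterm G c n) w)"
    using is_redex_iff[OF _ is_term_uterm[OF G(1)]] by blast
  obtain f where f: "fst (unravel_rule p) [] = Some (Inl f)" using lhs_root p(1) by blast
  then have "subterm (uterm G c n) w [] = Some (Inl f)" using m unfolding matches_def by blast
  then obtain m' where m': "path_end G n w = Some m'" by (cases "path_end G n w") (auto simp: unr_def)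
  interpret E: eval_rule ar p by (rule eval_rule[OF p(1)])
  obtain g where "morphism (lhs p) G g"
    using E.matching_morphism[OF G(1) path_end_nodes[OF G m']] m subterm_unr[OF m'] by metis
  then obtain H where "direct_derivation ar p g G id H"
    using canonical_derivation[OF p(1) G(1)] by metis
  then show False using nf p(1) by (auto simp: graph_normal_form_def)
qed

section \<open>Surjectivity of unraveling\<close>

text \<open>
  The graph of a rational term has the subterms at the occurrences in \<open>D\<close> as nodes. If \<open>D\<close> contains
  occurrences outside the term, the empty subterm is one of them and becomes a variable node.
\<close>

lemma uterm_surjective:
  fixes t :: "('f, 'n) pterm" and c :: "'n \<Rightarrow> 'n option"
  assumes t: "is_term ar t" "rational t"
    and D: "[] \<in> D" "\<And>w f i. w \<in> D \<Longrightarrow> t w = Some (Inl f) \<Longrightarrow> 1 \<le> i \<Longrightarrow> i \<le> ar f \<Longrightarrow> w @ [i] \<in> D"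
    and name: "inj_on name (subterm t ` D)"
    and c: "\<And>w. w \<in> D \<Longrightarrow> \<forall>f. t w \<noteq> Some (Inl f) \<Longrightarrow> map_option Inr (c (name (subterm t w))) = t w"
  shows "\<exists>G. is_graph ar G \<and> name t \<in> nodes G \<and> uterm G c (name t) = t"
proof -
  define N where "N = subterm t ` D"
  have name: "inj_on name N" using name by (simp add: N_def)
  define un where "un = inv_into N name"
  have un: "un (name s) = s" if "s \<in> N" for s
    unfolding un_def by (rule inv_into_f_f[OF name that])
  define l where "l s = (case s [] of Some (Inl f) \<Rightarrow> Some f | _ \<Rightarrow> None)" for s :: "('f, 'n) pterm"
  define G where "G = \<lparr>nodes = name ` N,
    sucs = (\<lambda>m. if m \<in> name ` N then map_option (\<lambda>f. map (\<lambda>i. name (subterm (un m) [i])) [1..<Suc (ar f)]) (l (un m)) else None),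
    lab = (\<lambda>m. if m \<in> name ` N then l (un m) else None)\<rparr>"
  have l: "l s = Some f \<longleftrightarrow> s [] = Some (Inl f)" for s f
    by (auto simp: l_def split: option.splits sum.splits)
  have Gs: "nodes G = name ` N" "\<And>s. s \<in> N \<Longrightarrow> lab G (name s) = l s"
    "\<And>s. s \<in> N \<Longrightarrow> sucs G (name s) = map_option (\<lambda>f. map (\<lambda>i. name (subterm s [i])) [1..<Suc (ar f)]) (l s)"
    by (simp_all add: G_def un)
  have "is_graph ar G"
    unfolding is_graph_def
  proof (intro conjI allI impI)
    have "N \<subseteq> range (subterm t)" by (auto simp: N_def)
    then show "finite (nodes G)" using t(2) finite_subset unfolding Gs(1) rational_def by blast
    show "dom (lab G) = dom (sucs G)" by (auto simp: G_def split: if_splits)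
    show "dom (lab G) \<subseteq> nodes G" by (auto simp: G_def split: if_splits)
    fix n f ns assume n: "lab G n = Some f" "sucs G n = Some ns"
    then have "n \<in> name ` N" by (simp add: G_def split: if_splits)
    then obtain w where w: "w \<in> D" "n = name (subterm t w)" unfolding N_def by blast
    then have f: "t w = Some (Inl f)" using n(1) Gs(2)[of "subterm t w"] l by (simp add: N_def)
    have ns: "ns = map (\<lambda>i. name (subterm t (w @ [i]))) [1..<Suc (ar f)]"
      using n Gs(2,3)[of "subterm t w"] w by (simp add: N_def del: upt_Suc)
    show "length ns = ar f" by (simp add: ns)
    have "w @ [i] \<in> D" if "i \<in> set [1..<Suc (ar f)]" for i
      using D(2)[OF w(1) f, of i] that by (auto simp del: upt_Suc)
    then show "set ns \<subseteq> nodes G" unfolding ns Gs(1) N_def by auto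
  qed
  moreover have "uterm G c (name (subterm t w)) u = t (w @ u)" if "w \<in> D" for w u
    using that
  proof (induction u arbitrary: w)
    case Nil
    have N: "subterm t w \<in> N" using Nil by (simp add: N_def)
    show ?case
    proof (cases "\<exists>f. t w = Some (Inl f)")
      case True
      then obtain f where f: "t w = Some (Inl f)" by blast
      then have "l (subterm t w) = Some f" by (simp add: l)
      then show ?thesis using Gs(2)[OF N] f by (simp add: glab_def)
    next
      case False
      then have "l (subterm t w) = None" using l[of "subterm t w"] by (cases "l (subterm t w)") auto
      then show ?thesis using Gs(2)[OF N] c[OF Nil] False by (simp add: glab_def)
    qed
  next
    case (Cons i u)
    have N: "subterm t w \<in> N" using Cons.prems by (simp add: N_def)
    show ?case
    proof (cases "\<exists>f. t w = Some (Inl f)")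
      case True
      then obtain f where f: "t w = Some (Inl f)" by blast
      then have "l (subterm t w) = Some f" by (simp add: l)
      then have s: "sucs G (name (subterm t w)) = Some (map (\<lambda>i. name (subterm t (w @ [i]))) [1..<Suc (ar f)])"
        using Gs(3)[OF N] by (simp del: upt_Suc)
      show ?thesis
      proof (cases "1 \<le> i \<and> i \<le> ar f")
        case True
        \<comment> \<open>Argument positions count from 1, list indices from 0.\<close>
        then have "map (\<lambda>i. name (subterm t (w @ [i]))) [1..<Suc (ar f)] ! (i - 1) = name (subterm t (w @ [i]))"
          by (subst nth_map_upt) auto
        moreover have "w @ [i] \<in> D" using D(2)[OF Cons.prems f] True by simp
        ultimately show ?thesis
          using Cons.IH[of "w @ [i]"] True unfolding unr_Cons[OF s] by (simp del: upt_Suc)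
      next
        case False
        then have "t (w @ [i]) = None" using is_term_snocD[OF t(1), of w i] f by fastforce
        then have "t (w @ i # u) = None" using is_term_None_below[OF t(1), of "w @ [i]" u] by simp
        then show ?thesis using False by (auto simp: unr_Cons[OF s] simp del: upt_Suc)
      qed
    next
      case False
      then have "l (subterm t w) = None" using l[of "subterm t w"] by (cases "l (subterm t w)") auto
      then have "sucs G (name (subterm t w)) = None" using Gs(3)[OF N] by simp
      moreover have "t (w @ i # u) = None"
        using is_term_prefix_op[OF t(1), of w "i # u"] False by blast
      ultimately show ?thesis by (simp add: unr_Cons_None)
    qed
  qed
  from this[OF D(1)] have "uterm G c (name t) = t" by (intro ext) simp
  moreover have "name t \<in> nodes G"
    unfolding Gs(1) N_def using D(1) by (intro imageI) (rule image_eqI[of _ _ "[]"], simp_all)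
  ultimately show ?thesis by blast
qed

lemma ground_image: "unravel_ground ` (pointed_graphs ar :: ('f, 'n) pgraph set) = CT_rat ar {}"
proof
  show "unravel_ground ` (pointed_graphs ar :: ('f, 'n) pgraph set) \<subseteq> CT_rat ar {}"
  proof
    fix t :: "('f, 'n) pterm" assume "t \<in> unravel_ground ` (pointed_graphs ar :: ('f, 'n) pgraph set)"
    then obtain G n where G: "is_graph ar G" "n \<in> nodes G" "t = unravel_ground (G, n)"
      by (auto simp: pointed_graphs_def)
    note t = G(3)[unfolded unravel_ground_uterm[OF G(1,2)]]
    have "tvars t = {}"
      unfolding t tvars_def unr_def glab_def by (auto split: option.splits bind_splits)
    then show "t \<in> CT_rat ar {}"
      using t is_term_uterm[OF G(1), of "\<lambda>_. None" n] rational_unr[OF G(1,2), of "glab G (\<lambda>_. None)"]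
      by (simp add: CT_rat_def CT_def)
  qed
  show "CT_rat ar {} \<subseteq> unravel_ground ` (pointed_graphs ar :: ('f, 'n) pgraph set)"
  proof
    fix t :: "('f, 'n) pterm" assume "t \<in> CT_rat ar {}"
    then have t: "is_term ar t" "rational t" and v: "tvars t = {}"
      by (auto simp: CT_rat_def CT_def)
    have fin: "finite (range (subterm t))" using t(2) by (simp add: rational_def)
    obtain name :: "('f, 'n) pterm \<Rightarrow> 'n"
      where name: "inj_on name (range (subterm t))" "name ` range (subterm t) \<inter> {} = {}"
      by (rule fresh_names[OF infinite_names fin finite.emptyI])
    have none: "map_option Inr None = t w" if "\<forall>f. t w \<noteq> Some (Inl f)" for w
    proof (cases "t w")
      case (Some y)
      then show ?thesis using that v by (cases y) (auto simp: tvars_def)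
    qed simp
    \<comment> \<open>Taking all words for \<open>D\<close> makes the empty subterm a node if an
      argument is missing; the constant reading \<open>None\<close> turns this variable node back
      into an undefined position.\<close>
    obtain G where "is_graph ar G" "name t \<in> nodes G" "uterm G (\<lambda>_. None) (name t) = t"
      using uterm_surjective[OF t, of UNIV name "\<lambda>_. None"] name(1) none by auto
    then show "t \<in> unravel_ground ` (pointed_graphs ar :: ('f, 'n) pgraph set)"
      using unravel_ground_uterm[of ar G "name t"]
      by (intro image_eqI[of _ _ "(G, name t)"]) (simp_all add: pointed_graphs_def)
  qed
qed

lemma total_image: "unravel_pointed ` (pointed_graphs ar :: ('f, 'n) pgraph set) = {t \<in> CT_rat ar UNIV. total_term ar t}"
proof
  show "unravel_pointed ` (pointed_graphs ar :: ('f, 'n) pgraph set) \<subseteq> {t \<in> CT_rat ar UNIV. total_term ar t}"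
  proof
    fix t :: "('f, 'n) pterm" assume "t \<in> unravel_pointed ` (pointed_graphs ar :: ('f, 'n) pgraph set)"
    then obtain G n where G: "is_graph ar G" "n \<in> nodes G" "t = uterm G Some n"
      by (auto simp: pointed_graphs_def unravel_pointed_def unravel_uterm)
    have gl: "glab G Some m \<noteq> None" for m by (simp add: glab_def split: option.splits)
    have "total_term ar t"
      unfolding total_term_def
    proof (intro conjI allI impI)
      show "t [] \<noteq> None" using gl G(3) by simp
      fix w f i assume w: "t w = Some (Inl f)" "1 \<le> i" "i \<le> ar f"
      then obtain m where m: "path_end G n w = Some m" "lab G m = Some f"
        using G(3) by (cases "path_end G n w") (auto simp: unr_def glab_Inl)
      obtain ns where "sucs G m = Some ns" "length ns = ar f" by (rule sucs_Some[OF G(1) m(2)])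
      then have "path_end G n (w @ [i]) = Some (ns ! (i - 1))"
        using m(1) w by (simp add: path_end_append)
      then show "t (w @ [i]) \<noteq> None" using gl G(3) by (simp add: unr_at)
    qed
    then show "t \<in> {t \<in> CT_rat ar UNIV. total_term ar t}"
      using G is_term_uterm[OF G(1), of Some n] rational_unr[OF G(1,2), of "glab G Some"]
      by (simp add: CT_rat_def CT_def)
  qed
  show "{t \<in> CT_rat ar UNIV. total_term ar t} \<subseteq> unravel_pointed ` (pointed_graphs ar :: ('f, 'n) pgraph set)"
  proof
    fix t :: "('f, 'n) pterm" assume "t \<in> {t \<in> CT_rat ar UNIV. total_term ar t}"
    then have t: "is_term ar t" "rational t" and tot: "total_term ar t"
      by (auto simp: CT_rat_def CT_def)
    have fin: "finite (range (subterm t))" using t(2) by (simp add: rational_def)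
    have "tvars t \<subseteq> (\<lambda>s. projr (the (s []))) ` range (subterm t)"
    proof
      fix x assume "x \<in> tvars t"
      then obtain w where "t w = Some (Inr x)" by (auto simp: tvars_def)
      then show "x \<in> (\<lambda>s. projr (the (s []))) ` range (subterm t)"
        by (intro image_eqI[of _ _ "subterm t w"]) simp_all
    qed
    then have fv: "finite (tvars t)" using finite_subset[OF _ finite_imageI[OF fin]] by blast
    obtain \<iota> :: "('f, 'n) pterm \<Rightarrow> 'n"
      where \<iota>: "inj_on \<iota> (range (subterm t))" "\<iota> ` range (subterm t) \<inter> tvars t = {}"
      by (rule fresh_names[OF infinite_names fin fv])
    \<comment> \<open>Under the reading \<open>Some\<close>, the node of a variable must bear the
      name of this variable; all other subterms get names that avoid the variables of
      \<open>t\<close>.\<close>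
    define name where "name s = (case s [] of Some (Inr x) \<Rightarrow> x | _ \<Rightarrow> \<iota> s)" for s :: "('f, 'n) pterm"
    have nv: "name (subterm t w) = x" if "t w = Some (Inr x)" for w x
      using that by (simp add: name_def)
    have no: "name (subterm t w) = \<iota> (subterm t w)" if "\<forall>x. t w \<noteq> Some (Inr x)" for w
      using that by (auto simp: name_def split: option.splits sum.splits)
    have sv: "subterm t w = tvar x" if "t w = Some (Inr x)" for w x
      using is_term_var_root[OF is_term_subterm[OF t(1)], of w x] that by simp
    have xv: "x \<in> tvars t" if "t w = Some (Inr x)" for w x using that by (auto simp: tvars_def)
    have fr: "\<iota> (subterm t w) \<notin> tvars t" for w using \<iota>(2) by blast
    have "subterm t w = subterm t u" if e: "name (subterm t w) = name (subterm t u)" for w u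
    proof (cases "\<exists>x. t w = Some (Inr x)")
      case True
      then obtain x where x: "t w = Some (Inr x)" by blast
      have "\<exists>y. t u = Some (Inr y)" using e nv[OF x] no[of u] fr[of u] xv[OF x] by metis
      then obtain y where y: "t u = Some (Inr y)" by blast
      then have "x = y" using e nv[OF x] nv[OF y] by simp
      then show ?thesis using sv[OF x] sv[OF y] by simp
    next
      case False
      then have w: "name (subterm t w) = \<iota> (subterm t w)" using no by blast
      have "\<forall>x. t u \<noteq> Some (Inr x)" using e w nv[of u] fr[of w] xv[of u] by metis
      then have "\<iota> (subterm t w) = \<iota> (subterm t u)" using e w no by metis
      then show ?thesis using inj_onD[OF \<iota>(1)] by blast
    qed
    then have name: "inj_on name (subterm t ` dom t)" by (intro inj_onI) auto
    have "\<exists>G. is_graph ar G \<and> name t \<in> nodes G \<and> uterm G Some (name t) = t"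
    \<comment> \<open>Restricting to \<open>dom t\<close> avoids a node for the empty subterm, which
      would be read as a variable; totality of \<open>t\<close> gives closure under
      arguments.\<close>
    proof (rule uterm_surjective[OF t _ _ name])
      show "[] \<in> dom t" using tot by (simp add: total_term_def domIff)
      show "w @ [i] \<in> dom t" if "t w = Some (Inl f)" "1 \<le> i" "i \<le> ar f" for w f i
        using tot that unfolding total_term_def domIff by blast
      show "map_option Inr (Some (name (subterm t w))) = t w" if "w \<in> dom t" "\<forall>f. t w \<noteq> Some (Inl f)" for w
      proof -
        have "t w \<noteq> None" using that(1) by (simp add: domIff)
        then have "\<exists>x. t w = Some (Inr x)" using that(2) by (metis option.exhaust sum.exhaust)
        then show ?thesis using nv by auto
      qed
    qed
    then obtain G where "is_graph ar G" "name t \<in> nodes G" "uterm G Some (name t) = t" by blast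
    then show "t \<in> unravel_pointed ` (pointed_graphs ar :: ('f, 'n) pgraph set)"
      by (intro image_eqI[of _ _ "(G, name t)"])
        (simp_all add: pointed_graphs_def unravel_pointed_def unravel_uterm)
  qed
qed

section \<open>The two adequacy statements\<close>

lemma ground_steps:
  assumes "(graph_step ar P)\<^sup>*\<^sup>* a a'" "a \<in> pointed_graphs ar"
  shows "a' \<in> pointed_graphs ar \<and> red\<^sup>*\<^sup>* (unravel_ground a) (unravel_ground a')"
  using assms
proof (induction rule: rtranclp_induct)
  case (step a' a'')
  obtain G n H m where a: "a' = (G, n)" "a'' = (H, m)" by fastforce
  have G: "is_graph ar G" "n \<in> nodes G" using step a by (auto simp: pointed_graphs_def)
  obtain p g b where d: "p \<in> P" "direct_derivation ar p g G b H" "b n = m"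
    using step.hyps(2) a by (auto simp: graph_step_def)
  note s = step_rat_par_step[OF d(2,1) G(2), of "\<lambda>_. None"]
  have "red (unravel_ground a') (unravel_ground a'')" "is_graph ar H" "m \<in> nodes H"
    using s d(3) unravel_ground_uterm[OF G] unravel_ground_uterm[of ar H m] a by auto
  then show ?case using step a by (auto simp: pointed_graphs_def)
qed simp

lemma named_steps:
  assumes "(graph_step_names ar P)\<^sup>*\<^sup>* a a'" "a \<in> pointed_graphs ar"
  shows "a' \<in> pointed_graphs ar \<and> red\<^sup>*\<^sup>* (unravel_pointed a) (unravel_pointed a')"
  using assms
proof (induction rule: rtranclp_induct)
  case (step a' a'')
  obtain G n H m where a: "a' = (G, n)" "a'' = (H, m)" by fastforce
  have G: "is_graph ar G" "n \<in> nodes G" using step a by (auto simp: pointed_graphs_def)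
  obtain p g b where d: "p \<in> P" "direct_derivation ar p g G b H" "b n = m" "\<forall>x\<in>var_nodes G. b x = x"
    using step.hyps(2) a by (auto simp: graph_step_names_def)
  have "Some (b m) = Some m" if "m \<in> var_nodes G" for m using d(4) that by simp
  note s = step_rat_par_step[OF d(2,1) G(2), of Some, OF this]
  have "red (unravel_pointed a') (unravel_pointed a'')" "is_graph ar H" "m \<in> nodes H"
    using s d(3) a by (auto simp: unravel_pointed_def unravel_uterm)
  then show ?case using step a by (auto simp: pointed_graphs_def)
qed simp

text \<open>The derivations built for cofinality have the identity as track function, hence keep
  names; this inclusion lets them serve the ground case as well.\<close>

lemma graph_steps_names: "(graph_step_names ar P)\<^sup>*\<^sup>* a a' \<Longrightarrow> (graph_step ar P)\<^sup>*\<^sup>* a a'"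
  by (rule rtranclp_mono[THEN predicate2D, rotated])
    (auto simp: graph_step_names_def graph_step_def)

lemma adequate_ground:
  "adequate (pointed_graphs ar) (graph_step ar P)\<^sup>*\<^sup>* (graph_normal_form ar P)
     (CT_rat ar {}) red\<^sup>*\<^sup>* (term_normal_form ar (unravel_rule ` P)) unravel_ground"
  unfolding adequate_def
proof (intro conjI ballI impI)
  show "unravel_ground ` (pointed_graphs ar :: ('f, 'n) pgraph set) = CT_rat ar {}" by (rule ground_image)
  show "red\<^sup>*\<^sup>* (unravel_ground a) (unravel_ground a')"
    if "a \<in> pointed_graphs ar" "(graph_step ar P)\<^sup>*\<^sup>* a a'" for a a' :: "('f, 'n) pgraph"
    using ground_steps that by blast
  fix a :: "('f, 'n) pgraph" assume "a \<in> pointed_graphs ar"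
  then obtain G n where a: "a = (G, n)" "is_graph ar G" "n \<in> nodes G" by (auto simp: pointed_graphs_def)
  have u: "unravel_ground a = uterm G (\<lambda>_. None) n" using unravel_ground_uterm a by simp
  show "term_normal_form ar (unravel_rule ` P) (unravel_ground a)" if "graph_normal_form ar P a"
    unfolding u by (rule normal_form[OF a(2,3)]) (use that a(1) in simp)
  fix b assume "red\<^sup>*\<^sup>* (unravel_ground a) b"
  then obtain H where H: "(graph_step_names ar P)\<^sup>*\<^sup>* (G, n) (H, n)" "is_graph ar H" "n \<in> nodes H"
    "red\<^sup>*\<^sup>* b (uterm H (\<lambda>_. None) n)"
    using cofinality[OF a(2,3), of "\<lambda>_. None" b] unfolding u by blast
  then show "\<exists>a'\<in>pointed_graphs ar. (graph_step ar P)\<^sup>*\<^sup>* a a' \<and> red\<^sup>*\<^sup>* b (unravel_ground a')"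
    using graph_steps_names a(1) unravel_ground_uterm[OF H(2,3)]
    by (intro bexI[of _ "(H, n)"]) (simp_all add: pointed_graphs_def)
qed

lemma adequate_total:
  "adequate (pointed_graphs ar) (graph_step_names ar P)\<^sup>*\<^sup>* (graph_normal_form ar P)
     {t \<in> CT_rat ar UNIV. total_term ar t} red\<^sup>*\<^sup>* (term_normal_form ar (unravel_rule ` P)) unravel_pointed"
  unfolding adequate_def
proof (intro conjI ballI impI)
  show "unravel_pointed ` (pointed_graphs ar :: ('f, 'n) pgraph set) = {t \<in> CT_rat ar UNIV. total_term ar t}" by (rule total_image)
  show "red\<^sup>*\<^sup>* (unravel_pointed a) (unravel_pointed a')"
    if "a \<in> pointed_graphs ar" "(graph_step_names ar P)\<^sup>*\<^sup>* a a'" for a a' :: "('f, 'n) pgraph"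
    using named_steps that by blast
  fix a :: "('f, 'n) pgraph" assume "a \<in> pointed_graphs ar"
  then obtain G n where a: "a = (G, n)" "is_graph ar G" "n \<in> nodes G" by (auto simp: pointed_graphs_def)
  have u: "unravel_pointed (H, m) = uterm H Some m" for H :: "('f, 'n) tgraph" and m
    by (simp add: unravel_pointed_def unravel_uterm)
  show "term_normal_form ar (unravel_rule ` P) (unravel_pointed a)" if "graph_normal_form ar P a"
    unfolding a(1) u by (rule normal_form[OF a(2,3)]) (use that a(1) in simp)
  fix b assume "red\<^sup>*\<^sup>* (unravel_pointed a) b"
  then obtain H where "(graph_step_names ar P)\<^sup>*\<^sup>* (G, n) (H, n)" "is_graph ar H" "n \<in> nodes H"
    "red\<^sup>*\<^sup>* b (uterm H Some n)"
    using cofinality[OF a(2,3), of Some b] unfolding a(1) u by blast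
  then show "\<exists>a'\<in>pointed_graphs ar. (graph_step_names ar P)\<^sup>*\<^sup>* a a' \<and> red\<^sup>*\<^sup>* b (unravel_pointed a')"
    using a(1) u by (intro bexI[of _ "(H, n)"]) (simp_all add: pointed_graphs_def)
qed

end

theorem theorem21:
  fixes ar :: "'f \<Rightarrow> nat" and P :: "('f, 'n) grule set"
  assumes infinite_nodes: "infinite (UNIV :: 'n set)"
    and orth: "orthogonal_tgrs ar P"
  shows "adequate
           (pointed_graphs ar) (graph_step ar P)\<^sup>*\<^sup>* (graph_normal_form ar P)
           (CT_rat ar {}) (rat_par_step ar (unravel_rule ` P))\<^sup>*\<^sup>*
             (term_normal_form ar (unravel_rule ` P))
           unravel_ground \<and>
         adequate
           (pointed_graphs ar) (graph_step_names ar P)\<^sup>*\<^sup>* (graph_normal_form ar P)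
           {t \<in> CT_rat ar UNIV. total_term ar t} (rat_par_step ar (unravel_rule ` P))\<^sup>*\<^sup>*
             (term_normal_form ar (unravel_rule ` P))
           unravel_pointed"
proof -
  interpret term_graph_rewriting ar P
    by unfold_locales (fact infinite_nodes, fact orth)
  show ?thesis using adequate_ground adequate_total by blast
qed

end
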